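(* Let $\{G(t)\}_{t\ge 0}$ be a $B$-strongly-connected sequence of directed graphs on $\{1,\dots,n\}$, and let each $f_i:\mathbb{R}^d\to\mathbb{R}$, $i=1,\dots,n$, be $\mu_i$-strongly convex with $\mu_i>0$. Let $F=\sum_{i=1}^n f_i$ and let $\mathbf{z}^*$ be the unique global minimizer of $F$. Consider the stochastic gradient-push iterates $\mathbf{x}_i(t),\mathbf{w}_i(t),\mathbf{z}_i(t),y_i(t)$ (defined in the context) with stepsize $\alpha(t)=\frac{p}{t}$ for $t\ge 1$, where the constant $p$ is such that $$p\,\frac{\sum_{i=1}^n\mu_i}{n}\ge 4 .$$ Suppose further that there exists a scalar $D$ such that, with probability $1$, $\sup_t\|\mathbf{z}_i(t)\|\le D$ for all $i$. Then there are scalars $\lambda\in(0,1)$ and $\delta>0$, which are functions of the graph sequence $\{G(t)\}$, satisfying $$\delta\ge\frac{1}{n^{nB}},\qquad \lambda\le\left(1-\frac{1}{n^{nB}}\right)^{1/(nB)},$$ such that for all $i=1,\dots,n$ and all $\tau\ge 2$, $$\mathbb{E}\left[F(\widehat{\mathbf{z}}_i(\tau))-F(\mathbf{z}^* )+\sum_{j=1}^n\mu_j\|\widehat{\mathbf{z}}_j(\tau)-\mathbf{z}^*\|^2\right]\le \frac{80L}{\tau\delta}\,\frac{\lambda}{1-\lambda}\sum_{j=1}^n\|\mathbf{x}_j(0)\|_1+\frac{80\,p\,L\,n\max_j B_j}{\tau\delta(1-\lambda)}\bigl(1+\ln(\tau-1)\bigr)+\frac{p}{\tau}\sum_{j=1}^n(L_j+c_j)^2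 ,$$ where $L_i$ is the largest possible Euclidean norm of any subgradient of $f_i$ on the ball of radius $D$ around the origin, $L=\sum_{j=1}^n L_j$, $B_i=\sqrt d\,(L_i+c_i)$ with $c_i$ the noise bound for node $i$, and $$\widehat{\mathbf{z}}_i(\tau)=\frac{\sum_{s=1}^{\tau}(s-1)\mathbf{z}_i(s)}{\tau(\tau-1)/2}.$$ Moreover, if each of the graphs $G(t)$ is regular, then the scalars $\delta$ and $\lambda$ in this bound satisfy $$\delta=1,\qquad \lambda\le\min\left\{\left(1-\frac{1}{4n^3}\right)^{1/B},\ \max_{t\ge 0}\sigma_2(A(t))\right\}.$$
   Context: Graphs. $G(t)$, $t=0,1,2,\dots$, are directed graphs with vertex set $\{1,\dots,n\}$ and edge set $E(t)$. $N_i^{\rm in}(t)$ and $N_i^{\rm out}(t)$ are the in- and out-neighborhoods of node $i$ at time $t$; by convention $i$ belongs to both. $d_i(t)=|N_i^{\rm out}(t)|$ is the out-degree (counting $i$ itself). The sequence is $B$-strongly-connected if $B$ is a positive integer such that for each $k\ge 0$ the graph with edge set $\bigcup_{t=kB}^{(k+1)B-1}E(t)$ is strongly connected. A directed graph $G(t)$ is regular if every out-degree and every in-degree of a node in $G(t)$ equals $d(t)$ for some $d(t)$. The matrix $A(t)$ is defined by $A_{ij}(t)=1/d_j(t)$ if $j\in N_i^{\rm in}(t)$ and $A_{ij}(t)=0$ otherwise; $\sigma_2(A)$ is the second-largest singular value of $A$. Strong convexity. A convex $f:\mathbb{R}^d\to\mathbb{R}$ is $\mu$-strongly convex ($\mu>0$)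 if $f(\mathbf{x})-f(\mathbf{y})\ge g(\mathbf{y})'(\mathbf{x}-\mathbf{y})+\frac{\mu}{2}\|\mathbf{x}-\mathbf{y}\|^2$ for all $\mathbf{x},\mathbf{y}\in\mathbb{R}^d$, where $g(\mathbf{y})$ is any subgradient of $f$ at $\mathbf{y}$. Noisy subgradients. Given a point $\mathbf{u}\in\mathbb{R}^d$, node $i$ can generate $\mathbf{g}_i(\mathbf{u})=\nabla f_i(\mathbf{u})+\mathbf{N}_i(\mathbf{u})$, where $\nabla f_i(\mathbf{u})$ denotes a subgradient of $f_i$ at $\mathbf{u}$ and $\mathbf{N}_i(\mathbf{u})$ is an independent random vector with $\mathbb{E}[\mathbf{N}_i(\mathbf{u})]=0$ (so that, in the algorithm below, the noise at step $t+1$ has zero conditional mean given all information generated by time $t$). For every $i$ there is a scalar $c_i>0$ such that, every time a noisy subgradient is generated, with probability 1 $\|\mathbf{N}_i(\mathbf{u})\|\le c_i$ for all $\mathbf{u}\in\mathbb{R}^d$. Stochastic gradient-push. Each node $i$ maintains $\mathbf{x}_i(t),\mathbf{w}_i(t),\mathbf{z}_i(t)\in\mathbb{R}^d$ and $y_i(t)\in\mathbb{R}$; the initial points $\mathbf{x}_i(0)$ are deterministic and $y_i(0)=1$. For all $t\ge 0$ and all $i$, $$\mathbf{w}_i(t+1)=\sum_{j\in N_i^{\rm in}(t)}\frac{\mathbf{x}_j(t)}{d_j(t)},\quad y_i(t+1)=\sum_{j\in N_i^{\rm in}(t)}\frac{y_j(t)}{d_j(t)},\quad \mathbf{z}_i(t+1)=\frac{\mathbf{w}_i(t+1)}{y_i(t+1)},\quad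 \mathbf{x}_i(t+1)=\mathbf{w}_i(t+1)-\alpha(t+1)\mathbf{g}_i(t+1),$$ where $\mathbf{g}_i(t+1)=\mathbf{g}_i(\mathbf{z}_i(t+1))$ and $\alpha(t+1)>0$ is the stepsize. $\|\cdot\|$ is the Euclidean norm and $\|\cdot\|_1$ the $1$-norm.
   Formalization: It is assumed that n ≥ 2, since for n = 1 the bound on λ forces λ ≤ 0; and λ = 0 is allowed exactly when all G(t) are regular and max_t σ₂(A(t)) = 0 (e.g. all graphs complete), where λ in (0,1) is impossible. *)

theory Defs
  imports "HOL-Probability.Probability" "HOL-Library.Multiset"
begin

text \<open>Directed graphs on the finite type \<open>'n\<close> are edge relations; \<open>(j, i) \<in> E\<close> is the edge from
  \<open>j\<close> to \<open>i\<close>. Every node counts as its own in- and out-neighbour, whether or not the loop is in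
  \<open>E\<close>.\<close>

definition in_nbhd :: "'n rel \<Rightarrow> 'n \<Rightarrow> 'n set" where
  "in_nbhd E i = insert i {j. (j, i) \<in> E}"

definition out_nbhd :: "'n rel \<Rightarrow> 'n \<Rightarrow> 'n set" where
  "out_nbhd E i = insert i {j. (i, j) \<in> E}"

definition out_deg :: "'n rel \<Rightarrow> 'n \<Rightarrow> nat" where
  "out_deg E i = card (out_nbhd E i)"

definition in_deg :: "'n rel \<Rightarrow> 'n \<Rightarrow> nat" where
  "in_deg E i = card (in_nbhd E i)"

definition strongly_connected :: "'n rel \<Rightarrow> bool" where
  "strongly_connected E \<longleftrightarrow> (\<forall>i j. (i, j) \<in> E\<^sup>*)"

definition B_strongly_connected :: "nat \<Rightarrow> (nat \<Rightarrow> 'n rel) \<Rightarrow> bool" where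
  "B_strongly_connected B E \<longleftrightarrow>
     0 < B \<and> (\<forall>k. strongly_connected (\<Union>t\<in>{k * B..<(k + 1) * B}. E t))"

definition regular_digraph :: "'n rel \<Rightarrow> bool" where
  "regular_digraph E \<longleftrightarrow> (\<exists>d. \<forall>i. out_deg E i = d \<and> in_deg E i = d)"

definition push_matrix :: "'n::finite rel \<Rightarrow> real^'n^'n" where
  "push_matrix E = (\<chi> i j. if j \<in> in_nbhd E i then 1 / real (out_deg E j) else 0)"

text \<open>The singular values of a square matrix \<open>A\<close>, in decreasing order: the \<open>s \<ge> 0\<close> such that \<open>s\<^sup>2\<close> is
  an eigenvalue of the symmetric matrix \<open>A\<^sup>T A\<close>, each repeated as often as the multiplicity
  of this eigenvalue (the dimension of its eigenspace).\<close>

definition gram_eigenspace :: "real^'n^'n \<Rightarrow> real \<Rightarrow> (real^'n) set" where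
  "gram_eigenspace A e = {v. (transpose A ** A) *v v = e *\<^sub>R v}"

definition singular_values :: "real^'n^'n \<Rightarrow> real list" where
  "singular_values A = rev (sorted_list_of_multiset
     (\<Sum>s\<in>{s. 0 \<le> s \<and> (\<exists>v\<in>gram_eigenspace A (s\<^sup>2). v \<noteq> 0)}.
        replicate_mset (dim (gram_eigenspace A (s\<^sup>2))) s))"

definition sigma2 :: "real^'n^'n \<Rightarrow> real" where
  "sigma2 A = singular_values A ! 1"

definition is_subgradient :: "('v::real_inner \<Rightarrow> real) \<Rightarrow> 'v \<Rightarrow> 'v \<Rightarrow> bool" where
  "is_subgradient f u g \<longleftrightarrow> (\<forall>x. f x \<ge> f u + g \<bullet> (x - u))"

definition strongly_convex :: "real \<Rightarrow> ('v::real_inner \<Rightarrow> real) \<Rightarrow> bool" where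
  "strongly_convex \<mu> f \<longleftrightarrow> 0 < \<mu> \<and> convex_on UNIV f \<and>
     (\<forall>x y g. is_subgradient f y g \<longrightarrow>
        f x - f y \<ge> g \<bullet> (x - y) + \<mu> / 2 * (norm (x - y))\<^sup>2)"

definition subgradient_bound :: "('v::real_inner \<Rightarrow> real) \<Rightarrow> real \<Rightarrow> real" where
  "subgradient_bound f D = Sup {norm g |u g. u \<in> cball 0 D \<and> is_subgradient f u g}"

definition norm1 :: "real^'d \<Rightarrow> real" where
  "norm1 v = (\<Sum>k\<in>UNIV. \<bar>v $ k\<bar>)"

text \<open>\<open>N t i u\<close> is the noise in the sample that node \<open>i\<close> draws at step \<open>t \<ge> 1\<close> at the point \<open>u\<close>.
  The samples of different nodes and different steps are independent. The noise is
  evaluated at random points (the iterates), so independence of the vectors \<open>N t i u\<close> for fixed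
  \<open>u\<close> would not be enough to make its conditional mean vanish there; instead \<open>S t i\<close>
  is the \<open>\<sigma>\<close>-algebra of the sample, and \<open>N t i\<close> is measurable jointly in the point and the
  sample.\<close>

definition independent_noise ::
  "'a measure \<Rightarrow> (nat \<Rightarrow> 'n \<Rightarrow> 'v \<Rightarrow> 'a \<Rightarrow> 'v::euclidean_space) \<Rightarrow> bool" where
  "independent_noise M N \<longleftrightarrow>
     (\<exists>S. (\<forall>t\<ge>1. \<forall>i. subalgebra M (S t i) \<and>
            (\<lambda>(u, \<omega>). N t i u \<omega>) \<in> borel_measurable (borel \<Otimes>\<^sub>M S t i)) \<and>
          prob_space.indep_sets M (\<lambda>(t, i). sets (S t i)) ({1..} \<times> UNIV)) \<and>
     (\<forall>t\<ge>1. \<forall>i u. (\<integral>\<omega>. N t i u \<omega> \<partial>M) = 0)"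

text \<open>One sample path of the algorithm. \<open>g t i u\<close> is what the oracle of node \<open>i\<close> returns at step \<open>t\<close>
  for the query point \<open>u\<close>. The values \<open>w 0\<close> and \<open>z 0\<close> do not exist in the algorithm and are
  left arbitrary.\<close>

definition gradient_push ::
  "(nat \<Rightarrow> 'n rel) \<Rightarrow> (nat \<Rightarrow> real) \<Rightarrow> (nat \<Rightarrow> 'n \<Rightarrow> 'v \<Rightarrow> 'v) \<Rightarrow>
   (nat \<Rightarrow> 'n \<Rightarrow> 'v::real_vector) \<Rightarrow> (nat \<Rightarrow> 'n \<Rightarrow> 'v) \<Rightarrow> (nat \<Rightarrow> 'n \<Rightarrow> real) \<Rightarrow>
   (nat \<Rightarrow> 'n \<Rightarrow> 'v) \<Rightarrow> bool" where
  "gradient_push E \<alpha> g x w y z \<longleftrightarrow>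
     (\<forall>i. y 0 i = 1) \<and>
     (\<forall>t i. w (t + 1) i = (\<Sum>j\<in>in_nbhd (E t) i. x t j /\<^sub>R real (out_deg (E t) j)) \<and>
            y (t + 1) i = (\<Sum>j\<in>in_nbhd (E t) i. y t j / real (out_deg (E t) j)) \<and>
            z (t + 1) i = w (t + 1) i /\<^sub>R y (t + 1) i \<and>
            x (t + 1) i = w (t + 1) i - \<alpha> (t + 1) *\<^sub>R g (t + 1) i (z (t + 1) i))"

definition weighted_average :: "(nat \<Rightarrow> 'v::real_vector) \<Rightarrow> nat \<Rightarrow> 'v" where
  "weighted_average z \<tau> =
     (\<Sum>s=1..\<tau>. (real s - 1) *\<^sub>R z s) /\<^sub>R (real \<tau> * (real \<tau> - 1) / 2)"

end

theory Submission
  imports Defs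
begin

text \<open>
  The proof separates the graphs from the optimization. All that is used of the graphs is a rate
  \<open>lam\<close> at which the products of the push matrices flatten zero-sum vectors (\<open>mixes\<close>) and a lower
  bound \<open>del\<close> for the push-sum weights.

  Without regularity, every product over \<open>n B\<close> steps has entries of at least \<open>e = 1 / n\<^bsup>n B\<^esup>\<close>, because
  the set of reached nodes grows in each window; Doeblin's argument then contracts the \<open>1\<close>-norm of
  zero-sum vectors by \<open>1 - e\<close>, and the weights never drop below \<open>e\<close>. For regular graphs the push
  matrices are doubly stochastic, all weights are \<open>1\<close>, and two estimates of the Euclidean norm
  compete. One step contracts by the second singular value, because the largest stretching factor
  on the complement of the constants is itself a singular value (\<open>doubly_stochastic_sigma2\<close>). One
  window contracts the squared norm by \<open>1 - 4 / n\<^sup>3\<close> (\<open>regular_window_contraction\<close>): each gap between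
  consecutive values of the initial vector survives until the first edge crosses it and then
  dissipates energy proportional to its square. All rates hold with the same constant, so their
  minimum is a rate as well (\<open>mixing_rate_exists\<close>).

  Given \<open>lam\<close> and \<open>del\<close>, the iterates minus the multiple of the weights with the same total form a
  zero-sum vector that is perturbed by the gradient steps. Hence the estimates \<open>z\<close> differ from the mean of
  the iterates by a geometrically weighted sum of past perturbations (\<open>consensus_error\<close>). The mean
  performs a noisy subgradient step. Strong convexity, used once to contract its distance to the
  minimizer and once to control the error at the estimates (\<open>descent\<close>), gives a recursion whose
  contraction factor \<open>1 - 2/(t + 1)\<close> telescopes under the weights \<open>t (t + 1)\<close>.

  The constant of the last term of the bound needs care. Estimating the squared norm of the \<open>n\<close> noise vectors
  together would lose a factor of \<open>2\<close>. The noise of a node is independent of the past and of the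
  noise of the other nodes, so that all mixed terms vanish in expectation (\<open>independent_mean_zero\<close>);
  then the noise contributes only \<open>(\<Sum> c\<^sub>j\<^sup>2) / n\<close>, and \<open>n \<ge> 2\<close> regains the factor.
\<close>

section \<open>Products of push matrices\<close>

definition push_prod :: "(nat \<Rightarrow> 'n::finite rel) \<Rightarrow> nat \<Rightarrow> nat \<Rightarrow> real^'n^'n" where
  "push_prod E s l = rec_nat (mat 1) (\<lambda>k P. push_matrix (E (s + k)) ** P) l"

lemma push_prod_0 [simp]: "push_prod E s 0 = mat 1"
  and push_prod_Suc: "push_prod E s (Suc l) = push_matrix (E (s + l)) ** push_prod E s l"
  by (simp_all add: push_prod_def)

lemma push_prod_add: "push_prod E s (l + m) = push_prod E (s + l) m ** push_prod E s l"
  by (induction m) (simp_all add: push_prod_Suc matrix_mul_assoc add.assoc)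

definition column_stochastic :: "real^'n^'n \<Rightarrow> bool" where
  "column_stochastic A \<longleftrightarrow> (\<forall>i j. 0 \<le> A $ i $ j) \<and> (\<forall>j. (\<Sum>i\<in>UNIV. A $ i $ j) = 1)"

lemma out_deg_pos: "0 < out_deg (E :: 'n::finite rel) i"
  by (auto simp: out_deg_def out_nbhd_def card_gt_0_iff)

lemma out_deg_le: "out_deg (E :: 'n::finite rel) i \<le> CARD('n)"
  by (auto simp: out_deg_def intro: card_mono)

lemma column_stochastic_push_matrix: "column_stochastic (push_matrix E)"
proof -
  have "(\<Sum>i\<in>UNIV. push_matrix E $ i $ j) = 1" for j
  proof -
    have "{i. j \<in> in_nbhd E i} = out_nbhd E j"
      by (auto simp: in_nbhd_def out_nbhd_def)
    then have "(\<Sum>i\<in>UNIV. push_matrix E $ i $ j) = real (card (out_nbhd E j)) / real (out_deg E j)"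
      by (simp add: push_matrix_def sum.If_cases)
    then show ?thesis
      using out_deg_pos[of E j] by (auto simp: out_deg_def card_gt_0_iff)
  qed
  then show ?thesis
    by (auto simp: column_stochastic_def push_matrix_def)
qed

lemma push_matrix_nonneg: "0 \<le> push_matrix E $ i $ j"
  by (simp add: push_matrix_def)

lemma push_matrix_lower:
  assumes "j \<in> in_nbhd E i"
  shows "1 / real CARD('n) \<le> push_matrix (E :: 'n::finite rel) $ i $ j"
  using assms out_deg_pos[of E j] out_deg_le[of E j] by (simp add: push_matrix_def frac_le)

lemma push_matrix_mult:
  "(push_matrix E *v v) $ i = (\<Sum>j\<in>in_nbhd E i. v $ j / real (out_deg E j))"
  by (simp add: push_matrix_def matrix_vector_mult_def if_distrib[of "\<lambda>x. x * _"] sum.If_cases)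

lemma sum_matrix_vector:
  assumes "column_stochastic A"
  shows "(\<Sum>i\<in>UNIV. (A *v v) $ i) = (\<Sum>j\<in>UNIV. v $ j)"
proof -
  have "(\<Sum>i\<in>UNIV. (A *v v) $ i) = (\<Sum>j\<in>UNIV. \<Sum>i\<in>UNIV. A $ i $ j * v $ j)"
    by (simp add: matrix_vector_mult_def) (rule sum.swap)
  also have "\<dots> = (\<Sum>j\<in>UNIV. v $ j)"
    using assms by (simp add: column_stochastic_def flip: sum_distrib_right)
  finally show ?thesis .
qed

lemma column_stochastic_mult:
  fixes A C :: "real^'n^'n"
  assumes "column_stochastic A" "column_stochastic C"
  shows "column_stochastic (A ** C)"
proof -
  have "(\<Sum>i\<in>UNIV. (A ** C) $ i $ j) = 1" for j
    using sum_matrix_vector[OF assms(1), of "\<chi> k. C $ k $ j"] assms(2)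
    by (simp add: column_stochastic_def matrix_matrix_mult_def matrix_vector_mult_def)
  then show ?thesis
    using assms by (auto simp: column_stochastic_def matrix_matrix_mult_def intro!: sum_nonneg)
qed

lemma column_stochastic_push_prod: "column_stochastic (push_prod E s l)"
proof (induction l)
  case 0
  then show ?case by (auto simp: column_stochastic_def mat_def)
next
  case (Suc l)
  then show ?case
    by (simp add: push_prod_Suc column_stochastic_mult column_stochastic_push_matrix)
qed

text \<open>Doeblin's argument: the common part \<open>e\<close> of all entries contributes nothing to the image of
  a zero-sum vector, and what remains has column sums \<open>1 - n e\<close>.\<close>

lemma norm1_column_stochastic_contraction:
  fixes A :: "real^'n^'n"
  assumes A: "column_stochastic A" and e: "\<And>i j. e \<le> A $ i $ j"
    and v: "(\<Sum>j\<in>UNIV. v $ j) = 0"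
  shows "norm1 (A *v v) \<le> (1 - real CARD('n) * e) * norm1 v"
proof -
  have "\<bar>(A *v v) $ i\<bar> \<le> (\<Sum>j\<in>UNIV. (A $ i $ j - e) * \<bar>v $ j\<bar>)" for i
  proof -
    have "(A *v v) $ i = (\<Sum>j\<in>UNIV. (A $ i $ j - e) * v $ j)"
      using v by (simp add: matrix_vector_mult_def algebra_simps sum_subtractf flip: sum_distrib_left)
    also have "\<bar>\<dots>\<bar> \<le> (\<Sum>j\<in>UNIV. \<bar>(A $ i $ j - e) * v $ j\<bar>)"
      by (rule sum_abs)
    also have "\<dots> = (\<Sum>j\<in>UNIV. (A $ i $ j - e) * \<bar>v $ j\<bar>)"
      using e by (simp add: abs_mult)
    finally show ?thesis .
  qed
  then have "norm1 (A *v v) \<le> (\<Sum>i\<in>UNIV. \<Sum>j\<in>UNIV. (A $ i $ j - e) * \<bar>v $ j\<bar>)"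
    unfolding norm1_def by (intro sum_mono)
  also have "\<dots> = (\<Sum>j\<in>UNIV. \<Sum>i\<in>UNIV. (A $ i $ j - e) * \<bar>v $ j\<bar>)"
    by (rule sum.swap)
  also have "\<dots> = (1 - real CARD('n) * e) * norm1 v"
    using A by (simp add: column_stochastic_def norm1_def sum_subtractf sum_distrib_left
        flip: sum_distrib_right)
  finally show ?thesis .
qed

lemma norm1_column_stochastic_le:
  fixes A :: "real^'n^'n"
  assumes "column_stochastic A" "(\<Sum>j\<in>UNIV. v $ j) = 0"
  shows "norm1 (A *v v) \<le> norm1 v"
  using norm1_column_stochastic_contraction[OF assms(1), of 0 v] assms
  by (auto simp: column_stochastic_def)

section \<open>Mixing under strong connectivity\<close>

text \<open>The nodes that a quantity starting in \<open>j\<close> at time \<open>s\<close> can occupy \<open>l\<close> steps later.\<close>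

definition reach :: "(nat \<Rightarrow> 'n rel) \<Rightarrow> nat \<Rightarrow> 'n \<Rightarrow> nat \<Rightarrow> 'n set" where
  "reach E s j l = rec_nat {j} (\<lambda>k R. {i. in_nbhd (E (s + k)) i \<inter> R \<noteq> {}}) l"

lemma reach_0: "reach E s j 0 = {j}"
  and reach_Suc: "reach E s j (Suc l) = {i. in_nbhd (E (s + l)) i \<inter> reach E s j l \<noteq> {}}"
  by (simp_all add: reach_def)

lemma reach_mono: "l \<le> m \<Longrightarrow> reach E s j l \<subseteq> reach E s j m"
  by (rule lift_Suc_mono_le[of "reach E s j"]) (auto simp: reach_Suc in_nbhd_def)

lemma push_prod_lower:
  fixes E :: "nat \<Rightarrow> 'n::finite rel"
  assumes "i \<in> reach E s j l"
  shows "(1 / real CARD('n)) ^ l \<le> push_prod E s l $ i $ j"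
  using assms
proof (induction l arbitrary: i)
  case 0
  then show ?case by (simp add: reach_0 mat_def)
next
  case (Suc l)
  then obtain k where k: "k \<in> in_nbhd (E (s + l)) i" "k \<in> reach E s j l"
    by (auto simp: reach_Suc)
  have nonneg: "0 \<le> push_matrix (E (s + l)) $ i $ k'" "0 \<le> push_prod E s l $ k' $ j" for k'
    using column_stochastic_push_matrix[of "E (s + l)"] column_stochastic_push_prod[of E s l]
    by (auto simp: column_stochastic_def)
  have "(1 / real CARD('n)) ^ Suc l \<le> push_matrix (E (s + l)) $ i $ k * push_prod E s l $ k $ j"
    unfolding power_Suc
    by (intro mult_mono push_matrix_lower k Suc.IH) (auto intro: nonneg)
  also have "\<dots> \<le> (\<Sum>k\<in>UNIV. push_matrix (E (s + l)) $ i $ k * push_prod E s l $ k $ j)"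
    by (rule member_le_sum) (auto intro!: mult_nonneg_nonneg nonneg)
  also have "\<dots> = push_prod E s (Suc l) $ i $ j"
    by (simp add: push_prod_Suc matrix_matrix_mult_def)
  finally show ?case .
qed

lemma crossing_edge:
  assumes "strongly_connected E" "i \<in> S" "k \<notin> S"
  obtains a b where "(a, b) \<in> E" "a \<in> S" "b \<notin> S"
proof -
  have "(i, k) \<in> E\<^sup>*"
    using assms by (auto simp: strongly_connected_def)
  then have "\<exists>a b. (a, b) \<in> E \<and> a \<in> S \<and> b \<notin> S"
    using assms(2,3)
  proof (induction rule: rtrancl_induct)
    case base
    then show ?case by simp
  next
    case (step y z)
    then show ?case by (cases "y \<in> S") auto
  qed
  then show ?thesis
    using that by blast
qed

lemma reach_window_grows:
  fixes E :: "nat \<Rightarrow> 'n::finite rel"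
  assumes conn: "strongly_connected (\<Union>t\<in>{k * B..<(k + 1) * B}. E t)"
    and s: "s + l = k * B" and ne: "reach E s j l \<noteq> UNIV"
  shows "reach E s j l \<subset> reach E s j (l + B)"
proof -
  have "j \<in> reach E s j l"
    using reach_mono[of 0 l E s j] by (auto simp: reach_0)
  moreover obtain b where "b \<notin> reach E s j l"
    using ne by auto
  ultimately obtain a b where ab: "(a, b) \<in> (\<Union>t\<in>{k * B..<(k + 1) * B}. E t)"
    "a \<in> reach E s j l" "b \<notin> reach E s j l"
    using crossing_edge[OF conn] by metis
  then obtain t where t: "k * B \<le> t" "t < (k + 1) * B" "(a, b) \<in> E t"
    by auto
  define m where "m = t - s"
  have m: "t = s + m" "l \<le> m" "Suc m \<le> l + B"
    using t s by (auto simp: m_def)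
  have "a \<in> reach E s j m"
    using ab(2) reach_mono[OF m(2), of E s j] by blast
  then have "b \<in> reach E s j (Suc m)"
    using t(3) by (auto simp: reach_Suc in_nbhd_def m(1))
  then have "b \<in> reach E s j (l + B)"
    using reach_mono[OF m(3), of E s j] by blast
  then show ?thesis
    using ab(3) reach_mono[of l "l + B" E s j] by auto
qed

lemma next_multiple:
  fixes B s :: nat
  assumes "0 < B"
  obtains k a where "s + a = k * B" "a < B"
proof (cases "s mod B = 0")
  case True
  then show ?thesis
    using that[of 0 "s div B"] assms by auto
next
  case False
  obtain q r where qr: "q = s div B" "r = s mod B" by blast
  have "s = q * B + r" "r < B"
    using assms by (auto simp: qr)
  then have "s + (B - s mod B) = (s div B + 1) * B"
    by (simp flip: qr)
  then show ?thesis
    using that[of "B - s mod B" "s div B + 1"] False assms by simp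
qed

text \<open>Any \<open>n B\<close> consecutive steps contain \<open>n - 1\<close> complete windows, and each of them enlarges a set that
  is not yet everything, because some edge of the window leaves it.\<close>

lemma reach_UNIV:
  fixes E :: "nat \<Rightarrow> 'n::finite rel"
  assumes "B_strongly_connected B E" and l: "CARD('n) * B \<le> l"
  shows "reach E s j l = UNIV"
proof -
  have B: "0 < B" and conn: "\<And>k. strongly_connected (\<Union>t\<in>{k * B..<(k + 1) * B}. E t)"
    using assms(1) by (auto simp: B_strongly_connected_def)
  obtain k0 a where a: "s + a = k0 * B" "a < B"
    using next_multiple[OF B] .
  have card: "min CARD('n) (Suc m) \<le> card (reach E s j (a + m * B))" for m
  proof (induction m)
    case 0
    have "{j} \<subseteq> reach E s j a"
      using reach_mono[of 0 a E s j] by (auto simp: reach_0)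
    then have "card {j} \<le> card (reach E s j a)"
      by (intro card_mono) auto
    then show ?case by simp
  next
    case (Suc m)
    show ?case
    proof (cases "reach E s j (a + m * B) = UNIV")
      case True
      then have "reach E s j (a + Suc m * B) = UNIV"
        using reach_mono[of "a + m * B" "a + Suc m * B" E s j] by auto
      then show ?thesis by simp
    next
      case False
      have "reach E s j (a + m * B) \<subset> reach E s j (a + m * B + B)"
        using a by (intro reach_window_grows[OF conn[of "k0 + m"]] False) (simp add: algebra_simps)
      then have "card (reach E s j (a + m * B)) < card (reach E s j (a + m * B + B))"
        by (intro psubset_card_mono) auto
      then show ?thesis
        using Suc.IH by (simp add: algebra_simps)
    qed
  qed
  have "CARD('n) - 1 + 1 = CARD('n)"
    by simp
  then have "CARD('n) \<le> card (reach E s j (a + (CARD('n) - 1) * B))"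
    using card[of "CARD('n) - 1"] by simp
  then have "reach E s j (a + (CARD('n) - 1) * B) = UNIV"
    by (intro card_subset_eq) (auto intro!: antisym card_mono)
  moreover have "a + (CARD('n) - 1) * B \<le> l"
  proof -
    have "a + (CARD('n) - 1) * B \<le> B + (CARD('n) - 1) * B"
      using a by simp
    also have "\<dots> = (CARD('n) - 1 + 1) * B"
      by (simp only: add_mult_distrib mult_1 add.commute)
    finally show ?thesis using l by simp
  qed
  ultimately show ?thesis
    using reach_mono[of "a + (CARD('n) - 1) * B" l E s j] by auto
qed

text \<open>The push products mix at rate \<open>lam\<close> when they flatten zero-sum vectors geometrically; the
  constant \<open>2\<close> pays for the incomplete blocks at the two ends of a time interval.\<close>

definition mixes :: "(nat \<Rightarrow> 'n::finite rel) \<Rightarrow> real \<Rightarrow> bool" where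
  "mixes E lam \<longleftrightarrow> (\<forall>s l v i. (\<Sum>j\<in>UNIV. v $ j) = 0 \<longrightarrow>
     \<bar>(push_prod E s l *v v) $ i\<bar> \<le> 2 * lam ^ l * norm1 v)"

lemma component_le_norm1: "\<bar>v $ i\<bar> \<le> norm1 v"
  unfolding norm1_def by (rule member_le_sum) auto

lemma norm1_nonneg: "0 \<le> norm1 v"
  by (simp add: norm1_def sum_nonneg)

context
  fixes E :: "nat \<Rightarrow> 'n::finite rel" and B n :: nat and e :: real
  assumes n: "n = CARD('n)" "2 \<le> n" and conn: "B_strongly_connected B E"
    and e: "e = 1 / real n ^ (n * B)"
begin

lemma e_bounds: "0 < e" "e \<le> 1 / 4"
proof -
  show "0 < e"
    using n e by simp
  have "B > 0"
    using conn by (simp add: B_strongly_connected_def)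
  then have "n \<le> n * B"
    by simp
  then have "2 \<le> n * B"
    using n(2) by (rule order_trans[rotated])
  then have "(2::nat) ^ 2 \<le> 2 ^ (n * B)"
    by (intro power_increasing) auto
  also have "\<dots> \<le> n ^ (n * B)"
    using n by (intro power_mono) auto
  finally have "4 \<le> n ^ (n * B)"
    by simp
  then have "real 4 \<le> real (n ^ (n * B))"
    by (rule of_nat_mono)
  then show "e \<le> 1 / 4"
    using n by (simp add: e field_simps)
qed

lemma push_prod_block_lower:
  assumes "l = n * B"
  shows "e \<le> push_prod E s l $ i $ j"
  using push_prod_lower[of i E s j l] reach_UNIV[OF conn, of l s j] assms n
  by (simp add: e power_one_over)

lemma norm1_push_blocks:
  assumes "(\<Sum>j\<in>UNIV. v $ j) = 0"
  shows "norm1 (push_prod E s (m * (n * B)) *v v) \<le> (1 - e) ^ m * norm1 v"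
proof (induction m)
  case 0
  then show ?case by simp
next
  case (Suc m)
  let ?u = "push_prod E s (m * (n * B)) *v v"
  have sum0: "(\<Sum>j\<in>UNIV. ?u $ j) = 0"
    using assms by (simp add: sum_matrix_vector column_stochastic_push_prod)
  have "norm1 (push_prod E s (Suc m * (n * B)) *v v)
      = norm1 (push_prod E (s + m * (n * B)) (n * B) *v ?u)"
    using push_prod_add[of E s "m * (n * B)" "n * B"]
    by (simp add: matrix_vector_mul_assoc add.commute)
  also have "\<dots> \<le> (1 - real CARD('n) * e) * norm1 ?u"
    by (intro norm1_column_stochastic_contraction column_stochastic_push_prod sum0
        push_prod_block_lower refl)
  also have "\<dots> \<le> (1 - e) * norm1 ?u"
    using e_bounds n by (intro mult_right_mono norm1_nonneg) auto
  also have "\<dots> \<le> (1 - e) * ((1 - e) ^ m * norm1 v)"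
    using e_bounds by (intro mult_left_mono Suc.IH) auto
  finally show ?case by simp
qed

lemma power_rate: "((1 - e) powr (1 / real (n * B))) ^ (n * B) = 1 - e"
proof -
  have "0 < n * B"
    using n conn by (auto simp: B_strongly_connected_def)
  then show ?thesis
    using e_bounds by (simp add: powr_power del: of_nat_mult)
qed

lemma mixes_strongly_connected: "mixes E ((1 - e) powr (1 / real (n * B)))"
  unfolding mixes_def
proof (intro allI impI)
  fix s l i and v :: "real^'n"
  assume v: "(\<Sum>j\<in>UNIV. v $ j) = 0"
  let ?lam = "(1 - e) powr (1 / real (n * B))"
  have pos: "0 < n * B"
    using n conn by (auto simp: B_strongly_connected_def)
  have lam: "0 < ?lam" "?lam \<le> 1"
    using e_bounds by (auto intro!: powr_le1)
  let ?m = "l div (n * B)" and ?r = "l mod (n * B)"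
  let ?u = "push_prod E s (?m * (n * B)) *v v"
  have split: "push_prod E s l *v v = push_prod E (s + ?m * (n * B)) ?r *v ?u"
    using push_prod_add[of E s "?m * (n * B)" ?r]
    unfolding div_mult_mod_eq by (simp add: matrix_vector_mul_assoc)
  have "\<bar>(push_prod E s l *v v) $ i\<bar> \<le> norm1 (push_prod E s l *v v)"
    by (rule component_le_norm1)
  also have "\<dots> \<le> norm1 ?u"
    unfolding split
    using v by (intro norm1_column_stochastic_le column_stochastic_push_prod)
      (simp add: sum_matrix_vector column_stochastic_push_prod)
  also have "\<dots> \<le> (1 - e) ^ ?m * norm1 v"
    by (rule norm1_push_blocks[OF v])
  also have "(1 - e) ^ ?m \<le> 2 * ?lam ^ l"
  proof -
    have "1 \<le> 2 * ?lam ^ (n * B)"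
      using e_bounds unfolding power_rate by simp
    also have "\<dots> \<le> 2 * ?lam ^ ?r"
      using lam pos by (intro mult_left_mono power_decreasing) (auto intro: less_imp_le)
    finally have "?lam ^ (n * B * ?m) * 1 \<le> ?lam ^ (n * B * ?m) * (2 * ?lam ^ ?r)"
      using lam by (intro mult_left_mono) auto
    also have "\<dots> = 2 * ?lam ^ (n * B * ?m + ?r)"
      by (simp only: power_add ac_simps)
    finally show ?thesis
      unfolding power_mult[of _ "n * B"] power_rate mult_div_mod_eq by simp
  qed
  then have "(1 - e) ^ ?m * norm1 v \<le> 2 * ?lam ^ l * norm1 v"
    by (intro mult_right_mono norm1_nonneg)
  finally show "\<bar>(push_prod E s l *v v) $ i\<bar> \<le> 2 * ?lam ^ l * norm1 v"
    by simp
qed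

text \<open>During the first \<open>n B\<close> steps the loops let every node keep at least \<open>1 / n\<close> of its weight per step;
  afterwards every node receives the fraction \<open>e\<close> of the total weight \<open>n\<close> that was present \<open>n B\<close>
  steps earlier.\<close>

lemma push_weight_lower: "e \<le> (push_prod E 0 t *v 1) $ i"
proof (cases "t \<le> n * B")
  case True
  have nonneg: "0 \<le> push_prod E 0 t $ i $ j" for j
    using column_stochastic_push_prod[of E 0 t] by (auto simp: column_stochastic_def)
  have "i \<in> reach E 0 i t"
    using reach_mono[of 0 t E 0 i] by (auto simp: reach_0)
  then have "(1 / real n) ^ t \<le> push_prod E 0 t $ i $ i"
    using push_prod_lower n by blast
  moreover have "(1 / real n) ^ (n * B) \<le> (1 / real n) ^ t"
    using n True by (intro power_decreasing) auto
  moreover have "push_prod E 0 t $ i $ i \<le> (push_prod E 0 t *v 1) $ i"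
    unfolding matrix_vector_mult_def using nonneg by (simp add: member_le_sum)
  ultimately show ?thesis
    by (simp add: e power_one_over)
next
  case False
  define s where "s = t - n * B"
  have t: "t = s + n * B"
    using False by (simp add: s_def)
  let ?y = "push_prod E 0 s *v 1"
  have y0: "0 \<le> ?y $ j" for j
    using column_stochastic_push_prod[of E 0 s]
    by (auto simp: column_stochastic_def matrix_vector_mult_def intro!: sum_nonneg)
  have "e * 1 \<le> e * (\<Sum>j\<in>UNIV. ?y $ j)"
    using n e_bounds by (intro mult_left_mono) (auto simp: sum_matrix_vector column_stochastic_push_prod)
  also have "\<dots> = (\<Sum>j\<in>UNIV. e * ?y $ j)"
    by (simp add: sum_distrib_left)
  also have "\<dots> \<le> (\<Sum>j\<in>UNIV. push_prod E s (n * B) $ i $ j * ?y $ j)"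
    by (intro sum_mono mult_right_mono push_prod_block_lower refl y0)
  also have "\<dots> = (push_prod E 0 t *v 1) $ i"
    using push_prod_add[of E 0 s "n * B"]
    unfolding t by (simp flip: matrix_vector_mul_assoc)
      (simp add: matrix_vector_mult_def[of "push_prod E s (n * B)"])
  finally show ?thesis by simp
qed

end

section \<open>The second singular value of a doubly stochastic matrix\<close>

lemma gram_inner: "(transpose A ** A *v u) \<bullet> v = (A *v u) \<bullet> ((A :: real^'n^'n) *v v)"
  by (metis dot_lmul_matrix matrix_vector_mul_assoc transpose_matrix_vector)

lemma finite_nonzero_pairwise_orthogonal:
  fixes S :: "'v::euclidean_space set"
  assumes "\<And>u v. u \<in> S \<Longrightarrow> v \<in> S \<Longrightarrow> u \<noteq> v \<Longrightarrow> u \<bullet> v = 0" "0 \<notin> S"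
  shows "finite S"
proof -
  have "pairwise orthogonal S"
    using assms(1) by (auto simp: pairwise_def orthogonal_def)
  then show ?thesis
    using assms(2) by (intro independent_imp_finite pairwise_orthogonal_independent)
qed

text \<open>The list of singular values is a sum over this set, which would collapse if the set were infinite.\<close>

lemma finite_singular_values:
  fixes A :: "real^'n^'n"
  shows "finite {s. 0 \<le> s \<and> (\<exists>v\<in>gram_eigenspace A (s\<^sup>2). v \<noteq> 0)}" (is "finite ?S")
proof -
  define v where "v s = (SOME v. v \<in> gram_eigenspace A (s\<^sup>2) \<and> v \<noteq> 0)" for s
  have v: "v s \<in> gram_eigenspace A (s\<^sup>2)" "v s \<noteq> 0" if "s \<in> ?S" for s
    using that someI_ex[of "\<lambda>v. v \<in> gram_eigenspace A (s\<^sup>2) \<and> v \<noteq> 0"] by (auto simp: v_def)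
  have orth: "v s \<bullet> v t = 0" if "s \<in> ?S" "t \<in> ?S" "s \<noteq> t" for s t
  proof -
    have "s\<^sup>2 * (v s \<bullet> v t) = (transpose A ** A *v v s) \<bullet> v t"
      using v(1)[OF that(1)] by (simp add: gram_eigenspace_def)
    also have "\<dots> = (transpose A ** A *v v t) \<bullet> v s"
      by (metis gram_inner inner_commute)
    also have "\<dots> = t\<^sup>2 * (v s \<bullet> v t)"
      using v(1)[OF that(2)] by (simp add: gram_eigenspace_def inner_commute)
    finally have "(s\<^sup>2 - t\<^sup>2) * (v s \<bullet> v t) = 0"
      by (simp add: algebra_simps)
    moreover have "s\<^sup>2 \<noteq> t\<^sup>2"
      using that by simp
    ultimately show ?thesis by simp
  qed
  have inj: "inj_on v ?S"
  proof (rule inj_onI, rule ccontr)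
    fix s t assume st: "s \<in> ?S" "t \<in> ?S" "v s = v t" "s \<noteq> t"
    show False
      using orth[OF st(1,2,4)] v(2)[OF st(1)] st(3) by simp
  qed
  have "finite (v ` ?S)"
  proof (rule finite_nonzero_pairwise_orthogonal)
    fix a b assume ab: "a \<in> v ` ?S" "b \<in> v ` ?S" "a \<noteq> b"
    from ab(1,2) obtain s t where st: "s \<in> ?S" "t \<in> ?S" "a = v s" "b = v t"
      by (elim imageE)
    with ab(3) show "a \<bullet> b = 0"
      using orth[OF st(1,2)] by auto
  next
    show "0 \<notin> v ` ?S"
    proof
      assume "0 \<in> v ` ?S"
      then obtain s where "s \<in> ?S" "v s = 0"
        by (elim imageE) simp
      then show False
        using v(2) by simp
    qed
  qed
  then show ?thesis
    using inj by (rule finite_imageD)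
qed

text \<open>Orthogonal eigenvectors make \<open>r\<close> and \<open>s\<close> two entries of the list of singular values even if
  \<open>r = s\<close>, since the eigenspace then has dimension at least \<open>2\<close>.\<close>

lemma sigma2_ge:
  fixes A :: "real^'n^'n"
  assumes s: "0 \<le> s" "s \<le> r" and u: "u \<in> gram_eigenspace A (r\<^sup>2)" "u \<noteq> 0"
    and v: "v \<in> gram_eigenspace A (s\<^sup>2)" "v \<noteq> 0" and orth: "u \<bullet> v = 0"
  shows "s \<le> sigma2 A"
proof -
  define S where "S = {s. 0 \<le> s \<and> (\<exists>v\<in>gram_eigenspace A (s\<^sup>2). v \<noteq> 0)}"
  define m where "m = (\<Sum>s\<in>S. replicate_mset (dim (gram_eigenspace A (s\<^sup>2))) s)"
  have fin: "finite S"
    unfolding S_def by (rule finite_singular_values)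
  have mem: "r \<in> S" "s \<in> S"
    using assms by (auto simp: S_def)
  have dim_ge: "card T \<le> dim (gram_eigenspace A e)"
    if "T \<subseteq> gram_eigenspace A e" "independent T" for T e
    using that by (simp add: independent_card_le_dim)
  have count: "count m t = (if t \<in> S then dim (gram_eigenspace A (t\<^sup>2)) else 0)" for t
    using fin by (simp add: m_def count_sum sum.delta)
  have sub: "{#r, s#} \<subseteq># m"
  proof (cases "r = s")
    case True
    have "u \<noteq> v"
      using orth u by auto
    moreover have "independent {u, v}"
      using orth u v by (intro pairwise_orthogonal_independent)
        (auto simp: pairwise_def orthogonal_def inner_commute)
    ultimately have "2 \<le> dim (gram_eigenspace A (s\<^sup>2))"
      using dim_ge[of "{u, v}" "s\<^sup>2"] u v True by simp
    then show ?thesis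
      using mem True by (auto simp: subseteq_mset_def count)
  next
    case False
    have "1 \<le> dim (gram_eigenspace A (r\<^sup>2))" "1 \<le> dim (gram_eigenspace A (s\<^sup>2))"
      using dim_ge[of "{u}" "r\<^sup>2"] dim_ge[of "{v}" "s\<^sup>2"] u v by auto
    then show ?thesis
      using mem False by (auto simp: subseteq_mset_def count)
  qed
  let ?xs = "sorted_list_of_multiset m"
  have "length ?xs = size m"
    by (simp flip: size_mset)
  then have len: "2 \<le> length ?xs"
    using size_mset_mono[OF sub] by simp
  have "singular_values A = rev ?xs"
    unfolding singular_values_def m_def S_def ..
  then have nth: "singular_values A ! 1 = ?xs ! (length ?xs - 2)"
    using len by (simp add: rev_nth numeral_2_eq_2)
  show ?thesis
  proof (rule ccontr)
    assume "\<not> s \<le> sigma2 A"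
    then have less: "?xs ! (length ?xs - 2) < s"
      unfolding sigma2_def nth by simp
    \<comment> \<open>Everything up to position \<open>length - 2\<close> is below \<open>s \<le> r\<close>, so \<open>r\<close> and \<open>s\<close> would have to share the last position.\<close>
    let ?k = "length ?xs - 1"
    have low: "x < s" if "x \<in> set (take ?k ?xs)" for x
    proof -
      obtain i where i: "i < ?k" "i < length ?xs" "x = ?xs ! i"
        using \<open>x \<in> set (take ?k ?xs)\<close> by (auto simp: in_set_conv_nth)
      then have "?xs ! i \<le> ?xs ! (length ?xs - 2)"
        using len by (intro sorted_nth_mono) auto
      with less i show ?thesis by simp
    qed
    have "{#r, s#} = filter_mset (\<lambda>x. s \<le> x) {#r, s#}"
      using s by simp
    also have "\<dots> \<subseteq># filter_mset (\<lambda>x. s \<le> x) m"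
      using sub by (rule multiset_filter_mono)
    finally have "size {#r, s#} \<le> size (filter_mset (\<lambda>x. s \<le> x) m)"
      by (rule size_mset_mono)
    also have "m = mset (take ?k ?xs) + mset (drop ?k ?xs)"
      by (metis append_take_drop_id mset_append mset_sorted_list_of_multiset)
    also have "filter_mset (\<lambda>x. s \<le> x) \<dots> = filter_mset (\<lambda>x. s \<le> x) (mset (drop ?k ?xs))"
      using low by (auto simp: not_le)
    also have "size \<dots> \<le> size (mset (drop ?k ?xs))"
      by (rule size_filter_mset_lesseq)
    also have "\<dots> \<le> 1"
      by simp
    finally show False by simp
  qed
qed

text \<open>A maximiser of the Rayleigh quotient \<open>\<parallel>A x\<parallel>\<^sup>2 / \<parallel>x\<parallel>\<^sup>2\<close> on a subspace that the Gram matrix maps to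
  itself is an eigenvector: the derivative in every direction of the subspace vanishes.\<close>

lemma gram_eigenvector_on_subspace:
  fixes A :: "real^'n^'n"
  assumes W: "subspace W" "\<And>v. v \<in> W \<Longrightarrow> transpose A ** A *v v \<in> W" and ne: "\<exists>v\<in>W. v \<noteq> 0"
  obtains v m where "v \<in> W" "v \<noteq> 0" "0 \<le> m" "v \<in> gram_eigenspace A (m\<^sup>2)"
    "\<And>u. u \<in> W \<Longrightarrow> norm (A *v u) \<le> m * norm u"
proof -
  let ?S = "W \<inter> sphere 0 1"
  have "compact ?S"
    using closed_subspace[OF W(1)] by (simp add: closed_Int_compact)
  moreover have "?S \<noteq> {}"
  proof -
    obtain v where v: "v \<in> W" "v \<noteq> 0" using ne by blast
    then have "(1 / norm v) *\<^sub>R v \<in> ?S"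
      using W(1) by (simp add: subspace_scale)
    then show ?thesis by blast
  qed
  moreover have "continuous_on ?S (\<lambda>u. norm (A *v u))"
    by (intro continuous_intros linear_continuous_on linear_linear[THEN iffD2] matrix_vector_mul_linear)
  ultimately obtain v where v: "v \<in> ?S" and vmax: "\<And>u. u \<in> ?S \<Longrightarrow> norm (A *v u) \<le> norm (A *v v)"
    using continuous_attains_sup[of ?S "\<lambda>u. norm (A *v u)"] by blast
  define m where "m = norm (A *v v)"
  have bound: "norm (A *v u) \<le> m * norm u" if u: "u \<in> W" for u
  proof (cases "u = 0")
    case False
    have "(1 / norm u) *\<^sub>R u \<in> ?S"
      using W(1) u False by (simp add: subspace_scale)
    from vmax[OF this] show ?thesis
      using False by (simp add: m_def matrix_vector_mult_scaleR field_simps)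
  qed simp
  define d where "d = transpose A ** A *v v - m\<^sup>2 *\<^sub>R v"
  have dW: "d \<in> W"
    using W v unfolding d_def by (intro subspace_diff subspace_scale) auto
  \<comment> \<open>For every \<open>t\<close>, \<open>\<parallel>A (v + t d)\<parallel>\<^sup>2 \<le> m\<^sup>2 \<parallel>v + t d\<parallel>\<^sup>2\<close> with equality at \<open>t = 0\<close>; the linear coefficient is \<open>2 \<parallel>d\<parallel>\<^sup>2\<close>.\<close>
  have quad: "2 * t * (d \<bullet> d) \<le> t\<^sup>2 * (m\<^sup>2 * (d \<bullet> d))" for t
  proof -
    have "(norm (A *v (v + t *\<^sub>R d)))\<^sup>2 \<le> (m * norm (v + t *\<^sub>R d))\<^sup>2"
      using v dW W(1) by (intro power_mono bound subspace_add subspace_scale) auto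
    then have le: "(norm (A *v v + t *\<^sub>R (A *v d)))\<^sup>2 \<le> m\<^sup>2 * (norm (v + t *\<^sub>R d))\<^sup>2"
      by (simp add: power_mult_distrib matrix_vector_right_distrib matrix_vector_mult_scaleR)
    have expand: "(norm (a + t *\<^sub>R b))\<^sup>2 = (norm a)\<^sup>2 + 2 * t * (a \<bullet> b) + t\<^sup>2 * (b \<bullet> b)"
      for a b :: "real^'n"
      unfolding power2_norm_eq_inner
      by (simp add: inner_add inner_commute[of b a] algebra_simps power2_eq_square[of t])
    have "(A *v v) \<bullet> (A *v d) = m\<^sup>2 * (v \<bullet> d) + d \<bullet> d"
      unfolding gram_inner[symmetric] by (simp add: d_def[symmetric] eq_diff_eq' flip: inner_add_left inner_scaleR_left)
        (simp add: d_def)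
    moreover have "norm v = 1"
      using v by simp
    ultimately have "2 * t * (d \<bullet> d) + t\<^sup>2 * ((A *v d) \<bullet> (A *v d)) \<le> t\<^sup>2 * (m\<^sup>2 * (d \<bullet> d))"
      using le unfolding expand m_def[symmetric] by (simp add: algebra_simps)
    moreover have "0 \<le> t\<^sup>2 * ((A *v d) \<bullet> (A *v d))"
      by simp
    ultimately show ?thesis
      by linarith
  qed
  have "d = 0"
  proof (rule ccontr)
    assume "d \<noteq> 0"
    then have q: "0 < d \<bullet> d"
      by simp
    have "2 * (1 / (m\<^sup>2 + 1)) * (d \<bullet> d) \<le> (1 / (m\<^sup>2 + 1))\<^sup>2 * (m\<^sup>2 * (d \<bullet> d))"
      by (rule quad)
    also have "\<dots> \<le> 1 / (m\<^sup>2 + 1) * (d \<bullet> d)"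
    proof -
      have "1 / (m\<^sup>2 + 1) * m\<^sup>2 \<le> 1"
        by (simp add: divide_le_eq add_pos_nonneg add_nonneg_pos)
      then have "1 / (m\<^sup>2 + 1) * m\<^sup>2 * (1 / (m\<^sup>2 + 1) * (d \<bullet> d)) \<le> 1 * (1 / (m\<^sup>2 + 1) * (d \<bullet> d))"
        by (intro mult_right_mono) auto
      then show ?thesis
        by (simp add: power2_eq_square ac_simps)
    qed
    finally have "1 / (m\<^sup>2 + 1) * (d \<bullet> d) \<le> 0"
      by simp
    moreover have "0 < 1 / (m\<^sup>2 + 1) * (d \<bullet> d)"
      using q by (intro mult_pos_pos) (auto intro: add_nonneg_pos)
    ultimately show False
      by simp
  qed
  then have "v \<in> gram_eigenspace A (m\<^sup>2)"
    by (simp add: gram_eigenspace_def d_def)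
  moreover have "0 \<le> m" "v \<in> W" "v \<noteq> 0"
    using v by (auto simp: m_def)
  ultimately show ?thesis
    using bound by (intro that[of v m])
qed

definition doubly_stochastic :: "real^'n^'n \<Rightarrow> bool" where
  "doubly_stochastic A \<longleftrightarrow> column_stochastic A \<and> (\<forall>i. (\<Sum>j\<in>UNIV. A $ i $ j) = 1)"

lemma doubly_stochastic_mult_1:
  fixes A :: "real^'n^'n"
  assumes "doubly_stochastic A"
  shows "A *v 1 = 1" "transpose A *v 1 = 1"
  using assms
  by (auto simp: doubly_stochastic_def column_stochastic_def matrix_vector_mult_def transpose_def vec_eq_iff)

lemma doubly_stochastic_push_matrix:
  assumes "regular_digraph E"
  shows "doubly_stochastic (push_matrix E)"
proof -
  obtain d where d: "\<And>i. out_deg E i = d" "\<And>i. in_deg E i = d"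
    using assms by (auto simp: regular_digraph_def)
  have "(\<Sum>j\<in>UNIV. push_matrix E $ i $ j) = 1" for i
    using d out_deg_pos[of E i] by (auto simp: push_matrix_def sum.If_cases in_deg_def)
  then show ?thesis
    by (simp add: doubly_stochastic_def column_stochastic_push_matrix)
qed

lemma norm_sq_vec: "(norm (v :: real^'n))\<^sup>2 = (\<Sum>i\<in>UNIV. (v $ i)\<^sup>2)"
  unfolding power2_norm_eq_inner by (simp add: inner_vec_def power2_eq_square)

text \<open>Jensen's inequality for each row, summed with the column sums.\<close>

lemma doubly_stochastic_norm_le:
  fixes A :: "real^'n^'n"
  assumes A: "doubly_stochastic A"
  shows "norm (A *v v) \<le> norm v"
proof -
  have nonneg: "0 \<le> A $ i $ j" and row: "(\<Sum>j\<in>UNIV. A $ i $ j) = 1"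
    and col: "(\<Sum>i\<in>UNIV. A $ i $ j) = 1" for i j
    using A by (auto simp: doubly_stochastic_def column_stochastic_def)
  have "((A *v v) $ i)\<^sup>2 \<le> (\<Sum>j\<in>UNIV. A $ i $ j * (v $ j)\<^sup>2)" for i
    using convex_on_sum[of UNIV "(UNIV :: real set)" power2 "\<lambda>j. A $ i $ j" "\<lambda>j. v $ j"]
      nonneg row convex_power2
    by (simp add: matrix_vector_mult_def)
  then have "(norm (A *v v))\<^sup>2 \<le> (\<Sum>i\<in>UNIV. \<Sum>j\<in>UNIV. A $ i $ j * (v $ j)\<^sup>2)"
    by (simp add: norm_sq_vec sum_mono)
  also have "\<dots> = (\<Sum>j\<in>UNIV. \<Sum>i\<in>UNIV. A $ i $ j * (v $ j)\<^sup>2)"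
    by (rule sum.swap)
  also have "\<dots> = (norm v)\<^sup>2"
    by (simp add: col norm_sq_vec flip: sum_distrib_right)
  finally show ?thesis
    by (rule power2_le_imp_le) simp
qed

text \<open>The constant vector is an eigenvector of the Gram matrix with eigenvalue \<open>1\<close>, and its complement is
  invariant. The norm \<open>m \<le> 1\<close> of \<open>A\<close> on the complement is a singular value with an eigenvector
  orthogonal to the constants, so it is the second of two entries and at most \<open>\<sigma>\<^sub>2\<close>.\<close>

lemma doubly_stochastic_sigma2:
  fixes A :: "real^'n^'n"
  assumes A: "doubly_stochastic A" and n: "2 \<le> CARD('n)"
  shows "0 \<le> sigma2 A" "(\<Sum>j\<in>UNIV. v $ j) = 0 \<Longrightarrow> norm (A *v v) \<le> sigma2 A * norm v"
proof -
  let ?W = "{v :: real^'n. 1 \<bullet> v = 0}"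
  have in_W: "v \<in> ?W \<longleftrightarrow> (\<Sum>j\<in>UNIV. v $ j) = 0" for v
    by (simp add: inner_vec_def)
  have fix1: "transpose A ** A *v 1 = 1"
    using doubly_stochastic_mult_1[OF A] by (simp flip: matrix_vector_mul_assoc)
  have "\<not> card (UNIV :: 'n set) \<le> Suc 0"
    using n by simp
  then obtain i j :: 'n where ij: "i \<noteq> j"
    by (auto simp: card_le_Suc0_iff_eq)
  have "1 \<bullet> (axis i 1 - axis j 1 :: real^'n) = 0"
    by (simp add: inner_diff_right inner_axis)
  moreover have "(axis i 1 - axis j 1 :: real^'n) \<noteq> 0"
    using ij by (simp add: axis_eq_axis)
  ultimately have ne: "\<exists>v\<in>?W. v \<noteq> 0"
    by blast
  have inv: "transpose A ** A *v v \<in> ?W" if "v \<in> ?W" for v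
  proof -
    have "1 \<bullet> (transpose A ** A *v v) = (transpose A ** A *v 1) \<bullet> v"
      by (simp only: gram_inner inner_commute[of 1])  (simp add: inner_commute)
    with that show ?thesis
      by (simp add: fix1)
  qed
  obtain u m where u: "u \<in> ?W" "u \<noteq> 0" "0 \<le> m" "u \<in> gram_eigenspace A (m\<^sup>2)"
    and bound: "\<And>v. v \<in> ?W \<Longrightarrow> norm (A *v v) \<le> m * norm v"
    using gram_eigenvector_on_subspace[OF subspace_hyperplane inv ne] by metis
  have "m \<le> 1"
  proof -
    have "(m * norm u)\<^sup>2 = (A *v u) \<bullet> (A *v u)"
      using u(4) by (simp add: gram_eigenspace_def power_mult_distrib power2_norm_eq_inner
          flip: gram_inner)
    then have "m * norm u = norm (A *v u)"
      using u(3) by (simp flip: power2_norm_eq_inner)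
    also have "\<dots> \<le> norm u"
      by (rule doubly_stochastic_norm_le[OF A])
    finally show ?thesis
      using u(2) by simp
  qed
  moreover have "1 \<in> gram_eigenspace A (1\<^sup>2)"
    by (simp add: gram_eigenspace_def fix1)
  ultimately have m: "m \<le> sigma2 A"
    using u by (intro sigma2_ge[of m 1 1 A u]) auto
  then show "0 \<le> sigma2 A"
    using u(3) by simp
  show "norm (A *v v) \<le> sigma2 A * norm v" if "(\<Sum>j\<in>UNIV. v $ j) = 0"
  proof -
    have "norm (A *v v) \<le> m * norm v"
      using bound that in_W by blast
    also have "\<dots> \<le> sigma2 A * norm v"
      using m by (simp add: mult_right_mono)
    finally show ?thesis .
  qed
qed

section \<open>Mixing for regular graphs\<close>

text \<open>The length of the part of \<open>[a, b]\<close> below \<open>x\<close>. Over consecutive intervals these lengths add up to \<open>x\<close>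
  up to a constant, which splits a vector into one layer for each gap between its values.\<close>

definition clip :: "real \<Rightarrow> real \<Rightarrow> real \<Rightarrow> real" where
  "clip a b x = max a (min b x) - a"

lemma clip_mono: "x \<le> y \<Longrightarrow> clip a b x \<le> clip a b y"
  by (auto simp: clip_def)

lemma clip_values:
  assumes "a \<le> b"
  shows "x \<le> a \<Longrightarrow> clip a b x = 0" "b \<le> x \<Longrightarrow> clip a b x = b - a"
  using assms by (auto simp: clip_def)

lemma sum_clip:
  fixes v :: "nat \<Rightarrow> real"
  assumes "\<And>l. l < m \<Longrightarrow> v l \<le> v (Suc l)" "v 0 \<le> x" "x \<le> v m"
  shows "(\<Sum>l<m. clip (v l) (v (Suc l)) x) = x - v 0"
proof -
  have "(\<Sum>l<k. clip (v l) (v (Suc l)) x) = min (v k) x - v 0" if "k \<le> m" for k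
    using that
  proof (induction k)
    case 0
    then show ?case using assms by simp
  next
    case (Suc k)
    have "(\<Sum>l<Suc k. clip (v l) (v (Suc l)) x) = min (v k) x - v 0 + clip (v k) (v (Suc k)) x"
      using Suc by simp
    then show ?case
      using assms(1)[of k] Suc.prems by (auto simp: clip_def)
  qed
  from this[of m] show ?thesis
    using assms by simp
qed

lemma sum_squares_le_square_sum:
  fixes d :: "'b \<Rightarrow> real"
  assumes "finite L" "(\<forall>l\<in>L. 0 \<le> d l) \<or> (\<forall>l\<in>L. d l \<le> 0)"
  shows "(\<Sum>l\<in>L. (d l)\<^sup>2) \<le> (\<Sum>l\<in>L. d l)\<^sup>2"
proof -
  have "(\<Sum>l\<in>L. (d l)\<^sup>2) \<le> (\<Sum>l\<in>L. \<Sum>k\<in>L. d l * d k)"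
  proof (intro sum_mono)
    fix l assume l: "l \<in> L"
    have "d l * d l \<le> (\<Sum>k\<in>L. d l * d k)"
      using l assms by (intro member_le_sum) (auto intro: mult_nonneg_nonneg mult_nonpos_nonpos)
    then show "(d l)\<^sup>2 \<le> (\<Sum>k\<in>L. d l * d k)"
      by (simp add: power2_eq_square)
  qed
  then show ?thesis
    by (simp add: power2_eq_square sum_product)
qed

text \<open>The energy \<open>\<parallel>v\<parallel>\<^sup>2 - \<parallel>A v\<parallel>\<^sup>2\<close> that one averaging step dissipates, as a sum of variances, one
  for each row.\<close>

definition row_variance :: "real^'n^'n \<Rightarrow> ('n \<Rightarrow> real) \<Rightarrow> 'n \<Rightarrow> real" where
  "row_variance A u k = (\<Sum>i\<in>UNIV. \<Sum>j\<in>UNIV. A $ k $ i * A $ k $ j * (u i - u j)\<^sup>2) / 2"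

lemma row_variance_eq:
  assumes "(\<Sum>j\<in>UNIV. A $ k $ j) = 1"
  shows "row_variance A u k = (\<Sum>j\<in>UNIV. A $ k $ j * (u j)\<^sup>2) - (\<Sum>j\<in>UNIV. A $ k $ j * u j)\<^sup>2"
proof -
  let ?a = "\<lambda>i. A $ k $ i"
  have s1: "(\<Sum>i\<in>UNIV. \<Sum>j\<in>UNIV. ?a i * ?a j * (u i)\<^sup>2) = (\<Sum>i\<in>UNIV. ?a i * (u i)\<^sup>2)"
  proof -
    have "(\<Sum>i\<in>UNIV. \<Sum>j\<in>UNIV. ?a i * ?a j * (u i)\<^sup>2)
        = (\<Sum>i\<in>UNIV. ?a i * (u i)\<^sup>2) * (\<Sum>j\<in>UNIV. ?a j)"
      unfolding sum_product by (simp add: ac_simps)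
    then show ?thesis using assms by simp
  qed
  have s2: "(\<Sum>i\<in>UNIV. \<Sum>j\<in>UNIV. ?a i * ?a j * (u j)\<^sup>2) = (\<Sum>i\<in>UNIV. ?a i * (u i)\<^sup>2)"
  proof -
    have "(\<Sum>i\<in>UNIV. \<Sum>j\<in>UNIV. ?a i * ?a j * (u j)\<^sup>2)
        = (\<Sum>i\<in>UNIV. ?a i) * (\<Sum>j\<in>UNIV. ?a j * (u j)\<^sup>2)"
      unfolding sum_product by (simp add: ac_simps)
    then show ?thesis using assms by simp
  qed
  have s3: "(\<Sum>i\<in>UNIV. \<Sum>j\<in>UNIV. 2 * (?a i * u i) * (?a j * u j)) = 2 * (\<Sum>i\<in>UNIV. ?a i * u i)\<^sup>2"
    unfolding power2_eq_square sum_product by (simp add: sum_distrib_left ac_simps)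
  have "?a i * ?a j * (u i - u j)\<^sup>2
      = ?a i * ?a j * (u i)\<^sup>2 + ?a i * ?a j * (u j)\<^sup>2 - 2 * (?a i * u i) * (?a j * u j)" for i j
    by (simp add: power2_eq_square algebra_simps)
  then have "2 * row_variance A u k = (\<Sum>i\<in>UNIV. ?a i * (u i)\<^sup>2) + (\<Sum>i\<in>UNIV. ?a i * (u i)\<^sup>2)
      - 2 * (\<Sum>i\<in>UNIV. ?a i * u i)\<^sup>2"
    using s1 s2 s3 by (simp add: row_variance_def sum.distrib sum_subtractf)
  then show ?thesis by simp
qed

lemma dissipation_eq:
  fixes A :: "real^'n^'n"
  assumes A: "doubly_stochastic A"
  shows "(norm v)\<^sup>2 - (norm (A *v v))\<^sup>2 = (\<Sum>k\<in>UNIV. row_variance A (($) v) k)"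
proof -
  have row: "(\<Sum>j\<in>UNIV. A $ i $ j) = 1" and col: "(\<Sum>i\<in>UNIV. A $ i $ j) = 1" for i j
    using A by (auto simp: doubly_stochastic_def column_stochastic_def)
  have "(\<Sum>k\<in>UNIV. \<Sum>j\<in>UNIV. A $ k $ j * (v $ j)\<^sup>2) = (\<Sum>j\<in>UNIV. \<Sum>k\<in>UNIV. A $ k $ j * (v $ j)\<^sup>2)"
    by (rule sum.swap)
  also have "\<dots> = (norm v)\<^sup>2"
    by (simp add: col norm_sq_vec flip: sum_distrib_right)
  finally show ?thesis
    by (simp add: row_variance_eq[OF row] sum_subtractf) (simp add: norm_sq_vec matrix_vector_mult_def)
qed

lemma row_variance_indicator:
  assumes "(\<Sum>j\<in>UNIV. A $ k $ j) = 1"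
  shows "row_variance A (\<lambda>i. if i \<in> S then 0 else g) k
    = (\<Sum>j\<in>S. A $ k $ j) * (\<Sum>j\<in>-S. A $ k $ j) * g\<^sup>2"
proof -
  have compl: "(\<Sum>j\<in>-S. A $ k $ j) = 1 - (\<Sum>j\<in>S. A $ k $ j)"
    using assms sum.subset_diff[of S UNIV "\<lambda>j. A $ k $ j"] by (simp add: Compl_eq_Diff_UNIV)
  have "(\<Sum>j\<in>UNIV. A $ k $ j * (if j \<in> S then 0 else c)) = (\<Sum>j\<in>-S. A $ k $ j) * c" for c
    by (simp add: if_distrib[of "\<lambda>x. _ * x"] sum.If_cases sum_distrib_right Compl_eq)
  then show ?thesis
    unfolding row_variance_eq[OF assms]
    by (simp add: if_distrib[of "\<lambda>x. x\<^sup>2"] compl cong: if_cong)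
      (simp add: power2_eq_square algebra_simps)
qed

text \<open>The layers are monotone in the value, so their differences between two nodes have a common sign
  and the variance of their sum dominates the sum of their variances.\<close>

lemma row_variance_clip:
  fixes A :: "real^'n^'n" and v :: "nat \<Rightarrow> real"
  assumes A: "\<And>i j. 0 \<le> A $ i $ j"
    and v: "\<And>l. l < m \<Longrightarrow> v l \<le> v (Suc l)" and u: "\<And>i. v 0 \<le> u i" "\<And>i. u i \<le> v m"
  shows "(\<Sum>l<m. row_variance A (\<lambda>i. clip (v l) (v (Suc l)) (u i)) k) \<le> row_variance A u k"
proof -
  let ?c = "\<lambda>l i. clip (v l) (v (Suc l)) (u i)"
  have "(\<Sum>l<m. (?c l i - ?c l j)\<^sup>2) \<le> (u i - u j)\<^sup>2" for i j
  proof -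
    have "(\<Sum>l<m. (?c l i - ?c l j)\<^sup>2) \<le> (\<Sum>l<m. ?c l i - ?c l j)\<^sup>2"
      using clip_mono[of "u i" "u j"] clip_mono[of "u j" "u i"] linear[of "u i" "u j"]
      by (intro sum_squares_le_square_sum) auto
    also have "(\<Sum>l<m. ?c l i - ?c l j) = u i - u j"
      using sum_clip[of m v, OF v u(1) u(2)] by (simp add: sum_subtractf)
    finally show ?thesis .
  qed
  then have "(\<Sum>i\<in>UNIV. \<Sum>j\<in>UNIV. A $ k $ i * A $ k $ j * (\<Sum>l<m. (?c l i - ?c l j)\<^sup>2))
      \<le> (\<Sum>i\<in>UNIV. \<Sum>j\<in>UNIV. A $ k $ i * A $ k $ j * (u i - u j)\<^sup>2)"
    using A by (intro sum_mono mult_left_mono) auto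
  also have "(\<Sum>i\<in>UNIV. \<Sum>j\<in>UNIV. A $ k $ i * A $ k $ j * (\<Sum>l<m. (?c l i - ?c l j)\<^sup>2))
      = (\<Sum>l<m. \<Sum>i\<in>UNIV. \<Sum>j\<in>UNIV. A $ k $ i * A $ k $ j * (?c l i - ?c l j)\<^sup>2)"
    unfolding sum_distrib_left by (subst sum.swap[of _ "{..<m}"]) (intro sum.cong refl sum.swap)
  finally show ?thesis
    by (simp add: row_variance_def divide_right_mono flip: sum_divide_distrib)
qed

text \<open>If no edge leaves \<open>S\<close>, the entries of the push matrix inside \<open>S\<close> sum to the size of \<open>S\<close> by
  columns; an edge into \<open>S\<close> would make the same sum by rows smaller.\<close>

lemma regular_no_inflow:
  fixes E :: "'n::finite rel"
  assumes reg: "regular_digraph E" and out: "\<And>a b. (a, b) \<in> E \<Longrightarrow> a \<in> S \<Longrightarrow> b \<in> S"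
    and ab: "(a, b) \<in> E" "b \<in> S"
  shows "a \<in> S"
proof (rule ccontr)
  assume a: "a \<notin> S"
  have ds: "doubly_stochastic (push_matrix E)"
    by (rule doubly_stochastic_push_matrix[OF reg])
  let ?A = "\<lambda>i j. push_matrix E $ i $ j"
  have nonneg: "0 \<le> ?A i j" and row: "(\<Sum>j\<in>UNIV. ?A i j) = 1" and col: "(\<Sum>i\<in>UNIV. ?A i j) = 1" for i j
    using ds by (auto simp: doubly_stochastic_def column_stochastic_def)
  have zero: "?A i j = 0" if "j \<in> S" "i \<notin> S" for i j
    using out[of j i] that by (auto simp: push_matrix_def in_nbhd_def)
  have "(\<Sum>i\<in>S. ?A i j) = 1" if "j \<in> S" for j
    using col[of j] zero that sum.mono_neutral_left[of UNIV S "\<lambda>i. ?A i j"] by auto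
  then have "real (card S) = (\<Sum>j\<in>S. \<Sum>i\<in>S. ?A i j)"
    by simp
  also have "\<dots> = (\<Sum>i\<in>S. \<Sum>j\<in>S. ?A i j)"
    by (rule sum.swap)
  also have "\<dots> < (\<Sum>i\<in>S. 1)"
  proof (rule sum_strict_mono_ex1)
    show "\<forall>i\<in>S. (\<Sum>j\<in>S. ?A i j) \<le> 1"
      using sum_mono2[of UNIV S "\<lambda>j. ?A _ j"] nonneg row by fastforce
    have "0 < ?A b a"
      using ab out_deg_pos[of E a] by (auto simp: push_matrix_def in_nbhd_def)
    moreover have "(\<Sum>j\<in>insert a S. ?A b j) \<le> (\<Sum>j\<in>UNIV. ?A b j)"
      using nonneg by (intro sum_mono2) auto
    ultimately have "(\<Sum>j\<in>S. ?A b j) < 1"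
      using a row[of b] by simp
    then show "\<exists>i\<in>S. (\<Sum>j\<in>S. ?A i j) < 1"
      using ab by blast
  qed simp
  finally show False by simp
qed

text \<open>A row of degree \<open>d \<ge> 2\<close> that averages over both sides of \<open>S\<close> puts a weight between \<open>1 / d\<close> and
  \<open>1 - 1 / d\<close> on each side, and \<open>(1 / d) (1 - 1 / d) \<ge> 1 / (2 n)\<close>.\<close>

lemma mixed_row_variance:
  fixes E :: "'n::finite rel"
  assumes reg: "regular_digraph E" and ij: "i \<in> S" "i \<in> in_nbhd E k" "j \<notin> S" "j \<in> in_nbhd E k"
  shows "g\<^sup>2 / (2 * real CARD('n)) \<le> row_variance (push_matrix E) (\<lambda>i. if i \<in> S then 0 else g) k"
proof -
  obtain d where d: "\<And>i. out_deg E i = d" "\<And>i. in_deg E i = d"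
    using reg by (auto simp: regular_digraph_def)
  let ?A = "\<lambda>j. push_matrix E $ k $ j"
  have nonneg: "0 \<le> ?A j" and row: "(\<Sum>j\<in>UNIV. push_matrix E $ k $ j) = 1" for j
    using doubly_stochastic_push_matrix[OF reg] by (auto simp: doubly_stochastic_def column_stochastic_def)
  have "card {i, j} \<le> card (in_nbhd E k)"
    using ij by (intro card_mono) auto
  moreover have "card {i, j} = 2"
    using ij by (auto simp: card_insert_if)
  ultimately have d2: "2 \<le> d"
    using d(2)[of k] by (simp add: in_deg_def)
  have dn: "d \<le> CARD('n)"
    using out_deg_le[of E k] d by simp
  have ge: "1 / real d \<le> (\<Sum>j\<in>T. ?A j)" if "l \<in> T" "l \<in> in_nbhd E k" for l T
  proof -
    have "?A l \<le> (\<Sum>j\<in>T. ?A j)"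
      using that nonneg by (intro member_le_sum) auto
    then show ?thesis
      using that d by (simp add: push_matrix_def)
  qed
  define a where "a = (\<Sum>j\<in>S. ?A j)"
  have compl: "(\<Sum>j\<in>-S. ?A j) = 1 - a"
    using row sum.subset_diff[of S UNIV ?A] by (simp add: Compl_eq_Diff_UNIV a_def)
  have a: "1 / d \<le> a" "1 / d \<le> 1 - a"
    using ge[of i S] ge[of j "-S"] ij compl by (auto simp: a_def)
  have "1 / (2 * real CARD('n)) \<le> 1 / real d * (1 - 1 / real d)"
  proof -
    have "1 / (2 * real CARD('n)) \<le> 1 / (2 * real d)"
      using dn d2 by (intro divide_left_mono) auto
    also have "\<dots> = 1 / real d * (1 / 2)"
      by simp
    also have "\<dots> \<le> 1 / real d * (1 - 1 / real d)"
      using d2 by (intro mult_left_mono) (auto simp: field_simps)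
    finally show ?thesis .
  qed
  also have "\<dots> \<le> a * (1 - a)"
  proof -
    have "0 \<le> (a - 1 / real d) * (1 - a - 1 / real d)"
      using a by (intro mult_nonneg_nonneg) auto
    then show ?thesis
      by (simp add: algebra_simps)
  qed
  finally have "1 / (2 * real CARD('n)) * g\<^sup>2 \<le> a * (1 - a) * g\<^sup>2"
    by (intro mult_right_mono) auto
  then show ?thesis
    by (simp add: row_variance_indicator[OF row] compl a_def)
qed

lemma row_variance_nonneg:
  assumes "\<And>i j. 0 \<le> A $ i $ j"
  shows "0 \<le> row_variance A u k"
  unfolding row_variance_def using assms by (intro divide_nonneg_nonneg sum_nonneg) auto

text \<open>An edge out of \<open>S\<close> comes with an edge into \<open>S\<close>, and their heads are two different mixed rows.\<close>

lemma crossing_dissipation: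
  fixes E :: "'n::finite rel"
  assumes reg: "regular_digraph E" and ab: "(a, b) \<in> E" "a \<in> S" "b \<notin> S"
  shows "g\<^sup>2 / real CARD('n) \<le> (\<Sum>k\<in>UNIV. row_variance (push_matrix E) (\<lambda>i. if i \<in> S then 0 else g) k)"
proof -
  obtain a' b' where ab': "(a', b') \<in> E" "a' \<notin> S" "b' \<in> S"
    using regular_no_inflow[OF reg, of "-S" a b] ab by blast
  let ?V = "row_variance (push_matrix E) (\<lambda>i. if i \<in> S then 0 else g)"
  have "g\<^sup>2 / (2 * real CARD('n)) \<le> ?V b" "g\<^sup>2 / (2 * real CARD('n)) \<le> ?V b'"
    using ab ab' by (auto intro!: mixed_row_variance[OF reg, of a S b b] mixed_row_variance[OF reg, of b' S b' a']
        simp: in_nbhd_def)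
  moreover have "(\<Sum>k\<in>{b, b'}. ?V k) \<le> (\<Sum>k\<in>UNIV. ?V k)"
    using column_stochastic_push_matrix[of E]
    by (intro sum_mono2 row_variance_nonneg) (auto simp: column_stochastic_def)
  moreover have "b \<noteq> b'"
    using ab ab' by auto
  ultimately show ?thesis
    by simp
qed


lemma push_matrix_mean_bounds:
  fixes E :: "'n::finite rel"
  assumes reg: "regular_digraph E"
  shows "(\<And>j. j \<in> in_nbhd E i \<Longrightarrow> u $ j \<le> c) \<Longrightarrow> (push_matrix E *v u) $ i \<le> c"
    and "(\<And>j. j \<in> in_nbhd E i \<Longrightarrow> c \<le> u $ j) \<Longrightarrow> c \<le> (push_matrix E *v u) $ i"
proof -
  have row: "(\<Sum>j\<in>UNIV. push_matrix E $ i $ j * c) = c"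
    using doubly_stochastic_push_matrix[OF reg] by (simp add: doubly_stochastic_def flip: sum_distrib_right)
  show "(push_matrix E *v u) $ i \<le> c" if "\<And>j. j \<in> in_nbhd E i \<Longrightarrow> u $ j \<le> c"
  proof -
    have "(push_matrix E *v u) $ i \<le> (\<Sum>j\<in>UNIV. push_matrix E $ i $ j * c)"
      unfolding matrix_vector_mult_def using that
      by (auto simp: push_matrix_def intro!: sum_mono divide_right_mono)
    then show ?thesis by (simp add: row)
  qed
  show "c \<le> (push_matrix E *v u) $ i" if "\<And>j. j \<in> in_nbhd E i \<Longrightarrow> c \<le> u $ j"
  proof -
    have "(\<Sum>j\<in>UNIV. push_matrix E $ i $ j * c) \<le> (push_matrix E *v u) $ i"
      unfolding matrix_vector_mult_def using that
      by (auto simp: push_matrix_def intro!: sum_mono divide_right_mono)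
    then show ?thesis by (simp add: row)
  qed
qed

text \<open>Until the first edge that leaves \<open>S\<close> the values on the two sides do not mix, so the gap between
  them persists; the clipped values are then those of an indicator function.\<close>

lemma window_gap_dissipation:
  fixes E :: "nat \<Rightarrow> 'n::finite rel"
  assumes reg: "\<And>t. regular_digraph (E t)"
    and conn: "strongly_connected (\<Union>t\<in>{s..<s + B}. E t)"
    and S: "S \<noteq> {}" "S \<noteq> UNIV" and ab: "a \<le> b"
    and v: "\<And>i. i \<in> S \<Longrightarrow> v $ i \<le> a" "\<And>i. i \<notin> S \<Longrightarrow> b \<le> v $ i"
  shows "(b - a)\<^sup>2 / real CARD('n) \<le> (\<Sum>l<B. \<Sum>k\<in>UNIV. row_variance (push_matrix (E (s + l)))
    (\<lambda>i. clip a b ((push_prod E s l *v v) $ i)) k)"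
    (is "_ \<le> (\<Sum>l<B. ?D l)")
proof -
  let ?cross = "\<lambda>l. l < B \<and> (\<exists>i j. (i, j) \<in> E (s + l) \<and> i \<in> S \<and> j \<notin> S)"
  obtain i j where ij: "(i, j) \<in> (\<Union>t\<in>{s..<s + B}. E t)" "i \<in> S" "j \<notin> S"
    using crossing_edge[OF conn, of _ S] S by blast
  then obtain t where t: "s \<le> t" "t < s + B" "(i, j) \<in> E t"
    by auto
  then have "?cross (t - s)"
    using ij by auto
  then have cross: "?cross (LEAST l. ?cross l)"
    by (rule LeastI)
  define L where "L = (LEAST l. ?cross l)"
  have before: "j \<in> S" if "l < L" "(i, j) \<in> E (s + l)" "i \<in> S" for l i j
  proof (rule ccontr)
    assume "j \<notin> S"
    moreover have "l < B"
      using that cross by (auto simp: L_def)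
    ultimately have "?cross l"
      using that by blast
    then have "L \<le> l"
      unfolding L_def by (rule Least_le)
    then show False
      using that by simp
  qed
  have inv: "(i \<in> S \<longrightarrow> (push_prod E s l *v v) $ i \<le> a) \<and> (i \<notin> S \<longrightarrow> b \<le> (push_prod E s l *v v) $ i)"
    if "l \<le> L" for l i
    using that
  proof (induction l arbitrary: i)
    case 0
    then show ?case using v by auto
  next
    case (Suc l)
    let ?u = "push_prod E s l *v v"
    have out: "d \<in> S" if "(c, d) \<in> E (s + l)" "c \<in> S" for c d
      using before[of l c d] that Suc.prems by simp
    have sep: "j \<in> S \<longleftrightarrow> i \<in> S" if "j \<in> in_nbhd (E (s + l)) i" for j
      using that out[of j i] regular_no_inflow[where E = "E (s + l)" and S = S and a = j and b = i, OF reg out]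
      by (auto simp: in_nbhd_def)
    have "push_prod E s (Suc l) *v v = push_matrix (E (s + l)) *v ?u"
      by (simp add: push_prod_Suc matrix_vector_mul_assoc)
    then show ?case
      using push_matrix_mean_bounds[OF reg[of "s + l"], where i = i and u = ?u] Suc sep by auto
  qed
  have "clip a b ((push_prod E s L *v v) $ i) = (if i \<in> S then 0 else b - a)" for i
    using inv[of L i] clip_values[OF ab] by auto
  then have "?D L = (\<Sum>k\<in>UNIV. row_variance (push_matrix (E (s + L))) (\<lambda>i. if i \<in> S then 0 else b - a) k)"
    by simp
  moreover obtain i' j' where "(i', j') \<in> E (s + L)" "i' \<in> S" "j' \<notin> S"
    using cross by (auto simp: L_def)
  ultimately have "(b - a)\<^sup>2 / real CARD('n) \<le> ?D L"
    using crossing_dissipation[OF reg[of "s + L"], of i' j' S "b - a"] by simp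
  also have "\<dots> \<le> (\<Sum>l<B. ?D l)"
    using cross column_stochastic_push_matrix
    by (intro member_le_sum sum_nonneg row_variance_nonneg) (auto simp: column_stochastic_def L_def)
  finally show ?thesis .
qed

lemma zero_sum_norm_le_spread:
  fixes v :: "real^'n"
  assumes v: "(\<Sum>j\<in>UNIV. v $ j) = 0" and lo: "\<And>i. lo \<le> v $ i" and hi: "\<And>i. v $ i \<le> hi"
  shows "(norm v)\<^sup>2 \<le> real CARD('n) * (hi - lo)\<^sup>2 / 4"
proof -
  let ?c = "(lo + hi) / 2"
  have "(norm v)\<^sup>2 \<le> (\<Sum>i\<in>UNIV. (v $ i - ?c)\<^sup>2)"
  proof -
    have "(\<Sum>i\<in>UNIV. (v $ i - ?c)\<^sup>2) = (\<Sum>i\<in>UNIV. (v $ i)\<^sup>2) - 2 * ?c * (\<Sum>i\<in>UNIV. v $ i) + real CARD('n) * ?c\<^sup>2"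
      unfolding power2_diff sum.distrib sum_subtractf sum_distrib_left by (simp add: ac_simps)
    then show ?thesis
      using v by (simp add: norm_sq_vec)
  qed
  also have "\<dots> \<le> (\<Sum>i\<in>(UNIV :: 'n set). ((hi - lo) / 2)\<^sup>2)"
  proof (rule sum_mono)
    fix i
    have "\<bar>v $ i - ?c\<bar> \<le> \<bar>(hi - lo) / 2\<bar>"
      using lo[of i] hi[of i] by (simp add: abs_le_iff field_simps)
    then show "(v $ i - ?c)\<^sup>2 \<le> ((hi - lo) / 2)\<^sup>2"
      by (simp only: abs_le_square_iff)
  qed
  finally show ?thesis
    by (simp add: power_divide)
qed

text \<open>If \<open>g\<^sub>1, \<dots>, g\<^sub>m\<close> are the gaps between consecutive values of \<open>v\<close> and \<open>R\<close> is their sum, then a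
  window dissipates at least \<open>\<Sum> g\<^sub>l\<^sup>2 / n \<ge> R\<^sup>2 / (m n)\<close>, whereas \<open>\<parallel>v\<parallel>\<^sup>2 \<le> n R\<^sup>2 / 4\<close>. Keeping all
  gaps instead of the largest one saves a factor of order \<open>n\<close>.\<close>

lemma regular_window_contraction:
  fixes E :: "nat \<Rightarrow> 'n::finite rel"
  assumes reg: "\<And>t. regular_digraph (E t)"
    and conn: "strongly_connected (\<Union>t\<in>{s..<s + B}. E t)"
    and v: "(\<Sum>j\<in>UNIV. v $ j) = 0"
  shows "(norm (push_prod E s B *v v))\<^sup>2 \<le> (1 - 4 / real CARD('n) ^ 3) * (norm v)\<^sup>2"
proof -
  let ?n = "real CARD('n)"
  let ?A = "\<lambda>l. push_matrix (E (s + l))"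
  define u where "u l = push_prod E s l *v v" for l
  have u_Suc: "u (Suc l) = ?A l *v u l" for l
    by (simp add: u_def push_prod_Suc matrix_vector_mul_assoc)
  define xs where "xs = sorted_list_of_set (range (($) v))"
  define m where "m = length xs - 1"
  have set_xs: "set xs = range (($) v)" and sorted: "sorted_wrt (<) xs"
    by (auto simp: xs_def)
  have len: "length xs = Suc m" "Suc m \<le> CARD('n)"
  proof -
    have "length xs = card (range (($) v))"
      by (simp add: xs_def)
    moreover have "card (range (($) v)) \<le> CARD('n)" "0 < card (range (($) v))"
      by (auto simp: card_image_le card_gt_0_iff)
    ultimately show "length xs = Suc m" "Suc m \<le> CARD('n)"
      by (auto simp: m_def)
  qed
  have less: "xs ! q < xs ! r" if "q < r" "r \<le> m" for q r
    using sorted that len by (auto simp: sorted_wrt_iff_nth_less)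
  have le: "xs ! q \<le> xs ! r" if "q \<le> r" "r \<le> m" for q r
    using less[of q r] that by (cases "q = r") auto
  have idx: "\<exists>r\<le>m. v $ i = xs ! r" for i
  proof -
    have "v $ i \<in> set xs" by (simp add: set_xs)
    then show ?thesis using len by (auto simp: in_set_conv_nth less_Suc_eq_le)
  qed
  have range: "xs ! 0 \<le> u l $ i \<and> u l $ i \<le> xs ! m" for l i
  proof (induction l arbitrary: i)
    case 0
    then show ?case using idx[of i] le by (auto simp: u_def)
  next
    case (Suc l)
    then show ?case
      unfolding u_Suc using push_matrix_mean_bounds[OF reg[of "s + l"], where i = i and u = "u l"] by blast
  qed
  let ?g = "\<lambda>q. xs ! Suc q - xs ! q"
  let ?V = "\<lambda>q l k. row_variance (?A l) (\<lambda>i. clip (xs ! q) (xs ! Suc q) (u l $ i)) k"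
  have gap: "(?g q)\<^sup>2 / ?n \<le> (\<Sum>l<B. \<Sum>k\<in>UNIV. ?V q l k)" if q: "q < m" for q
    unfolding u_def
  proof (rule window_gap_dissipation[OF reg conn, where S = "{i. v $ i \<le> xs ! q}"])
    have "xs ! q \<in> range (($) v)" "xs ! Suc q \<in> range (($) v)"
      using q len by (auto simp flip: set_xs)
    then obtain i j where "v $ i = xs ! q" "v $ j = xs ! Suc q"
      by (metis rangeE)
    then have "i \<in> {i. v $ i \<le> xs ! q}" "j \<notin> {i. v $ i \<le> xs ! q}"
      using less[of q "Suc q"] q by auto
    then show "{i. v $ i \<le> xs ! q} \<noteq> {}" "{i. v $ i \<le> xs ! q} \<noteq> UNIV"
      by blast+
    show "xs ! q \<le> xs ! Suc q"
      using le q by simp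
    show "xs ! Suc q \<le> v $ i" if "i \<notin> {i. v $ i \<le> xs ! q}" for i
    proof -
      obtain r where r: "r \<le> m" "v $ i = xs ! r"
        using idx by blast
      then have "\<not> r \<le> q"
        using that le[of r q] q by auto
      then show ?thesis
        using le[of "Suc q" r] r by simp
    qed
  qed auto
  have "(norm v)\<^sup>2 - (norm (u B))\<^sup>2 = (\<Sum>l<B. (norm (u l))\<^sup>2 - (norm (u (Suc l)))\<^sup>2)"
    using sum_lessThan_telescope'[of "\<lambda>l. (norm (u l))\<^sup>2" B] by (simp add: u_def)
  also have "\<dots> = (\<Sum>l<B. \<Sum>k\<in>UNIV. row_variance (?A l) (($) (u l)) k)"
    unfolding u_Suc by (simp add: dissipation_eq doubly_stochastic_push_matrix reg)
  also have "\<dots> \<ge> (\<Sum>l<B. \<Sum>k\<in>UNIV. \<Sum>q<m. ?V q l k)"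
    using range le by (intro sum_mono row_variance_clip) (auto simp: push_matrix_nonneg)
  also have "(\<Sum>l<B. \<Sum>k\<in>UNIV. \<Sum>q<m. ?V q l k) = (\<Sum>q<m. \<Sum>l<B. \<Sum>k\<in>UNIV. ?V q l k)"
    by (subst sum.swap[of _ "{..<m}"]) (intro sum.cong refl sum.swap)
  finally have diss: "(\<Sum>q<m. \<Sum>l<B. \<Sum>k\<in>UNIV. ?V q l k) \<le> (norm v)\<^sup>2 - (norm (u B))\<^sup>2" .
  have gaps: "(\<Sum>q<m. (?g q)\<^sup>2) \<le> ?n * ((norm v)\<^sup>2 - (norm (u B))\<^sup>2)"
  proof -
    have "(\<Sum>q<m. (?g q)\<^sup>2) / ?n \<le> (\<Sum>q<m. \<Sum>l<B. \<Sum>k\<in>UNIV. ?V q l k)"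
      unfolding sum_divide_distrib using gap by (intro sum_mono) auto
    with diss have "(\<Sum>q<m. (?g q)\<^sup>2) / ?n \<le> (norm v)\<^sup>2 - (norm (u B))\<^sup>2"
      by linarith
    then show ?thesis
      by (simp add: divide_le_eq mult.commute)
  qed
  have "(norm v)\<^sup>2 \<le> ?n * (xs ! m - xs ! 0)\<^sup>2 / 4"
    using range[of 0] by (intro zero_sum_norm_le_spread[OF v]) (auto simp: u_def)
  also have "(xs ! m - xs ! 0)\<^sup>2 = (\<Sum>q<m. ?g q)\<^sup>2"
    by (simp add: sum_lessThan_telescope)
  also have "\<dots> \<le> (\<Sum>q<m. (?g q)\<^sup>2) * real m"
    using sum_squared_le_sum_of_squares[of ?g "{..<m}"] by simp
  also have "\<dots> \<le> (\<Sum>q<m. (?g q)\<^sup>2) * ?n"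
    using len by (intro mult_left_mono sum_nonneg) auto
  also have "\<dots> \<le> ?n * ((norm v)\<^sup>2 - (norm (u B))\<^sup>2) * ?n"
    by (intro mult_right_mono gaps) simp
  finally have "4 * (norm v)\<^sup>2 \<le> ?n ^ 3 * ((norm v)\<^sup>2 - (norm (u B))\<^sup>2)"
    by (simp add: power3_eq_cube ac_simps)
  then have "4 * (norm v)\<^sup>2 / ?n ^ 3 \<le> (norm v)\<^sup>2 - (norm (u B))\<^sup>2"
    by (simp add: divide_le_eq mult.commute)
  then show ?thesis
    by (simp add: u_def algebra_simps)
qed


lemma zero_sum_push_prod:
  "(\<Sum>j\<in>UNIV. v $ j) = 0 \<Longrightarrow> (\<Sum>j\<in>UNIV. (push_prod E s l *v v) $ j) = 0"
  by (simp add: sum_matrix_vector column_stochastic_push_prod)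

lemma mixesI:
  assumes "\<And>s l v. (\<Sum>j\<in>UNIV. v $ j) = 0 \<Longrightarrow> norm (push_prod E s l *v v) \<le> 2 * lam ^ l * norm v"
    and "0 \<le> lam"
  shows "mixes E lam"
  unfolding mixes_def
proof (intro allI impI)
  fix s l i and v :: "real^'a"
  assume "(\<Sum>j\<in>UNIV. v $ j) = 0"
  then have "\<bar>(push_prod E s l *v v) $ i\<bar> \<le> 2 * lam ^ l * norm v"
    using assms(1) component_le_norm_cart order_trans by blast
  also have "\<dots> \<le> 2 * lam ^ l * norm1 v"
    unfolding norm1_def using assms(2) by (intro mult_left_mono norm_le_l1_cart) auto
  finally show "\<bar>(push_prod E s l *v v) $ i\<bar> \<le> 2 * lam ^ l * norm1 v" .
qed

lemma norm_push_prod_le_geometric: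
  fixes E :: "nat \<Rightarrow> 'n::finite rel"
  assumes "0 \<le> r" "\<And>t v. (\<Sum>j\<in>UNIV. v $ j) = 0 \<Longrightarrow> norm (push_matrix (E t) *v v) \<le> r * norm v"
    and v: "(\<Sum>j\<in>UNIV. v $ j) = 0"
  shows "norm (push_prod E s l *v v) \<le> r ^ l * norm v"
proof (induction l)
  case (Suc l)
  have "norm (push_prod E s (Suc l) *v v) = norm (push_matrix (E (s + l)) *v (push_prod E s l *v v))"
    by (simp add: push_prod_Suc matrix_vector_mul_assoc)
  also have "\<dots> \<le> r * norm (push_prod E s l *v v)"
    by (intro assms(2) zero_sum_push_prod v)
  also have "\<dots> \<le> r * (r ^ l * norm v)"
    by (intro mult_left_mono Suc.IH assms(1))
  finally show ?case by simp
qed simp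

lemma norm_push_prod_regular_le:
  fixes E :: "nat \<Rightarrow> 'n::finite rel"
  assumes "\<And>t. regular_digraph (E t)" "(\<Sum>j\<in>UNIV. v $ j) = 0"
  shows "norm (push_prod E s l *v v) \<le> norm v"
  using norm_push_prod_le_geometric[of 1 E v s l] assms
  by (simp add: doubly_stochastic_norm_le doubly_stochastic_push_matrix)

lemma mixes_sigma2:
  fixes E :: "nat \<Rightarrow> 'n::finite rel"
  assumes reg: "\<And>t. regular_digraph (E t)" and n: "2 \<le> CARD('n)"
    and sg: "\<And>t. sigma2 (push_matrix (E t)) \<le> sg"
  shows "mixes E sg"
proof -
  have "0 \<le> sigma2 (push_matrix (E 0))"
    by (intro doubly_stochastic_sigma2 doubly_stochastic_push_matrix reg n)
  with sg[of 0] have sg0: "0 \<le> sg"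
    by simp
  show ?thesis
  proof (rule mixesI)
    fix s l and v :: "real^'n"
    assume v: "(\<Sum>j\<in>UNIV. v $ j) = 0"
    have "norm (push_matrix (E t) *v u) \<le> sg * norm u" if "(\<Sum>j\<in>UNIV. u $ j) = 0" for t u
    proof -
      have "norm (push_matrix (E t) *v u) \<le> sigma2 (push_matrix (E t)) * norm u"
        by (intro doubly_stochastic_sigma2 doubly_stochastic_push_matrix reg n that)
      also have "\<dots> \<le> sg * norm u"
        by (intro mult_right_mono sg norm_ge_zero)
      finally show ?thesis .
    qed
    from norm_push_prod_le_geometric[OF sg0 this v]
    have "norm (push_prod E s l *v v) \<le> sg ^ l * norm v" .
    moreover have "0 \<le> sg ^ l * norm v"
      using sg0 by simp
    ultimately show "norm (push_prod E s l *v v) \<le> 2 * sg ^ l * norm v"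
      by linarith
  qed (rule sg0)
qed

text \<open>A time interval of length \<open>l\<close> contains complete windows except for fewer than \<open>2 B\<close> steps.\<close>

lemma mixes_regular_windows:
  fixes E :: "nat \<Rightarrow> 'n::finite rel"
  assumes reg: "\<And>t. regular_digraph (E t)" and conn: "B_strongly_connected B E"
    and lam: "0 < lam" "lam \<le> 1" "1 - 4 / real CARD('n) ^ 3 \<le> (lam ^ B)\<^sup>2" "1 / 2 \<le> (lam ^ B)\<^sup>2"
  shows "mixes E lam"
proof (rule mixesI)
  fix s l and v :: "real^'n"
  assume v: "(\<Sum>j\<in>UNIV. v $ j) = 0"
  have B: "0 < B"
    using conn by (simp add: B_strongly_connected_def)
  have windows: "norm (push_prod E (k * B) (m * B) *v u) \<le> (lam ^ B) ^ m * norm u"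
    if u: "(\<Sum>j\<in>UNIV. u $ j) = 0" for u k m
  proof (induction m)
    case (Suc m)
    let ?w = "push_prod E (k * B) (m * B) *v u"
    have "push_prod E (k * B) (Suc m * B) *v u = push_prod E ((k + m) * B) B *v ?w"
      using push_prod_add[of E "k * B" "m * B" B]
      by (simp add: matrix_vector_mul_assoc add.commute algebra_simps)
    moreover have "strongly_connected (\<Union>t\<in>{(k + m) * B..<(k + m + 1) * B}. E t)"
      using conn unfolding B_strongly_connected_def by blast
    then have "strongly_connected (\<Union>t\<in>{(k + m) * B..<(k + m) * B + B}. E t)"
      by (simp only: add_mult_distrib mult_1)
    ultimately have "(norm (push_prod E (k * B) (Suc m * B) *v u))\<^sup>2
        \<le> (1 - 4 / real CARD('n) ^ 3) * (norm ?w)\<^sup>2"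
      using regular_window_contraction[where E = E and s = "(k + m) * B" and B = B and v = ?w, OF reg]
        zero_sum_push_prod[OF u] by simp
    also have "\<dots> \<le> (lam ^ B)\<^sup>2 * (norm ?w)\<^sup>2"
      by (intro mult_right_mono lam) simp
    also have "\<dots> = (lam ^ B * norm ?w)\<^sup>2"
      by (simp add: power_mult_distrib)
    finally have "norm (push_prod E (k * B) (Suc m * B) *v u) \<le> lam ^ B * norm ?w"
      using lam by (auto intro: power2_le_imp_le)
    also have "\<dots> \<le> lam ^ B * ((lam ^ B) ^ m * norm u)"
      using lam by (intro mult_left_mono Suc.IH) auto
    finally show ?case by simp
  qed simp
  obtain k a where a: "s + a = k * B" "a < B"
    using next_multiple[OF B] .
  let ?m = "(l - a) div B" and ?b = "(l - a) mod B"
  have "norm (push_prod E s l *v v) \<le> (lam ^ B) ^ ?m * norm v"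
  proof (cases "a \<le> l")
    case True
    have "l = a + (?m * B + ?b)"
      using True by simp
    then have "push_prod E s l *v v
        = push_prod E (s + a + ?m * B) ?b *v (push_prod E (k * B) (?m * B) *v (push_prod E s a *v v))"
      using push_prod_add[of E s a "?m * B + ?b"] push_prod_add[of E "s + a" "?m * B" ?b] a
      by (simp add: matrix_vector_mul_assoc matrix_mul_assoc)
    also have "norm \<dots> \<le> norm (push_prod E (k * B) (?m * B) *v (push_prod E s a *v v))"
      by (intro norm_push_prod_regular_le reg zero_sum_push_prod v)
    also have "\<dots> \<le> (lam ^ B) ^ ?m * norm (push_prod E s a *v v)"
      by (intro windows zero_sum_push_prod v)
    also have "\<dots> \<le> (lam ^ B) ^ ?m * norm v"
      using lam by (intro mult_left_mono norm_push_prod_regular_le reg v) auto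
    finally show ?thesis .
  next
    case False
    then show ?thesis
      using norm_push_prod_regular_le[OF reg v] by simp
  qed
  also have "\<dots> \<le> 2 * lam ^ l * norm v"
  proof (rule mult_right_mono)
    have "l \<le> ?m * B + 2 * B"
    proof -
      have "l \<le> a + (?m * B + ?b)" by simp
      moreover have "?b < B" using B by simp
      ultimately show ?thesis using a by linarith
    qed
    then have "lam ^ (?m * B + 2 * B) \<le> lam ^ l"
      using lam by (intro power_decreasing) auto
    moreover have "lam ^ (?m * B + 2 * B) = (lam ^ B) ^ ?m * (lam ^ B)\<^sup>2"
      by (simp add: power_add flip: power_mult) (simp add: ac_simps)
    moreover have "(lam ^ B) ^ ?m * (1 / 2) \<le> (lam ^ B) ^ ?m * (lam ^ B)\<^sup>2"
      using lam by (intro mult_left_mono) auto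
    ultimately show "(lam ^ B) ^ ?m \<le> 2 * lam ^ l"
      by linarith
  qed simp
  finally show "norm (push_prod E s l *v v) \<le> 2 * lam ^ l * norm v" .
qed (use lam in simp)

lemma power_le_reciprocal:
  fixes a :: real
  assumes "0 \<le> a" "a \<le> 1"
  shows "(1 - a) ^ n * (1 + real n * a) \<le> 1"
proof -
  have "(1 - a) ^ n * (1 + real n * a) \<le> (1 - a) ^ n * (1 + a) ^ n"
    using assms by (intro mult_left_mono Bernoulli_inequality) auto
  also have "\<dots> = (1 - a * a) ^ n"
    by (simp add: algebra_simps flip: power_mult_distrib)
  also have "\<dots> \<le> 1"
    using assms by (intro power_le_one) (auto simp: mult_le_one)
  finally show ?thesis .
qed

text \<open>The window contraction \<open>1 - 4 / n\<^sup>3\<close> of the squared norm is compared with both admissible rates. For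
  \<open>lam2\<close> this amounts to \<open>(1 - 2 / n\<^sup>3)\<^sup>n \<le> 1 / (1 + 2 / n\<^sup>2) \<le> 1 - 1 / n\<^bsup>n B\<^esup>\<close>. The weaker contraction
  that \<open>lam1\<close> alone asks for would not suffice: for \<open>n = 2\<close>, \<open>B \<le> 2\<close> and for \<open>n = 3\<close>, \<open>B = 1\<close> the
  rate \<open>lam2\<close> is the smaller one.\<close>

lemma regular_window_rates:
  fixes n B :: nat and e :: real
  assumes n: "2 \<le> n" and B: "0 < B" and e: "e = 1 / real n ^ (n * B)"
  defines "lam1 \<equiv> (1 - 1 / (4 * real n ^ 3)) powr (1 / real B)"
    and "lam2 \<equiv> (1 - e) powr (1 / real (n * B))"
  shows "1 - 4 / real n ^ 3 \<le> (lam1 ^ B)\<^sup>2" "1 / 2 \<le> (lam1 ^ B)\<^sup>2"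
    and "1 - 4 / real n ^ 3 \<le> (lam2 ^ B)\<^sup>2" "1 / 2 \<le> (lam2 ^ B)\<^sup>2"
    and "0 < lam1" "lam1 < 1" "0 < lam2" "lam2 < 1"
proof -
  have n3: "8 \<le> real n ^ 3"
    using power_mono[of 2 "real n" 3] n by simp
  define x where "x = 1 / real n ^ 3"
  have x: "0 < x" "x \<le> 1 / 8"
    using n3 n by (auto simp: x_def field_simps)
  have sq: "1 - 2 * c \<le> (1 - c)\<^sup>2" for c :: real
    by (simp add: power2_diff)
  have nB: "0 < n * B"
    using n B by simp
  have n2: "real n ^ 2 \<le> real n ^ (n * B)"
  proof -
    have "2 * 1 \<le> n * B"
      using n B by (intro mult_le_mono) auto
    then show ?thesis
      using n by (intro power_increasing) auto
  qed
  have "4 \<le> real n ^ 2"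
    using power_mono[of 2 "real n" 2] n by simp
  with n2 have "4 \<le> real n ^ (n * B)"
    by linarith
  then have e_bounds: "0 < e" "e \<le> 1 / 4"
    using n by (simp_all add: e field_simps)
  have l1: "lam1 ^ B = 1 - x / 4"
    using B x unfolding lam1_def x_def by (simp add: powr_power)
  have "1 - 4 * x \<le> (1 - x / 4)\<^sup>2"
    using sq[of "x / 4"] x by simp
  then show "1 - 4 / real n ^ 3 \<le> (lam1 ^ B)\<^sup>2"
    unfolding l1 by (simp add: x_def)
  show "1 / 2 \<le> (lam1 ^ B)\<^sup>2"
    using sq[of "x / 4"] x unfolding l1 by linarith
  have "0 < 1 - x / 4" "1 - x / 4 < 1"
    using x by auto
  then show "0 < lam1" "lam1 < 1"
    using B powr_less_mono2[of "1 / real B" "1 - x / 4" 1] unfolding lam1_def x_def by (auto simp: mult.commute)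
  show lam2: "0 < lam2" "lam2 < 1"
    using e_bounds nB powr_less_mono2[of "1 / real (n * B)" "1 - e" 1] unfolding lam2_def by auto
  have l2: "(lam2 ^ B) ^ n = 1 - e"
    using e_bounds nB unfolding lam2_def by (simp add: powr_power mult.commute flip: power_mult)
  have "(lam2 ^ B) ^ n \<le> (lam2 ^ B)\<^sup>2"
    using lam2 n by (intro power_decreasing) (auto intro: power_le_one)
  then show "1 / 2 \<le> (lam2 ^ B)\<^sup>2"
    using e_bounds unfolding l2 by linarith
  have "(1 - 2 * x) ^ n \<le> (lam2 ^ B) ^ n"
  proof -
    define q where "q = real n * (2 * x)"
    have q: "q = 2 / real n ^ 2"
      using n by (simp add: q_def x_def power2_eq_square power3_eq_cube)
    have "0 < q"
      using n by (simp add: q)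
    have "(1 - 2 * x) ^ n * (1 + q) \<le> 1"
      unfolding q_def using x by (intro power_le_reciprocal) auto
    also have "1 \<le> (1 - e) * (1 + q)"
    proof -
      have "e \<le> 1 / real n ^ 2"
        using n n2 by (simp add: e frac_le)
      then have "2 * e \<le> q"
        by (simp add: q)
      moreover have "e * q \<le> q / 2"
      proof -
        have "e * q \<le> 1 / 2 * q"
          using e_bounds \<open>0 < q\<close> by (intro mult_right_mono) auto
        then show ?thesis by simp
      qed
      ultimately show ?thesis
        by (simp add: algebra_simps)
    qed
    finally show ?thesis
      using \<open>0 < q\<close> unfolding l2 by simp
  qed
  moreover obtain k where k: "n = Suc k"
    using n by (cases n) auto
  ultimately have "1 - 2 * x \<le> lam2 ^ B"
    using power_le_imp_le_base[of "1 - 2 * x" k "lam2 ^ B"] lam2(1) unfolding k by simp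
  then have "(1 - 2 * x)\<^sup>2 \<le> (lam2 ^ B)\<^sup>2"
    using x by (intro power_mono) auto
  then show "1 - 4 / real n ^ 3 \<le> (lam2 ^ B)\<^sup>2"
    using sq[of "2 * x"] by (simp add: x_def)
qed

lemma finite_range_push_matrix: "finite (range (\<lambda>t. sigma2 (push_matrix (E t :: 'n::finite rel))))"
  by (rule finite_subset[of _ "(\<lambda>G. sigma2 (push_matrix G)) ` (UNIV :: 'n rel set)"]) auto

lemma push_weight_regular:
  assumes "\<And>t. regular_digraph (E t)"
  shows "push_prod E s t *v 1 = 1"
proof (induction t)
  case (Suc t)
  then show ?case
    using doubly_stochastic_mult_1(1)[OF doubly_stochastic_push_matrix[OF assms]]
    by (simp add: push_prod_Suc flip: matrix_vector_mul_assoc)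
qed simp

text \<open>For regular graphs each of the three upper bounds is at least a mixing rate with one and the same
  constant, so their minimum can be taken; it vanishes exactly if \<open>\<sigma>\<^sub>2\<close> does. Otherwise the rate from
  strong connectivity is used, with the general lower bound for the weights.\<close>

lemma mixing_rate_exists:
  fixes E :: "nat \<Rightarrow> 'n::finite rel" and B n :: nat
  assumes n: "n = CARD('n)" "2 \<le> n" and conn: "B_strongly_connected B E"
  obtains lam del :: real where
    "0 < lam \<or>
      lam = 0 \<and> (\<forall>t. regular_digraph (E t)) \<and> Max (range (\<lambda>t. sigma2 (push_matrix (E t)))) = 0"
    "lam < 1" "0 < del" "del \<le> 1" "del \<ge> 1 / real n ^ (n * B)"
    "lam \<le> (1 - 1 / real n ^ (n * B)) powr (1 / real (n * B))"
    "(\<forall>t. regular_digraph (E t)) \<longrightarrow> del = 1 \<and>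
      lam \<le> min ((1 - 1 / (4 * real n ^ 3)) powr (1 / real B))
                (Max (range (\<lambda>t. sigma2 (push_matrix (E t)))))"
    "mixes E lam" "\<And>t i. del \<le> (push_prod E 0 t *v 1) $ i"
proof -
  let ?e = "1 / real n ^ (n * B)"
  let ?lam1 = "(1 - 1 / (4 * real n ^ 3)) powr (1 / real B)"
    and ?lam2 = "(1 - ?e) powr (1 / real (n * B))"
    and ?sg = "Max (range (\<lambda>t. sigma2 (push_matrix (E t))))"
  have B: "0 < B"
    using conn by (simp add: B_strongly_connected_def)
  note rates = regular_window_rates[OF n(2) B refl]
  note e = e_bounds[OF n conn refl]
  show ?thesis
  proof (cases "\<forall>t. regular_digraph (E t)")
    case True
    have sg: "sigma2 (push_matrix (E t)) \<le> ?sg" for t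
      using finite_range_push_matrix by (intro Max_ge) auto
    have "0 \<le> sigma2 (push_matrix (E 0))"
      using True n by (intro doubly_stochastic_sigma2 doubly_stochastic_push_matrix) auto
    with sg[of 0] have sg0: "0 \<le> ?sg"
      by simp
    have mix12: "mixes E (min ?lam1 ?lam2)"
      using rates n True conn by (intro mixes_regular_windows) (auto simp: min_def)
    have mix3: "mixes E ?sg"
      using True n sg by (intro mixes_sigma2) auto
    show ?thesis
    proof (rule that[of "min (min ?lam1 ?lam2) ?sg" 1])
      show "mixes E (min (min ?lam1 ?lam2) ?sg)"
        using mix12 mix3 by (metis min_def)
      show "0 < min (min ?lam1 ?lam2) ?sg \<or>
          min (min ?lam1 ?lam2) ?sg = 0 \<and> (\<forall>t. regular_digraph (E t)) \<and> ?sg = 0"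
        using sg0 rates True by (auto simp: min_def)
    qed (use rates e True push_weight_regular[of E] in \<open>auto simp: min_less_iff_disj min_le_iff_disj\<close>)
  next
    case False
    show ?thesis
    proof (rule that[of ?lam2 ?e])
      show "mixes E ?lam2"
        by (rule mixes_strongly_connected[OF n conn refl])
      show "?e \<le> (push_prod E 0 t *v 1) $ i" for t i
        by (rule push_weight_lower[OF n conn refl])
    qed (use rates e False in auto)
  qed
qed

section \<open>Consensus of perturbed push-sum\<close>

lemma norm1_triangle: "norm1 (u - v) \<le> norm1 u + norm1 v"
  unfolding norm1_def sum.distrib[symmetric] by (intro sum_mono) (simp add: abs_triangle_ineq4)

lemma norm1_le_sqrt_dim: "norm1 (v :: real^'d) \<le> sqrt (real CARD('d)) * norm v"
proof -
  have "(norm1 v)\<^sup>2 \<le> (\<Sum>k\<in>UNIV. \<bar>v $ k\<bar>\<^sup>2) * real CARD('d)"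
    unfolding norm1_def using sum_squared_le_sum_of_squares[of "\<lambda>k. \<bar>v $ k\<bar>" UNIV] by simp
  also have "\<dots> = real CARD('d) * (norm v)\<^sup>2"
    unfolding power2_norm_eq_inner by (simp add: inner_vec_def power2_eq_square)
  finally show ?thesis
    using real_le_rsqrt by (metis norm_ge_zero real_sqrt_abs2 real_sqrt_mult abs_of_nonneg power2_eq_square)
qed

lemma norm1_recentre:
  fixes u y :: "real^'n"
  assumes y: "\<And>i. 0 \<le> y $ i" "(\<Sum>i\<in>UNIV. y $ i) = real CARD('n)"
  defines "r \<equiv> u - ((\<Sum>i\<in>UNIV. u $ i) / real CARD('n)) *\<^sub>R y"
  shows "(\<Sum>i\<in>UNIV. r $ i) = 0" "norm1 r \<le> 2 * norm1 u"
proof -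
  let ?b = "(\<Sum>i\<in>UNIV. u $ i) / real CARD('n)"
  show "(\<Sum>i\<in>UNIV. r $ i) = 0"
    using y(2) by (simp add: r_def sum_subtractf flip: sum_divide_distrib sum_distrib_left)
  have "norm1 (?b *\<^sub>R y) = \<bar>?b\<bar> * real CARD('n)"
    using y unfolding norm1_def by (simp only: vector_scaleR_component real_scaleR_def abs_mult abs_of_nonneg flip: sum_distrib_left)
  also have "\<dots> \<le> norm1 u"
    by (simp add: norm1_def abs_divide sum_abs)
  finally show "norm1 r \<le> 2 * norm1 u"
    using norm1_triangle[of u "?b *\<^sub>R y"] by (simp add: r_def)
qed

lemma push_weight_nonneg: "0 \<le> (push_prod E s t *v 1) $ i"
  using column_stochastic_push_prod[of E s t]
  by (auto simp: column_stochastic_def matrix_vector_mult_def intro!: sum_nonneg)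

lemma sum_push_weight: "(\<Sum>i\<in>UNIV. (push_prod E s t *v 1) $ i) = real CARD('n)"
  for E :: "nat \<Rightarrow> 'n::finite rel"
  by (simp add: sum_matrix_vector column_stochastic_push_prod)

text \<open>Each coordinate follows a scalar push-sum whose input \<open>X\<close> is perturbed by \<open>e\<close>. Subtracting the
  multiple \<open>b t\<close> of the weights with the same total leaves a zero-sum vector, which every
  factor of the push product keeps contracting.\<close>

lemma scalar_push_sum_consensus:
  fixes E :: "nat \<Rightarrow> 'n::finite rel" and X e :: "nat \<Rightarrow> real^'n"
  assumes mix: "mixes E lam" and lam: "0 \<le> lam"
    and X: "\<And>t. X (Suc t) = push_matrix (E t) *v X t - e (Suc t)"
  defines "b \<equiv> \<lambda>t. (\<Sum>j\<in>UNIV. X t $ j) / real CARD('n)"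
  shows "\<bar>(push_matrix (E t) *v X t) $ i - b t * (push_prod E 0 (Suc t) *v 1) $ i\<bar>
    \<le> 4 * (lam ^ Suc t * norm1 (X 0) + (\<Sum>s=1..t. lam ^ (Suc t - s) * norm1 (e s)))"
proof -
  let ?y = "\<lambda>t. push_prod E 0 t *v 1"
  define r where "r t = X t - b t *\<^sub>R ?y t" for t
  define \<eta> where "\<eta> s = e s - ((\<Sum>j\<in>UNIV. e s $ j) / real CARD('n)) *\<^sub>R ?y s" for s
  have y_Suc: "?y (Suc t) = push_matrix (E t) *v ?y t" for t
    by (simp add: push_prod_Suc flip: matrix_vector_mul_assoc)
  have b_Suc: "b (Suc t) = b t - (\<Sum>j\<in>UNIV. e (Suc t) $ j) / real CARD('n)" for t
    by (simp add: b_def X sum_subtractf sum_matrix_vector column_stochastic_push_matrix diff_divide_distrib)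
  have r_Suc: "r (Suc t) = push_matrix (E t) *v r t - \<eta> (Suc t)" for t
    by (simp add: r_def \<eta>_def b_Suc X y_Suc matrix_vector_mult_diff_distrib
        matrix_vector_mult_scaleR scaleR_diff_left)
  have unroll: "push_matrix (E t) *v r t
      = push_prod E 0 (Suc t) *v r 0 - (\<Sum>s=1..t. push_prod E s (Suc t - s) *v \<eta> s)" for t
  proof (induction t)
    case 0
    then show ?case by (simp add: push_prod_Suc)
  next
    case (Suc t)
    have step: "push_matrix (E (Suc t)) *v (push_prod E s (Suc t - s) *v u) = push_prod E s (Suc (Suc t) - s) *v u"
      if "s \<le> Suc t" for s u
      using that push_prod_Suc[of E s "Suc t - s"] by (simp add: matrix_vector_mul_assoc Suc_diff_le)
    have "push_matrix (E (Suc t)) *v r (Suc t) = push_matrix (E (Suc t)) *v (push_matrix (E t) *v r t)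
        - push_matrix (E (Suc t)) *v \<eta> (Suc t)"
      by (simp add: r_Suc matrix_vector_mult_diff_distrib)
    also have "\<dots> = push_prod E 0 (Suc (Suc t)) *v r 0
        - (\<Sum>s=1..t. push_prod E s (Suc (Suc t) - s) *v \<eta> s) - push_matrix (E (Suc t)) *v \<eta> (Suc t)"
      using step[of 0 "r 0"] step
      by (simp add: Suc.IH matrix_vector_mult_diff_distrib linear_sum[OF matrix_vector_mul_linear])
    also have "push_matrix (E (Suc t)) *v \<eta> (Suc t) = push_prod E (Suc t) (Suc (Suc t) - Suc t) *v \<eta> (Suc t)"
      using step[of "Suc t" "\<eta> (Suc t)"] by simp
    finally show ?case
      by (simp add: algebra_simps)
  qed
  have bound: "\<bar>(push_prod E s l *v (u - ((\<Sum>j\<in>UNIV. u $ j) / real CARD('n)) *\<^sub>R ?y k)) $ i\<bar>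
      \<le> 4 * (lam ^ l * norm1 u)" for s l k u
  proof -
    let ?u = "u - ((\<Sum>j\<in>UNIV. u $ j) / real CARD('n)) *\<^sub>R ?y k"
    have "(\<Sum>j\<in>UNIV. ?u $ j) = 0" "norm1 ?u \<le> 2 * norm1 u"
      using norm1_recentre[OF push_weight_nonneg sum_push_weight] by blast+
    then have "\<bar>(push_prod E s l *v ?u) $ i\<bar> \<le> 2 * lam ^ l * norm1 ?u"
      using mix by (auto simp: mixes_def)
    also have "\<dots> \<le> 2 * lam ^ l * (2 * norm1 u)"
      using lam \<open>norm1 ?u \<le> _\<close> by (intro mult_left_mono) auto
    finally show ?thesis by simp
  qed
  have "(push_matrix (E t) *v X t) $ i - b t * ?y (Suc t) $ i = (push_matrix (E t) *v r t) $ i"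
    by (simp add: r_def y_Suc matrix_vector_mult_diff_distrib matrix_vector_mult_scaleR)
  also have "\<dots> = (push_prod E 0 (Suc t) *v r 0) $ i - (\<Sum>s=1..t. (push_prod E s (Suc t - s) *v \<eta> s) $ i)"
    by (simp add: unroll)
  also have "\<bar>\<dots>\<bar> \<le> \<bar>(push_prod E 0 (Suc t) *v r 0) $ i\<bar>
      + (\<Sum>s=1..t. \<bar>(push_prod E s (Suc t - s) *v \<eta> s) $ i\<bar>)"
    by (intro order_trans[OF abs_triangle_ineq4] add_mono sum_abs order_refl)
  also have "\<dots> \<le> 4 * (lam ^ Suc t * norm1 (X 0)) + (\<Sum>s=1..t. 4 * (lam ^ (Suc t - s) * norm1 (e s)))"
    unfolding \<eta>_def r_def b_def by (intro add_mono sum_mono bound)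
  finally show ?thesis
    by (simp add: distrib_left sum_distrib_left)
qed

definition mean :: "('n::finite \<Rightarrow> 'v::real_vector) \<Rightarrow> 'v" where
  "mean x = (1 / real CARD('n)) *\<^sub>R (\<Sum>j\<in>UNIV. x j)"

context
  fixes E :: "nat \<Rightarrow> 'n::finite rel" and \<alpha> :: "nat \<Rightarrow> real" and y :: "nat \<Rightarrow> 'n \<Rightarrow> real"
    and x w z :: "nat \<Rightarrow> 'n \<Rightarrow> real^'d" and g :: "nat \<Rightarrow> 'n \<Rightarrow> real^'d \<Rightarrow> real^'d"
  assumes push: "gradient_push E \<alpha> g x w y z"
begin

lemma push_steps:
  "w (Suc t) i = (\<Sum>j\<in>in_nbhd (E t) i. x t j /\<^sub>R real (out_deg (E t) j))"
  "y (Suc t) i = (\<Sum>j\<in>in_nbhd (E t) i. y t j / real (out_deg (E t) j))"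
  "z (Suc t) i = w (Suc t) i /\<^sub>R y (Suc t) i"
  "x (Suc t) i = w (Suc t) i - \<alpha> (Suc t) *\<^sub>R g (Suc t) i (z (Suc t) i)"
  using push by (simp_all add: gradient_push_def)

lemma push_weight_eq: "y t i = (push_prod E 0 t *v 1) $ i"
proof (induction t arbitrary: i)
  case 0
  then show ?case using push by (simp add: gradient_push_def)
next
  case (Suc t)
  then show ?case
    by (simp add: push_steps push_prod_Suc push_matrix_mult flip: matrix_vector_mul_assoc)
qed

lemma push_coordinate: "w (Suc t) i $ k = (push_matrix (E t) *v (\<chi> j. x t j $ k)) $ i"
  by (simp add: push_steps push_matrix_mult divide_inverse mult.commute)

lemma mean_push: "mean (w (Suc t)) = mean (x t)"
proof -
  have "(\<Sum>i\<in>UNIV. w (Suc t) i) = (\<Sum>i\<in>UNIV. x t i)"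
    using sum_matrix_vector[OF column_stochastic_push_matrix, of "E t"]
    by (simp add: vec_eq_iff push_coordinate)
  then show ?thesis by (simp add: mean_def)
qed

lemma mean_step: "mean (x (Suc t))
  = mean (x t) - (\<alpha> (Suc t) / real CARD('n)) *\<^sub>R (\<Sum>j\<in>UNIV. g (Suc t) j (z (Suc t) j))"
  using mean_push[of t]
  by (simp add: mean_def push_steps(4) sum_subtractf scaleR_diff_right flip: scaleR_sum_right)

context
  fixes del :: real
  assumes del: "0 < del" "\<And>t i. del \<le> (push_prod E 0 t *v 1) $ i"
begin

lemma weight_ge: "del \<le> y t i"
  using del by (simp add: push_weight_eq)

text \<open>The mean of the iterates is a convex combination of the estimates, hence stays in every ball that
  contains them.\<close>

lemma norm_mean_le:
  assumes "\<And>i. norm (z (Suc t) i) \<le> D"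
  shows "norm (mean (x t)) \<le> D"
proof -
  let ?n = "real CARD('n)"
  have y: "0 < y (Suc t) i" for i
    using weight_ge[of "Suc t" i] del by simp
  have "w (Suc t) i = y (Suc t) i *\<^sub>R z (Suc t) i" for i
    using y[of i] by (simp add: push_steps(3))
  then have "mean (x t) = (1 / ?n) *\<^sub>R (\<Sum>i\<in>UNIV. y (Suc t) i *\<^sub>R z (Suc t) i)"
    by (simp add: mean_def mean_push[of t, symmetric, unfolded mean_def])
  also have "norm \<dots> \<le> (1 / ?n) * (\<Sum>i\<in>UNIV. y (Suc t) i * norm (z (Suc t) i))"
    using y by (auto intro!: divide_right_mono order_trans[OF norm_sum] sum_mono simp: less_imp_le)
  also have "\<dots> \<le> (1 / ?n) * (\<Sum>i\<in>UNIV. y (Suc t) i * D)"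
    using y assms by (intro mult_left_mono sum_mono) (auto simp: less_imp_le)
  also have "\<dots> = D"
    using sum_push_weight[of E 0 "Suc t"] by (simp add: push_weight_eq flip: sum_distrib_right)
  finally show ?thesis .
qed

lemma consensus_error:
  assumes mix: "mixes E lam" and lam: "0 \<le> lam"
  shows "norm (z (Suc t) i - mean (x t)) \<le> 4 / del * (lam ^ Suc t * (\<Sum>j\<in>UNIV. norm1 (x 0 j))
    + (\<Sum>s=1..t. lam ^ (Suc t - s) * (\<Sum>j\<in>UNIV. norm1 (\<alpha> s *\<^sub>R g s j (z s j)))))"
proof -
  let ?e = "\<lambda>s j. \<alpha> s *\<^sub>R g s j (z s j)"
  have y: "0 < y (Suc t) i"
    using weight_ge[of "Suc t" i] del by simp
  have swap: "(\<Sum>k\<in>UNIV. norm1 (\<chi> j. v j $ k)) = (\<Sum>j\<in>UNIV. norm1 (v j))" for v :: "'n \<Rightarrow> real^'d"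
    by (simp add: norm1_def) (rule sum.swap)
  have coord: "\<bar>(z (Suc t) i - mean (x t)) $ k\<bar> \<le> 4 / del * (lam ^ Suc t * norm1 (\<chi> j. x 0 j $ k)
    + (\<Sum>s=1..t. lam ^ (Suc t - s) * norm1 (\<chi> j. ?e s j $ k)))" (is "_ \<le> 4 / del * ?R") for k
  proof -
    have "(\<chi> j. x (Suc s) j $ k) = push_matrix (E s) *v (\<chi> j. x s j $ k) - (\<chi> j. ?e (Suc s) j $ k)" for s
      by (simp add: vec_eq_iff push_steps(4) push_coordinate)
    from scalar_push_sum_consensus[where X = "\<lambda>t. \<chi> j. x t j $ k" and e = "\<lambda>s. \<chi> j. ?e s j $ k",
        OF mix lam this, of t i]
    have "\<bar>w (Suc t) i $ k - mean (x t) $ k * y (Suc t) i\<bar> \<le> 4 * ?R"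
      by (simp add: push_coordinate push_weight_eq mean_def)
    moreover have "w (Suc t) i $ k - mean (x t) $ k * y (Suc t) i
        = (z (Suc t) i - mean (x t)) $ k * y (Suc t) i"
      using y by (simp add: push_steps(3) field_simps)
    ultimately have "\<bar>(z (Suc t) i - mean (x t)) $ k\<bar> * y (Suc t) i \<le> 4 * ?R"
      using y by (simp add: abs_mult)
    moreover have "\<bar>(z (Suc t) i - mean (x t)) $ k\<bar> * del \<le> \<bar>(z (Suc t) i - mean (x t)) $ k\<bar> * y (Suc t) i"
      by (intro mult_left_mono weight_ge) simp
    ultimately have "\<bar>(z (Suc t) i - mean (x t)) $ k\<bar> * del \<le> 4 * ?R"
      by linarith
    then show ?thesis
      using del by (simp add: field_simps)
  qed
  have "norm (z (Suc t) i - mean (x t)) \<le> (\<Sum>k\<in>UNIV. \<bar>(z (Suc t) i - mean (x t)) $ k\<bar>)"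
    by (rule norm_le_l1_cart)
  also have "\<dots> \<le> (\<Sum>k\<in>UNIV. 4 / del * (lam ^ Suc t * norm1 (\<chi> j. x 0 j $ k)
    + (\<Sum>s=1..t. lam ^ (Suc t - s) * norm1 (\<chi> j. ?e s j $ k))))"
    by (intro sum_mono coord)
  also have "\<dots> = 4 / del * (lam ^ Suc t * (\<Sum>k\<in>UNIV. norm1 (\<chi> j. x 0 j $ k))
    + (\<Sum>s=1..t. lam ^ (Suc t - s) * (\<Sum>k\<in>UNIV. norm1 (\<chi> j. ?e s j $ k))))"
    unfolding sum_distrib_left[symmetric] sum.distrib
    by (subst sum.swap) (simp add: sum_distrib_left)
  finally show ?thesis
    unfolding swap .
qed

end

end

section \<open>Strongly convex sums\<close>

text \<open>A step of length \<open>1\<close> in the direction of a subgradient \<open>g\<close> raises \<open>f\<close> by at least the norm of \<open>g\<close>,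
  and \<open>f\<close> is bounded on the ball of radius \<open>D + 1\<close>. Hence the supremum in the definition is one of a
  bounded set.\<close>

lemma subgradient_bound_ge:
  fixes f :: "'v::euclidean_space \<Rightarrow> real"
  assumes f: "convex_on UNIV f" and u: "norm u \<le> D" and g: "is_subgradient f u g"
  shows "norm g \<le> subgradient_bound f D"
  unfolding subgradient_bound_def
proof (rule cSup_upper)
  have "continuous_on (cball 0 (D + 1)) f"
    using convex_on_continuous[OF open_UNIV f] by (rule continuous_on_subset) simp
  then have "bounded (f ` cball 0 (D + 1))"
    by (intro compact_imp_bounded compact_continuous_image) auto
  then obtain K where "\<forall>y\<in>f ` cball 0 (D + 1). norm y \<le> K"
    by (auto simp: bounded_iff)
  then have K: "\<bar>f x\<bar> \<le> K" if "norm x \<le> D + 1" for x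
    using that by auto
  have "norm g \<le> 2 * K" if u: "u \<in> cball 0 D" and g: "is_subgradient f u g" for u g
  proof (cases "g = 0")
    case True
    then show ?thesis using K[of u] u by auto
  next
    case False
    let ?x = "u + (1 / norm g) *\<^sub>R g"
    have "norm ?x \<le> norm u + norm ((1 / norm g) *\<^sub>R g)"
      by (rule norm_triangle_ineq)
    also have "\<dots> \<le> D + 1"
      using u False by simp
    finally have "\<bar>f ?x\<bar> \<le> K"
      by (rule K)
    moreover have "\<bar>f u\<bar> \<le> K"
      using u by (intro K) simp
    moreover have "f ?x \<ge> f u + g \<bullet> (?x - u)"
      using g unfolding is_subgradient_def by blast
    moreover have "g \<bullet> (?x - u) = norm g"
      using False by (simp add: dot_square_norm power2_eq_square)
    ultimately show ?thesis by linarith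
  qed
  then show "bdd_above {norm g |u g. u \<in> cball 0 D \<and> is_subgradient f u g}"
    by (intro bdd_aboveI[of _ "2 * K"]) auto
qed (use u g in auto)

locale strongly_convex_sum =
  fixes f :: "'n::finite \<Rightarrow> 'v::euclidean_space \<Rightarrow> real" and \<mu> :: "'n \<Rightarrow> real"
    and h :: "'n \<Rightarrow> 'v \<Rightarrow> 'v" and v :: 'v and D :: real
  assumes strongly: "strongly_convex (\<mu> i) (f i)"
    and subgradient: "is_subgradient (f i) u (h i u)"
    and minimizer: "(\<Sum>j\<in>UNIV. f j v) \<le> (\<Sum>j\<in>UNIV. f j u)"
begin

definition F :: "'v \<Rightarrow> real" where
  "F u = (\<Sum>j\<in>UNIV. f j u)"

definition m :: real where
  "m = (\<Sum>j\<in>UNIV. \<mu> j)"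

definition Lip :: "'n \<Rightarrow> real" where
  "Lip j = subgradient_bound (f j) D"

lemma \<mu>_pos: "0 < \<mu> i"
  and convex_f: "convex_on UNIV (f i)"
  and growth: "f i u + h i u \<bullet> (x - u) + \<mu> i / 2 * (norm (x - u))\<^sup>2 \<le> f i x"
  using strongly[of i] subgradient[of i u] by (auto simp: strongly_convex_def) (smt (verit))

lemma norm_h_le: "norm u \<le> D \<Longrightarrow> norm (h i u) \<le> Lip i"
  unfolding Lip_def by (rule subgradient_bound_ge[OF convex_f _ subgradient])

lemma convex_F: "convex_on UNIV F"
proof -
  have "convex_on UNIV (\<lambda>u. \<Sum>j\<in>A. f j u)" if "finite A" for A
    using that by induction (auto intro!: convex_on_add convex_f simp: convex_on_const)
  from this[of UNIV] show ?thesis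
    by (simp add: F_def[abs_def])
qed

lemma F_ge: "F v \<le> F u"
  using minimizer by (simp add: F_def)

text \<open>The subgradients of the summands at the minimizer need not add up to zero. Instead, the growth
  inequality is used at a point \<open>u\<close> of the segment from \<open>v\<close> to \<open>x\<close> towards both ends, which cancels the
  subgradients, and \<open>u\<close> then tends to \<open>v\<close>.\<close>

lemma F_growth: "m / 2 * (norm (x - v))\<^sup>2 \<le> F x - F v"
proof (rule field_le_mult_one_interval)
  fix s :: real assume s: "0 < s" "s < 1"
  define t where "t = 1 - s"
  have t: "0 < t" "t < 1" using s by (auto simp: t_def)
  define u where "u = v + t *\<^sub>R (x - v)"
  define G where "G = (\<Sum>j\<in>UNIV. h j u)"
  have sub: "F u + G \<bullet> (a - u) + m / 2 * (norm (a - u))\<^sup>2 \<le> F a" for a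
  proof -
    have "F u + G \<bullet> (a - u) + m / 2 * (norm (a - u))\<^sup>2
        = (\<Sum>j\<in>UNIV. f j u + h j u \<bullet> (a - u) + \<mu> j / 2 * (norm (a - u))\<^sup>2)"
      by (simp add: F_def G_def m_def sum.distrib inner_sum_left sum_distrib_right sum_divide_distrib)
    also have "\<dots> \<le> F a"
      unfolding F_def by (intro sum_mono growth)
    finally show ?thesis .
  qed
  have x: "x - u = (1 - t) *\<^sub>R (x - v)" and v: "v - u = - t *\<^sub>R (x - v)"
    by (simp_all add: u_def algebra_simps)
  let ?q = "m / 2 * (norm (x - v))\<^sup>2" and ?g = "G \<bullet> (x - v)"
  have 1: "F u + (1 - t) * ?g + (1 - t)\<^sup>2 * ?q \<le> F x"
    using sub[of x] unfolding x by (simp add: power_mult_distrib mult.left_commute)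
  have 2: "F u - t * ?g + t\<^sup>2 * ?q \<le> F v"
    using sub[of v] unfolding v by (simp add: power_mult_distrib mult.left_commute)
  have "t * (F u + (1 - t) * ?g + (1 - t)\<^sup>2 * ?q) + (1 - t) * (F u - t * ?g + t\<^sup>2 * ?q)
      \<le> t * F x + (1 - t) * F v"
    using t by (intro add_mono mult_left_mono 1 2) auto
  moreover have "t * (a + (1 - t) * g + (1 - t)\<^sup>2 * q) + (1 - t) * (a - t * g + t\<^sup>2 * q)
      = a + t * (1 - t) * q" for a g q :: real
    by (simp add: power2_eq_square algebra_simps)
  ultimately have "F u + t * (1 - t) * ?q \<le> t * F x + (1 - t) * F v"
    by (simp only:)
  then have "t * ((1 - t) * ?q) \<le> t * (F x - F v)"
    using F_ge[of u] by (simp add: algebra_simps)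
  then show "s * ?q \<le> F x - F v"
    using t by (simp add: t_def)
qed

text \<open>Half of the strong convexity, in the form \<open>F X - F v \<ge> m/2 \<parallel>X - v\<parallel>\<^sup>2\<close>, contracts the distance of
  the mean \<open>X\<close>; the rest bounds the error at the estimates \<open>z\<close>, which differ from \<open>X\<close> by the
  consensus error.\<close>

lemma descent:
  fixes z :: "'n \<Rightarrow> 'v"
  assumes X: "norm X \<le> D" and z: "\<And>j. norm (z j) \<le> D"
    and e: "\<And>j. norm (z j - X) \<le> e"
  shows "m / 2 * (norm (X - v))\<^sup>2 + (F (z i) - F v + (\<Sum>j\<in>UNIV. \<mu> j * (norm (z j - v))\<^sup>2))
    - 5 * (\<Sum>j\<in>UNIV. Lip j) * e \<le> 2 * ((\<Sum>j\<in>UNIV. h j (z j)) \<bullet> (X - v))"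
proof -
  let ?L = "\<Sum>j\<in>UNIV. Lip j"
  have cs: "- (Lip j * e) \<le> h j u \<bullet> d" if "norm u \<le> D" "norm d \<le> e" for j u d
  proof -
    have "\<bar>h j u \<bullet> d\<bar> \<le> norm (h j u) * norm d"
      by (rule Cauchy_Schwarz_ineq2)
    also have "\<dots> \<le> Lip j * e"
    proof (rule mult_mono)
      show "norm (h j u) \<le> Lip j"
        by (rule norm_h_le) (rule that)
      then show "0 \<le> Lip j"
        using norm_ge_zero order_trans by blast
    qed (use that in auto)
    finally show ?thesis by linarith
  qed
  have e': "norm (X - z j) \<le> e" for j
    using e[of j] by (simp add: norm_minus_commute)
  have "f j X - f j v + \<mu> j / 2 * (norm (z j - v))\<^sup>2 - 2 * (Lip j * e) \<le> h j (z j) \<bullet> (X - v)" for j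
  proof -
    have "h j (z j) \<bullet> (X - v) = h j (z j) \<bullet> (X - z j) - h j (z j) \<bullet> (v - z j)"
      by (simp add: inner_diff_right)
    moreover have "f j (z j) + h j (z j) \<bullet> (v - z j) + \<mu> j / 2 * (norm (z j - v))\<^sup>2 \<le> f j v"
      using growth[of j "z j" v] by (simp add: norm_minus_commute)
    moreover have "f j X + h j X \<bullet> (z j - X) \<le> f j (z j)"
      using subgradient[of j X] by (auto simp: is_subgradient_def)
    ultimately show ?thesis
      using cs[OF z[of j] e'[of j], of j] cs[OF X e[of j], of j] by linarith
  qed
  then have "(\<Sum>j\<in>UNIV. f j X - f j v + \<mu> j / 2 * (norm (z j - v))\<^sup>2 - 2 * (Lip j * e))
      \<le> (\<Sum>j\<in>UNIV. h j (z j) \<bullet> (X - v))"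
    by (intro sum_mono)
  then have 1: "F X - F v + (\<Sum>j\<in>UNIV. \<mu> j * (norm (z j - v))\<^sup>2) / 2 - 2 * (?L * e)
      \<le> (\<Sum>j\<in>UNIV. h j (z j)) \<bullet> (X - v)"
    by (simp add: F_def sum.distrib sum_subtractf inner_sum_left sum_divide_distrib
        sum_distrib_left sum_distrib_right)
  have "(\<Sum>j\<in>UNIV. f j (z i) - Lip j * e) \<le> (\<Sum>j\<in>UNIV. f j X)"
  proof (rule sum_mono)
    fix j
    have "f j (z i) + h j (z i) \<bullet> (X - z i) \<le> f j X"
      using subgradient[of j "z i"] by (auto simp: is_subgradient_def)
    then show "f j (z i) - Lip j * e \<le> f j X"
      using cs[OF z[of i] e'[of i], of j] by linarith
  qed
  then have 2: "F (z i) - ?L * e \<le> F X"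
    by (simp add: F_def sum_subtractf sum_distrib_right)
  show ?thesis
    using 1 2 F_growth[of X] by (simp add: algebra_simps)
qed

end

section \<open>Noise that is independent of the past\<close>

text \<open>What the samples with indices in \<open>J\<close> reveal.\<close>

definition info :: "'a measure \<Rightarrow> ('k \<Rightarrow> 'a measure) \<Rightarrow> 'k set \<Rightarrow> 'a measure" where
  "info M S J = sigma (space M) (\<Union>k\<in>J. sets (S k))"

context prob_space
begin

text \<open>By independence the pair of the two pieces of information has a product distribution, so
  the noise can be averaged first, with \<open>\<phi>\<close> and the query point \<open>\<zeta>\<close> held fixed.\<close>

lemma independent_mean_zero:
  fixes N :: "'v::euclidean_space \<Rightarrow> 'a \<Rightarrow> 'v"
  assumes sub: "subalgebra M F" "subalgebra M S"
    and indep: "indep_set (sets F) (sets S)"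
    and \<phi>: "\<phi> \<in> borel_measurable F" and \<zeta>: "\<zeta> \<in> borel_measurable F"
    and N: "(\<lambda>(u, \<omega>). N u \<omega>) \<in> borel_measurable (borel \<Otimes>\<^sub>M S)"
    and mean: "\<And>u. (\<integral>\<omega>. N u \<omega> \<partial>M) = 0"
    and bound: "AE \<omega> in M. norm (\<phi> \<omega>) \<le> K" "AE \<omega> in M. \<forall>u. norm (N u \<omega>) \<le> c"
  shows "integrable M (\<lambda>\<omega>. \<phi> \<omega> \<bullet> N (\<zeta> \<omega>) \<omega>)" "(\<integral>\<omega>. \<phi> \<omega> \<bullet> N (\<zeta> \<omega>) \<omega> \<partial>M) = 0"
proof -
  have spaces: "space F = space M" "space S = space M"
    using sub by (auto simp: subalgebra_def)
  have idF: "(\<lambda>x. x) \<in> M \<rightarrow>\<^sub>M F" and idS: "(\<lambda>x. x) \<in> M \<rightarrow>\<^sub>M S"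
    by (rule measurable_from_subalg[OF sub(1) measurable_ident_sets[OF refl]],
        rule measurable_from_subalg[OF sub(2) measurable_ident_sets[OF refl]])
  define \<psi> where "\<psi> = (\<lambda>(a, b). \<phi> a \<bullet> N (\<zeta> a) b)"
  have N': "(\<lambda>p. N (\<zeta> (fst p)) (snd p)) \<in> borel_measurable (F \<Otimes>\<^sub>M S)"
  proof -
    have "(\<lambda>p. (\<zeta> (fst p), snd p)) \<in> F \<Otimes>\<^sub>M S \<rightarrow>\<^sub>M borel \<Otimes>\<^sub>M S"
      using \<zeta> by measurable
    from measurable_compose[OF this N] show ?thesis
      by simp
  qed
  have \<psi>: "\<psi> \<in> borel_measurable (F \<Otimes>\<^sub>M S)"
  proof -
    have "(\<lambda>p. \<phi> (fst p)) \<in> borel_measurable (F \<Otimes>\<^sub>M S)"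
      using \<phi> by measurable
    then show ?thesis
      using N' unfolding \<psi>_def case_prod_beta by (intro borel_measurable_inner)
  qed
  have Nu: "N u \<in> borel_measurable S" for u
    using measurable_Pair2[OF N, of u] by simp
  have pair: "(\<lambda>x. (x, x)) \<in> M \<rightarrow>\<^sub>M F \<Otimes>\<^sub>M S"
    using idF idS by (rule measurable_Pair)
  let ?P = "distr M F (\<lambda>x. x)" and ?Q = "distr M S (\<lambda>x. x)"
  have preimages: "sigma_sets (space M) {(\<lambda>x. x) -` A \<inter> space M |A. A \<in> sets G} = sets G"
    if "subalgebra M G" for G
  proof -
    have "{(\<lambda>x. x) -` A \<inter> space M |A. A \<in> sets G} = sets G"
      using that sets.sets_into_space[of _ G] by (auto simp: subalgebra_def Int_absorb2 intro!: exI)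
    then show ?thesis
      using that sets.sigma_sets_eq[of G] by (simp add: subalgebra_def)
  qed
  have "indep_var F (\<lambda>x. x) S (\<lambda>x. x)"
    unfolding indep_var_eq using idF idS indep preimages[OF sub(1)] preimages[OF sub(2)] by simp
  then have prod: "?P \<Otimes>\<^sub>M ?Q = distr M (F \<Otimes>\<^sub>M S) (\<lambda>x. (x, x))"
    by (simp add: indep_var_distribution_eq)
  interpret P: prob_space ?P by (rule prob_space_distr[OF idF])
  interpret Q: prob_space ?Q by (rule prob_space_distr[OF idS])
  interpret PQ: pair_prob_space ?P ?Q ..
  have int: "integrable M (\<lambda>\<omega>. \<psi> (\<omega>, \<omega>))"
  proof (rule integrable_const_bound)
    show "AE \<omega> in M. norm (\<psi> (\<omega>, \<omega>)) \<le> \<bar>K\<bar> * \<bar>c\<bar>"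
      using bound
    proof eventually_elim
      case (elim \<omega>)
      have "\<bar>\<phi> \<omega> \<bullet> N (\<zeta> \<omega>) \<omega>\<bar> \<le> norm (\<phi> \<omega>) * norm (N (\<zeta> \<omega>) \<omega>)"
        by (rule Cauchy_Schwarz_ineq2)
      also have "\<dots> \<le> \<bar>K\<bar> * \<bar>c\<bar>"
        using elim by (intro mult_mono) (auto intro: order_trans[OF _ abs_ge_self])
      finally show ?case by (simp add: \<psi>_def)
    qed
    show "(\<lambda>\<omega>. \<psi> (\<omega>, \<omega>)) \<in> borel_measurable M"
      using measurable_compose[OF pair \<psi>] .
  qed
  then show "integrable M (\<lambda>\<omega>. \<phi> \<omega> \<bullet> N (\<zeta> \<omega>) \<omega>)"
    by (simp add: \<psi>_def)
  have int_PQ: "integrable (?P \<Otimes>\<^sub>M ?Q) \<psi>"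
    using int by (simp add: prod integrable_distr_eq[OF pair \<psi>])
  have intN: "integrable ?Q (N u)" for u
  proof -
    have "integrable M (N u)"
    proof (rule integrable_const_bound)
      show "AE \<omega> in M. norm (N u \<omega>) \<le> c"
        using bound(2) by eventually_elim simp
      show "N u \<in> borel_measurable M"
        using measurable_compose[OF idS Nu] .
    qed
    then show ?thesis
      by (simp add: integrable_distr_eq[OF idS Nu])
  qed
  have zero: "(\<integral>b. \<psi> (a, b) \<partial>?Q) = 0" for a
    using intN mean by (simp add: \<psi>_def integral_distr[OF idS Nu])
  have "(\<integral>\<omega>. \<psi> (\<omega>, \<omega>) \<partial>M) = (\<integral>p. \<psi> p \<partial>(?P \<Otimes>\<^sub>M ?Q))"
    by (simp add: prod integral_distr[OF pair \<psi>])
  also have "\<dots> = (\<integral>a. (\<integral>b. \<psi> (a, b) \<partial>?Q) \<partial>?P)"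
    using PQ.integral_fst'[OF int_PQ] by simp
  also have "\<dots> = 0"
    by (simp add: zero)
  finally show "(\<integral>\<omega>. \<phi> \<omega> \<bullet> N (\<zeta> \<omega>) \<omega> \<partial>M) = 0"
    by (simp add: \<psi>_def)
qed

lemma space_info [simp]: "space (info M S J) = space M"
  by (simp add: info_def space_measure_of_conv)

lemma sets_info:
  assumes "\<And>k. k \<in> J \<Longrightarrow> subalgebra M (S k)"
  shows "sets (info M S J) = sigma_sets (space M) (\<Union>k\<in>J. sets (S k))"
  using assms sets.sets_into_space unfolding info_def subalgebra_def
  by (intro sets_measure_of) fastforce

lemma subalgebra_info:
  assumes "\<And>k. k \<in> J \<Longrightarrow> subalgebra M (S k)"
  shows "subalgebra M (info M S J)"
  using assms unfolding subalgebra_def by (auto simp: sets_info assms intro!: sets.sigma_sets_subset)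

lemma info_mono:
  assumes "J \<subseteq> J'" "\<And>k. k \<in> J' \<Longrightarrow> subalgebra M (S k)" "f \<in> info M S J \<rightarrow>\<^sub>M R"
  shows "f \<in> info M S J' \<rightarrow>\<^sub>M R"
proof -
  have "sets (info M S J) \<subseteq> sets (info M S J')"
    using assms(1,2) by (subst (1 2) sets_info) (auto intro!: sigma_sets_mono')
  then show ?thesis
    using assms(3) by (auto simp: measurable_def)
qed

lemma measurable_info_query:
  assumes sub: "\<And>k. k \<in> J \<Longrightarrow> subalgebra M (S k)" and k: "k \<in> J"
    and \<zeta>: "\<zeta> \<in> borel_measurable (info M S J)"
    and N: "(\<lambda>(u, \<omega>). N u \<omega>) \<in> borel_measurable (borel \<Otimes>\<^sub>M S k)"
  shows "(\<lambda>\<omega>. N (\<zeta> \<omega>) \<omega>) \<in> borel_measurable (info M S J)"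
proof -
  have "(\<lambda>\<omega>. \<omega>) \<in> info M S J \<rightarrow>\<^sub>M S k"
  proof (rule measurableI)
    show "\<omega> \<in> space (S k)" if "\<omega> \<in> space (info M S J)" for \<omega>
      using that sub[OF k] by (simp add: subalgebra_def)
    show "(\<lambda>\<omega>. \<omega>) -` A \<inter> space (info M S J) \<in> sets (info M S J)" if A: "A \<in> sets (S k)" for A
    proof -
      have "A \<subseteq> space M"
        using sets.sets_into_space[OF A] sub[OF k] by (simp add: subalgebra_def)
      then have "(\<lambda>\<omega>. \<omega>) -` A \<inter> space (info M S J) = A"
        by auto
      then show ?thesis
        using A k sub by (auto simp: sets_info intro!: sigma_sets.Basic)
    qed
  qed
  then have "(\<lambda>\<omega>. (\<zeta> \<omega>, \<omega>)) \<in> info M S J \<rightarrow>\<^sub>M borel \<Otimes>\<^sub>M S k"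
    using \<zeta> by (intro measurable_Pair)
  from measurable_compose[OF this N] show ?thesis by simp
qed

lemma indep_info_rest:
  assumes indep: "indep_sets (\<lambda>k. sets (S k)) J" and k: "k \<in> J"
    and sub: "\<And>k. k \<in> J \<Longrightarrow> subalgebra M (S k)"
  shows "indep_set (sets (info M S (J - {k}))) (sets (S k))"
proof -
  let ?I = "case_bool (J - {k}) {k}"
  have "indep_sets (\<lambda>b. sigma_sets (space M) (\<Union>i\<in>?I b. sets (S i))) UNIV"
  proof (rule indep_sets_collect_sigma)
    show "indep_sets (\<lambda>k. sets (S k)) (\<Union>b\<in>UNIV. ?I b)"
      using indep k by (simp add: UNIV_bool insert_absorb)
    show "Int_stable (sets (S i))" for i
      by (rule sets.Int_stable)
    show "disjoint_family_on ?I UNIV"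
      by (auto simp: disjoint_family_on_def split: bool.splits)
  qed
  moreover have "sigma_sets (space M) (sets (S k)) = sets (S k)"
    using sets.sigma_sets_eq[of "S k"] sub[OF k] by (simp add: subalgebra_def)
  moreover have "sets (info M S (J - {k})) = sigma_sets (space M) (\<Union>i\<in>J - {k}. sets (S i))"
    using sub by (intro sets_info) auto
  moreover have "(\<lambda>b. sigma_sets (space M) (\<Union>i\<in>?I b. sets (S i)))
      = case_bool (sigma_sets (space M) (\<Union>i\<in>J - {k}. sets (S i))) (sigma_sets (space M) (sets (S k)))"
    by (auto simp: fun_eq_iff split: bool.splits)
  ultimately show ?thesis
    by (simp add: indep_set_def)
qed

end

section \<open>One step in expectation\<close>

lemma norm_diff_scaleR_squared:
  fixes a g :: "'v::real_inner"
  shows "(norm (a - b *\<^sub>R g))\<^sup>2 = (norm a)\<^sup>2 - 2 * b * (a \<bullet> g) + b\<^sup>2 * (norm g)\<^sup>2"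
  unfolding power2_norm_eq_inner
  by (simp add: inner_diff_left inner_diff_right inner_commute[of g a] power2_eq_square[of b] algebra_simps)

lemma norm_sum_squared:
  fixes N :: "'n::finite \<Rightarrow> 'v::real_inner"
  shows "(norm (\<Sum>j\<in>UNIV. N j))\<^sup>2 = (\<Sum>j\<in>UNIV. \<Sum>k\<in>UNIV. N j \<bullet> N k)"
  unfolding power2_norm_eq_inner by (simp only: inner_sum_left inner_sum_right) (rule sum.swap)

text \<open>The past influence of an input \<open>g s\<close> after a delay of \<open>Suc t - s\<close> steps; index \<open>0\<close> stands for
  the initial values.\<close>

definition lagged :: "real \<Rightarrow> (nat \<Rightarrow> real) \<Rightarrow> nat \<Rightarrow> real" where
  "lagged lam g t = (\<Sum>s\<le>t. lam ^ (Suc t - s) * g s)"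

text \<open>The graph sequence enters only through a mixing rate and a lower bound for the weights. A pair
  \<open>(t, i)\<close> indexes the sample of node \<open>i\<close> at step \<open>t\<close>.\<close>

locale stochastic_gradient_push = prob_space M + strongly_convex_sum f \<mu> h v D
  for M :: "'a measure" and f :: "'n::finite \<Rightarrow> real^'d \<Rightarrow> real" and \<mu> h v D +
  fixes E :: "nat \<Rightarrow> 'n rel" and lam del :: real
    and N :: "nat \<Rightarrow> 'n \<Rightarrow> real^'d \<Rightarrow> 'a \<Rightarrow> real^'d" and S :: "nat \<times> 'n \<Rightarrow> 'a measure"
    and c :: "'n \<Rightarrow> real" and p :: real and x0 :: "'n \<Rightarrow> real^'d"
    and x w z :: "nat \<Rightarrow> 'n \<Rightarrow> 'a \<Rightarrow> real^'d" and y :: "nat \<Rightarrow> 'n \<Rightarrow> real"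
  assumes lam: "0 \<le> lam" "lam < 1" and mix: "mixes E lam"
    and del: "0 < del" "del \<le> 1" and weight: "del \<le> (push_prod E 0 t *v 1) $ i"
    and h_measurable: "h i \<in> borel_measurable borel"
    and subalgebra_S: "k \<in> {1..} \<times> UNIV \<Longrightarrow> subalgebra M (S k)"
    and N_measurable: "1 \<le> t \<Longrightarrow> (\<lambda>(u, \<omega>). N t i u \<omega>) \<in> borel_measurable (borel \<Otimes>\<^sub>M S (t, i))"
    and indep_S: "indep_sets (\<lambda>k. sets (S k)) ({1..} \<times> UNIV)"
    and N_mean: "1 \<le> t \<Longrightarrow> (\<integral>\<omega>. N t i u \<omega> \<partial>M) = 0"
    and N_bound: "1 \<le> t \<Longrightarrow> AE \<omega> in M. \<forall>u. norm (N t i u \<omega>) \<le> c i"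
    and c_pos: "0 < c i"
    and p_large: "4 \<le> p * ((\<Sum>i\<in>UNIV. \<mu> i) / real CARD('n))"
    and initial: "\<omega> \<in> space M \<Longrightarrow> x 0 i \<omega> = x0 i"
    and push: "\<omega> \<in> space M \<Longrightarrow> gradient_push E (\<lambda>t. p / real t) (\<lambda>t i u. h i u + N t i u \<omega>)
         (\<lambda>t i. x t i \<omega>) (\<lambda>t i. w t i \<omega>) y (\<lambda>t i. z t i \<omega>)"
    and z_bound: "AE \<omega> in M. \<forall>i. \<forall>t\<ge>1. norm (z t i \<omega>) \<le> D"
begin

definition L :: real where
  "L = (\<Sum>j\<in>UNIV. Lip j)"

definition past :: "nat \<Rightarrow> 'a measure" where
  "past t = info M S ({1..t} \<times> UNIV)"

definition noise :: "nat \<Rightarrow> 'n \<Rightarrow> 'a \<Rightarrow> real^'d" where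
  "noise t i \<omega> = N t i (z t i \<omega>) \<omega>"

definition centre :: "nat \<Rightarrow> 'a \<Rightarrow> real^'d" where
  "centre t \<omega> = mean (\<lambda>j. x t j \<omega>)"

definition H :: "nat \<Rightarrow> 'a \<Rightarrow> real^'d" where
  "H t \<omega> = (\<Sum>j\<in>UNIV. h j (z t j \<omega>))"

definition gap :: "('n \<Rightarrow> real^'d) \<Rightarrow> 'n \<Rightarrow> real" where
  "gap u i = F (u i) - F v + (\<Sum>j\<in>UNIV. \<mu> j * (norm (u j - v))\<^sup>2)"

text \<open>An almost sure bound in the \<open>1\<close>-norm for the perturbation that the gradient step \<open>s\<close> adds to the push-sum.\<close>

definition input :: "nat \<Rightarrow> real" where
  "input s = (if s = 0 then \<Sum>j\<in>UNIV. norm1 (x0 j)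
    else p / real s * (\<Sum>j\<in>UNIV. sqrt (real CARD('d)) * (Lip j + c j)))"

definition error :: "nat \<Rightarrow> real" where
  "error t = 4 / del * lagged lam input t"

lemma m_pos: "0 < m"
  unfolding m_def by (intro sum_pos) (auto intro: \<mu>_pos)

lemma p_pos: "0 < p"
proof (rule ccontr)
  assume "\<not> 0 < p"
  then have "p * (m / real CARD('n)) \<le> 0"
    using m_pos by (intro mult_nonpos_nonneg) auto
  then show False
    using p_large by (simp add: m_def)
qed

lemma D_nonneg: "0 \<le> D"
proof -
  have "AE \<omega> in M. 0 \<le> D"
    using z_bound by eventually_elim (meson norm_ge_zero order_refl order_trans)
  then show ?thesis by simp
qed

lemma Lip_nonneg: "0 \<le> Lip j"
  using norm_h_le[of 0 j] D_nonneg by (simp add: order_trans[OF norm_ge_zero])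

lemma L_nonneg: "0 \<le> L"
  unfolding L_def by (intro sum_nonneg Lip_nonneg)

lemma AE_good: "AE \<omega> in M. \<omega> \<in> space M \<and> (\<forall>t\<ge>1. \<forall>i. norm (z t i \<omega>) \<le> D)
    \<and> (\<forall>t\<ge>1. \<forall>i u. norm (N t i u \<omega>) \<le> c i)"
proof -
  have "AE \<omega> in M. \<forall>t\<in>{1..}. \<forall>i\<in>UNIV. \<forall>u. norm (N t i u \<omega>) \<le> c i"
    using N_bound by (intro AE_ball_countable' AE_finite_allI) auto
  then show ?thesis
    using z_bound AE_space by eventually_elim auto
qed

subsection \<open>Adaptedness\<close>

lemma space_past [simp]: "space (past t) = space M"
  by (simp add: past_def)

lemma past_mono: "g \<in> past s \<rightarrow>\<^sub>M R \<Longrightarrow> s \<le> t \<Longrightarrow> g \<in> past t \<rightarrow>\<^sub>M R"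
  unfolding past_def by (rule info_mono[of "{1..s} \<times> UNIV"]) (auto intro: subalgebra_S)

lemma w_adapted:
  assumes "\<And>j. x t j \<in> borel_measurable (past t)"
  shows "w (Suc t) i \<in> borel_measurable (past t)"
proof -
  have "(\<lambda>\<omega>. \<Sum>j\<in>in_nbhd (E t) i. x t j \<omega> /\<^sub>R real (out_deg (E t) j)) \<in> borel_measurable (past t)"
    using assms by measurable
  then show ?thesis
    by (rule measurable_cong[THEN iffD2, rotated]) (simp add: push_steps(1)[OF push])
qed

lemma z_adapted':
  assumes "\<And>j. x t j \<in> borel_measurable (past t)"
  shows "z (Suc t) i \<in> borel_measurable (past t)"
proof -
  have "(\<lambda>\<omega>. w (Suc t) i \<omega> /\<^sub>R y (Suc t) i) \<in> borel_measurable (past t)"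
    using w_adapted[OF assms] by measurable
  then show ?thesis
    by (rule measurable_cong[THEN iffD2, rotated]) (simp add: push_steps(3)[OF push])
qed

lemma x_adapted: "x t i \<in> borel_measurable (past t)"
proof (induction t arbitrary: i)
  case 0
  have "(\<lambda>\<omega>. x0 i) \<in> borel_measurable (past 0)"
    by simp
  then show ?case
    by (rule measurable_cong[THEN iffD2, rotated]) (simp add: initial)
next
  case (Suc t)
  have z: "z (Suc t) i \<in> borel_measurable (past (Suc t))"
    using z_adapted'[OF Suc] by (rule past_mono) simp
  have w: "w (Suc t) i \<in> borel_measurable (past (Suc t))"
    using w_adapted[OF Suc] by (rule past_mono) simp
  have noise: "(\<lambda>\<omega>. N (Suc t) i (z (Suc t) i \<omega>) \<omega>) \<in> borel_measurable (past (Suc t))"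
    unfolding past_def
    by (rule measurable_info_query[where k = "(Suc t, i)"])
      (use z in \<open>auto intro: subalgebra_S N_measurable simp: past_def\<close>)
  have "(\<lambda>\<omega>. h i (z (Suc t) i \<omega>)) \<in> borel_measurable (past (Suc t))"
    using measurable_compose[OF z h_measurable] .
  with w noise have "(\<lambda>\<omega>. w (Suc t) i \<omega> - (p / real (Suc t)) *\<^sub>R
      (h i (z (Suc t) i \<omega>) + N (Suc t) i (z (Suc t) i \<omega>) \<omega>)) \<in> borel_measurable (past (Suc t))"
    by (intro borel_measurable_diff borel_measurable_scaleR borel_measurable_add) auto
  then show ?case
    by (rule measurable_cong[THEN iffD2, rotated]) (simp add: push_steps(4)[OF push])
qed

lemma z_adapted: "z (Suc t) i \<in> borel_measurable (past t)"
  by (rule z_adapted'[OF x_adapted])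

lemma measurable_past: "g \<in> past t \<rightarrow>\<^sub>M R \<Longrightarrow> g \<in> M \<rightarrow>\<^sub>M R"
  unfolding past_def
  by (erule measurable_from_subalg[rotated]) (auto intro!: subalgebra_info subalgebra_S)

lemma noise_measurable:
  assumes "(Suc t, i) \<in> J" "J \<subseteq> {1..} \<times> UNIV" "{1..t} \<times> UNIV \<subseteq> J"
  shows "noise (Suc t) i \<in> borel_measurable (info M S J)"
proof -
  have sub: "subalgebra M (S k)" if "k \<in> J" for k
    using that assms(2) subalgebra_S by blast
  have "z (Suc t) i \<in> borel_measurable (info M S J)"
    by (rule info_mono[of "{1..t} \<times> UNIV"]) (use assms z_adapted[of t i] sub in \<open>auto simp: past_def\<close>)
  from measurable_info_query[OF sub assms(1) this N_measurable] show ?thesis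
    by (simp add: noise_def[abs_def])
qed

lemma noise_measurable_M: "noise (Suc t) i \<in> borel_measurable M"
  by (rule measurable_from_subalg[OF _ noise_measurable[of t i "{1..} \<times> UNIV"]])
    (auto intro!: subalgebra_info subalgebra_S)

text \<open>Here \<open>\<phi>\<close> may depend on every other sample, in particular on those of the other nodes at the same
  step, which makes the noises of different nodes uncorrelated.\<close>

lemma noise_orthogonal:
  assumes \<phi>: "\<phi> \<in> borel_measurable (info M S ({1..} \<times> UNIV - {(Suc t, i)}))"
    and bound: "AE \<omega> in M. norm (\<phi> \<omega>) \<le> K"
  shows "integrable M (\<lambda>\<omega>. \<phi> \<omega> \<bullet> noise (Suc t) i \<omega>)" "expectation (\<lambda>\<omega>. \<phi> \<omega> \<bullet> noise (Suc t) i \<omega>) = 0"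
proof -
  let ?J = "{1..} \<times> UNIV - {(Suc t, i)}"
  have z: "z (Suc t) i \<in> borel_measurable (info M S ?J)"
    by (rule info_mono[of "{1..t} \<times> UNIV"])
      (use z_adapted[of t i] in \<open>auto simp: past_def intro: subalgebra_S\<close>)
  have sub: "subalgebra M (info M S ?J)" "subalgebra M (S (Suc t, i))"
    by (auto intro!: subalgebra_info subalgebra_S)
  have ind: "indep_set (sets (info M S ?J)) (sets (S (Suc t, i)))"
    by (intro indep_info_rest indep_S subalgebra_S) auto
  show "integrable M (\<lambda>\<omega>. \<phi> \<omega> \<bullet> noise (Suc t) i \<omega>)" "expectation (\<lambda>\<omega>. \<phi> \<omega> \<bullet> noise (Suc t) i \<omega>) = 0"
    unfolding noise_def
    by (rule independent_mean_zero[OF sub ind \<phi> z N_measurable N_mean bound N_bound]; simp)+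
qed

lemma noise_bound: "AE \<omega> in M. norm (noise (Suc t) i \<omega>) \<le> c i"
  using AE_good by eventually_elim (simp add: noise_def)

lemma noise_product:
  "integrable M (\<lambda>\<omega>. noise (Suc t) i \<omega> \<bullet> noise (Suc t) j \<omega>)"
  "expectation (\<lambda>\<omega>. noise (Suc t) i \<omega> \<bullet> noise (Suc t) j \<omega>) \<le> (if i = j then (c i)\<^sup>2 else 0)"
proof -
  have "integrable M (\<lambda>\<omega>. noise (Suc t) i \<omega> \<bullet> noise (Suc t) j \<omega>) \<and>
    expectation (\<lambda>\<omega>. noise (Suc t) i \<omega> \<bullet> noise (Suc t) j \<omega>) \<le> (if i = j then (c i)\<^sup>2 else 0)"
  proof (cases "i = j")
    case True
    have le: "AE \<omega> in M. norm (noise (Suc t) i \<omega> \<bullet> noise (Suc t) i \<omega>) \<le> (c i)\<^sup>2"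
      using noise_bound[of t i]
      by eventually_elim (simp add: power_mono flip: power2_norm_eq_inner)
    have int: "integrable M (\<lambda>\<omega>. noise (Suc t) i \<omega> \<bullet> noise (Suc t) i \<omega>)"
      using le noise_measurable_M by (intro integrable_const_bound[where B = "(c i)\<^sup>2"]) auto
    moreover have "expectation (\<lambda>\<omega>. noise (Suc t) i \<omega> \<bullet> noise (Suc t) i \<omega>) \<le> (c i)\<^sup>2"
      by (rule integral_le_const[OF int]) (use le in \<open>eventually_elim, simp\<close>)
    ultimately show ?thesis
      using True by simp
  next
    case False
    have "noise (Suc t) i \<in> borel_measurable (info M S ({1..} \<times> UNIV - {(Suc t, j)}))"
      using False by (intro noise_measurable) auto
    from noise_orthogonal[OF this noise_bound] False show ?thesis
      by simp
  qed
  then show "integrable M (\<lambda>\<omega>. noise (Suc t) i \<omega> \<bullet> noise (Suc t) j \<omega>)"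
    "expectation (\<lambda>\<omega>. noise (Suc t) i \<omega> \<bullet> noise (Suc t) j \<omega>) \<le> (if i = j then (c i)\<^sup>2 else 0)"
    by auto
qed

subsection \<open>Pathwise bounds\<close>

lemma centre_step:
  assumes "\<omega> \<in> space M"
  shows "centre (Suc t) \<omega> - v = (centre t \<omega> - v - (p / real (Suc t) / real CARD('n)) *\<^sub>R H (Suc t) \<omega>)
    - (p / real (Suc t) / real CARD('n)) *\<^sub>R (\<Sum>j\<in>UNIV. noise (Suc t) j \<omega>)"
  using mean_step[OF push[OF assms], of t]
  by (simp add: centre_def H_def noise_def sum.distrib scaleR_add_right algebra_simps)

context
  fixes \<omega>
  assumes good: "\<omega> \<in> space M \<and> (\<forall>t\<ge>1. \<forall>i. norm (z t i \<omega>) \<le> D)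
    \<and> (\<forall>t\<ge>1. \<forall>i u. norm (N t i u \<omega>) \<le> c i)"
begin

lemma norm_centre_le: "norm (centre t \<omega>) \<le> D"
  unfolding centre_def
  using norm_mean_le[OF push del(1) weight] good by auto

lemma norm_H_le: "norm (H (Suc t) \<omega>) \<le> L"
  unfolding H_def L_def using good by (intro order_trans[OF norm_sum] sum_mono norm_h_le) auto

lemma estimate_error: "norm (z (Suc t) i \<omega> - centre t \<omega>) \<le> error t"
proof -
  let ?e = "\<lambda>s j. (p / real s) *\<^sub>R (h j (z s j \<omega>) + N s j (z s j \<omega>) \<omega>)"
  have input: "(\<Sum>j\<in>UNIV. norm1 (?e s j)) \<le> input s" if s: "s \<in> {1..t}" for s
  proof -
    have "norm1 (?e s j) \<le> p / real s * (sqrt (real CARD('d)) * (Lip j + c j))" for j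
    proof -
      have "norm1 (?e s j) \<le> sqrt (real CARD('d)) * norm (?e s j)"
        by (rule norm1_le_sqrt_dim)
      also have "norm (?e s j) = p / real s * norm (h j (z s j \<omega>) + N s j (z s j \<omega>) \<omega>)"
        using p_pos by simp
      also have "\<dots> \<le> p / real s * (Lip j + c j)"
        using p_pos s good
        by (intro mult_left_mono order_trans[OF norm_triangle_ineq] add_mono norm_h_le) auto
      finally show ?thesis
        by (simp add: mult_left_mono ac_simps)
    qed
    then show ?thesis
      using s by (auto simp: input_def sum_distrib_left intro!: sum_mono)
  qed
  have "norm (z (Suc t) i \<omega> - centre t \<omega>) \<le> 4 / del * (lam ^ Suc t * (\<Sum>j\<in>UNIV. norm1 (x 0 j \<omega>))
    + (\<Sum>s=1..t. lam ^ (Suc t - s) * (\<Sum>j\<in>UNIV. norm1 (?e s j))))"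
    unfolding centre_def using good by (intro consensus_error[OF push del(1) weight mix lam(1)]) simp
  also have "\<dots> \<le> 4 / del * (lam ^ Suc t * input 0 + (\<Sum>s=1..t. lam ^ (Suc t - s) * input s))"
    using del lam input good
    by (intro mult_left_mono add_mono sum_mono) (auto simp: input_def initial)
  also have "lam ^ Suc t * input 0 + (\<Sum>s=1..t. lam ^ (Suc t - s) * input s) = lagged lam input t"
    using sum.atLeast_Suc_atMost[of 0 t "\<lambda>s. lam ^ (Suc t - s) * input s"]
    by (simp add: lagged_def atLeast0AtMost)
  finally show ?thesis
    by (simp add: error_def)
qed

lemma pathwise_descent:
  defines "b t \<equiv> p / real (Suc t) / real CARD('n)"
  shows "(norm (centre (Suc t) \<omega> - v))\<^sup>2 \<le> (1 - b t * m / 2) * (norm (centre t \<omega> - v))\<^sup>2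
    - b t * (gap (\<lambda>j. z (Suc t) j \<omega>) i - 5 * L * error t) + (b t)\<^sup>2 * L\<^sup>2
    - 2 * b t * (\<Sum>j\<in>UNIV. (centre t \<omega> - v - b t *\<^sub>R H (Suc t) \<omega>) \<bullet> noise (Suc t) j \<omega>)
    + (b t)\<^sup>2 * (\<Sum>j\<in>UNIV. \<Sum>k\<in>UNIV. noise (Suc t) j \<omega> \<bullet> noise (Suc t) k \<omega>)"
proof -
  have b: "0 \<le> b t"
    using p_pos by (simp add: b_def)
  let ?X = "centre t \<omega> - v" and ?G = "gap (\<lambda>j. z (Suc t) j \<omega>) i"
  have "m / 2 * (norm ?X)\<^sup>2 + ?G - 5 * L * error t \<le> 2 * (H (Suc t) \<omega> \<bullet> ?X)"
    unfolding gap_def L_def H_def using good by (intro descent norm_centre_le estimate_error) auto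
  then have "b t * (m / 2 * (norm ?X)\<^sup>2 + ?G - 5 * L * error t) \<le> b t * (2 * (H (Suc t) \<omega> \<bullet> ?X))"
    using b by (rule mult_left_mono)
  moreover have "(norm (H (Suc t) \<omega>))\<^sup>2 \<le> L\<^sup>2"
    by (intro power_mono norm_H_le) simp
  then have "(b t)\<^sup>2 * (norm (H (Suc t) \<omega>))\<^sup>2 \<le> (b t)\<^sup>2 * L\<^sup>2"
    by (rule mult_left_mono) simp
  ultimately have "(norm (?X - b t *\<^sub>R H (Suc t) \<omega>))\<^sup>2 \<le> (1 - b t * m / 2) * (norm ?X)\<^sup>2
      - b t * (?G - 5 * L * error t) + (b t)\<^sup>2 * L\<^sup>2"
    unfolding norm_diff_scaleR_squared by (simp add: inner_commute[of "H (Suc t) \<omega>"] algebra_simps)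
  then show ?thesis
    unfolding centre_step[OF conjunct1[OF good]] b_def[of t, symmetric]
      norm_diff_scaleR_squared[of _ _ "\<Sum>j\<in>UNIV. noise (Suc t) j \<omega>"] norm_sum_squared inner_sum_right
    by linarith
qed

end

subsection \<open>Expectations\<close>

definition dist2 :: "nat \<Rightarrow> real" where
  "dist2 t = expectation (\<lambda>\<omega>. (norm (centre t \<omega> - v))\<^sup>2)"

definition mean_gap :: "'n \<Rightarrow> nat \<Rightarrow> real" where
  "mean_gap i t = expectation (\<lambda>\<omega>. gap (\<lambda>j. z t j \<omega>) i)"

lemma continuous_F: "continuous_on UNIV F"
  by (rule convex_on_continuous[OF open_UNIV convex_F])

lemma centre_measurable: "centre t \<in> borel_measurable (past t)"
  unfolding centre_def mean_def
  by (intro borel_measurable_scaleR borel_measurable_sum x_adapted) auto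

lemma H_measurable: "H (Suc t) \<in> borel_measurable (past t)"
  unfolding H_def by (intro borel_measurable_sum measurable_compose[OF z_adapted h_measurable])

lemma integrable_dist2: "integrable M (\<lambda>\<omega>. (norm (centre t \<omega> - v))\<^sup>2)"
proof (rule integrable_const_bound)
  show "AE \<omega> in M. norm ((norm (centre t \<omega> - v))\<^sup>2) \<le> (D + norm v)\<^sup>2"
    using AE_good
  proof eventually_elim
    case (elim \<omega>)
    have "norm (centre t \<omega> - v) \<le> D + norm v"
      using norm_centre_le[OF elim, of t] norm_triangle_ineq4[of "centre t \<omega>" v] by simp
    then show ?case
      by (simp add: power_mono)
  qed
  show "(\<lambda>\<omega>. (norm (centre t \<omega> - v))\<^sup>2) \<in> borel_measurable M"
    using measurable_past[OF centre_measurable] by measurable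
qed

lemma integrable_gap: "integrable M (\<lambda>\<omega>. gap (\<lambda>j. z (Suc t) j \<omega>) i)"
  unfolding gap_def
proof (intro Bochner_Integration.integrable_add Bochner_Integration.integrable_sum
    Bochner_Integration.integrable_diff integrable_mult_right integrable_const)
  have zM: "z (Suc t) j \<in> borel_measurable M" for j
    by (rule measurable_past[OF z_adapted])
  have "compact (F ` cball 0 D)"
    by (intro compact_continuous_image continuous_on_subset[OF continuous_F]) auto
  then obtain K where K: "\<forall>a\<in>F ` cball 0 D. norm a \<le> K"
    using compact_imp_bounded bounded_iff by metis
  show "integrable M (\<lambda>\<omega>. F (z (Suc t) i \<omega>))"
  proof (rule integrable_const_bound)
    show "AE \<omega> in M. norm (F (z (Suc t) i \<omega>)) \<le> K"
      using AE_good by eventually_elim (use K in auto)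
    show "(\<lambda>\<omega>. F (z (Suc t) i \<omega>)) \<in> borel_measurable M"
      by (rule measurable_compose[OF zM borel_measurable_continuous_onI[OF continuous_F]])
  qed
  show "integrable M (\<lambda>\<omega>. (norm (z (Suc t) j \<omega> - v))\<^sup>2)" for j
  proof (rule integrable_const_bound)
    show "AE \<omega> in M. norm ((norm (z (Suc t) j \<omega> - v))\<^sup>2) \<le> (D + norm v)\<^sup>2"
      using AE_good
    proof eventually_elim
      case (elim \<omega>)
      then have "norm (z (Suc t) j \<omega>) \<le> D"
        by simp
      then have "norm (z (Suc t) j \<omega> - v) \<le> D + norm v"
        using norm_triangle_ineq4[of "z (Suc t) j \<omega>" v] by simp
      then show ?case
        by (simp add: power_mono)
    qed
    show "(\<lambda>\<omega>. (norm (z (Suc t) j \<omega> - v))\<^sup>2) \<in> borel_measurable M"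
      using zM by measurable
  qed
qed

text \<open>The pathwise inequality with the terms that are linear in the noise removed. Since \<open>p m / n \<ge> 4\<close>,
  the contraction factor \<open>1 - b t m / 2\<close> is at most \<open>1 - 2 / (t + 1)\<close>.\<close>

lemma one_step:
  defines "b t \<equiv> p / real (Suc t) / real CARD('n)"
  shows "dist2 (Suc t) \<le> (1 - 2 / real (Suc t)) * dist2 t - b t * (mean_gap i (Suc t) - 5 * L * error t)
    + (b t)\<^sup>2 * (L\<^sup>2 + (\<Sum>j\<in>UNIV. (c j)\<^sup>2))"
proof -
  let ?\<phi> = "\<lambda>\<omega>. centre t \<omega> - v - b t *\<^sub>R H (Suc t) \<omega>"
  let ?R = "\<lambda>\<omega>. \<Sum>j\<in>UNIV. ?\<phi> \<omega> \<bullet> noise (Suc t) j \<omega>"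
    and ?Q = "\<lambda>\<omega>. \<Sum>j\<in>UNIV. \<Sum>k\<in>UNIV. noise (Suc t) j \<omega> \<bullet> noise (Suc t) k \<omega>"
  have b: "0 \<le> b t"
    using p_pos by (simp add: b_def)
  have \<phi>: "?\<phi> \<in> borel_measurable (info M S ({1..} \<times> UNIV - {(Suc t, j)}))" for j
  proof (rule info_mono[of "{1..t} \<times> UNIV"])
    show "?\<phi> \<in> borel_measurable (info M S ({1..t} \<times> UNIV))"
      using centre_measurable[of t] H_measurable[of t] unfolding past_def
      by (intro borel_measurable_diff borel_measurable_scaleR) auto
  qed (auto intro: subalgebra_S)
  have \<phi>_bound: "AE \<omega> in M. norm (?\<phi> \<omega>) \<le> D + norm v + b t * L"
    using AE_good
  proof eventually_elim
    case (elim \<omega>)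
    have "b t * norm (H (Suc t) \<omega>) \<le> b t * L"
      by (intro mult_left_mono norm_H_le[OF elim] b)
    then show ?case
      using norm_centre_le[OF elim, of t] norm_triangle_ineq4[of "centre t \<omega>" v] b
        norm_triangle_ineq4[of "centre t \<omega> - v" "b t *\<^sub>R H (Suc t) \<omega>"] by simp
  qed
  have R: "integrable M ?R" "expectation ?R = 0"
    using noise_orthogonal[OF \<phi> \<phi>_bound] by simp_all
  have Q: "integrable M ?Q" "expectation ?Q \<le> (\<Sum>j\<in>UNIV. (c j)\<^sup>2)"
  proof -
    show "integrable M ?Q"
      by (intro Bochner_Integration.integrable_sum noise_product)
    have "expectation ?Q = (\<Sum>j\<in>UNIV. \<Sum>k\<in>UNIV. expectation (\<lambda>\<omega>. noise (Suc t) j \<omega> \<bullet> noise (Suc t) k \<omega>))"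
      by (simp add: noise_product)
    also have "\<dots> \<le> (\<Sum>j\<in>UNIV. \<Sum>k\<in>UNIV. if j = k then (c j)\<^sup>2 else 0)"
      by (intro sum_mono noise_product)
    finally show "expectation ?Q \<le> (\<Sum>j\<in>UNIV. (c j)\<^sup>2)"
      by simp
  qed
  have "dist2 (Suc t) \<le> expectation (\<lambda>\<omega>. (1 - b t * m / 2) * (norm (centre t \<omega> - v))\<^sup>2
      - b t * (gap (\<lambda>j. z (Suc t) j \<omega>) i - 5 * L * error t) + (b t)\<^sup>2 * L\<^sup>2 - 2 * b t * ?R \<omega> + (b t)\<^sup>2 * ?Q \<omega>)"
    unfolding dist2_def
  proof (rule integral_mono_AE)
    show "AE \<omega> in M. (norm (centre (Suc t) \<omega> - v))\<^sup>2 \<le> (1 - b t * m / 2) * (norm (centre t \<omega> - v))\<^sup>2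
      - b t * (gap (\<lambda>j. z (Suc t) j \<omega>) i - 5 * L * error t) + (b t)\<^sup>2 * L\<^sup>2 - 2 * b t * ?R \<omega> + (b t)\<^sup>2 * ?Q \<omega>"
      using AE_good by eventually_elim (unfold b_def, rule pathwise_descent)
  qed (intro Bochner_Integration.integrable_add Bochner_Integration.integrable_diff
      integrable_mult_right integrable_dist2 integrable_gap integrable_const R Q)+
  also have "\<dots> = (1 - b t * m / 2) * dist2 t - b t * (mean_gap i (Suc t) - 5 * L * error t)
      + (b t)\<^sup>2 * L\<^sup>2 - 2 * b t * expectation ?R + (b t)\<^sup>2 * expectation ?Q"
    unfolding dist2_def mean_gap_def using integrable_dist2[of t] integrable_gap[of t i] R(1) Q(1)
    by (simp add: prob_space del: Bochner_Integration.integral_sum)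
  also have "\<dots> \<le> (1 - 2 / real (Suc t)) * dist2 t - b t * (mean_gap i (Suc t) - 5 * L * error t)
      + (b t)\<^sup>2 * (L\<^sup>2 + (\<Sum>j\<in>UNIV. (c j)\<^sup>2))"
  proof -
    have "2 / real (Suc t) \<le> b t * m / 2"
    proof -
      have "4 / (2 * real (Suc t)) \<le> p * (m / real CARD('n)) / (2 * real (Suc t))"
        using p_large by (intro divide_right_mono) (auto simp: m_def)
      then show ?thesis
        by (simp add: b_def ac_simps del: of_nat_Suc)
    qed
    then have "(1 - b t * m / 2) * dist2 t \<le> (1 - 2 / real (Suc t)) * dist2 t"
      by (intro mult_right_mono) (auto simp: dist2_def)
    moreover have "(b t)\<^sup>2 * expectation ?Q \<le> (b t)\<^sup>2 * (\<Sum>j\<in>UNIV. (c j)\<^sup>2)"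
      by (intro mult_left_mono Q) simp
    ultimately show ?thesis
      using R(2) by (simp add: distrib_left)
  qed
  finally show ?thesis .
qed

end

section \<open>Summation over time\<close>

lemma lagged_Suc: "lagged lam g (Suc t) = lam * (lagged lam g t + g (Suc t))"
  by (simp add: lagged_def sum_distrib_left distrib_left Suc_diff_le ac_simps)

text \<open>The influence still stored at the end completes the sum to an identity, proved by the recursion for
  \<open>lagged\<close>.\<close>

lemma sum_lagged_le:
  assumes "0 \<le> lam" "lam < 1" "\<And>s. 0 \<le> g s"
  shows "(\<Sum>t\<le>T. lagged lam g t) \<le> lam / (1 - lam) * (\<Sum>s\<le>T. g s)"
proof -
  have "(\<Sum>t\<le>T. lagged lam g t) + lam / (1 - lam) * lagged lam g T = lam / (1 - lam) * (\<Sum>s\<le>T. g s)"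
  proof (induction T)
    case 0
    then show ?case
      using assms by (simp add: lagged_def field_simps)
  next
    case (Suc T)
    have "lagged lam g (Suc T) + lam / (1 - lam) * lagged lam g (Suc T)
        = lagged lam g (Suc T) / (1 - lam)"
      using assms by (simp add: field_simps)
    also have "\<dots> = lam / (1 - lam) * lagged lam g T + lam / (1 - lam) * g (Suc T)"
      by (simp add: lagged_Suc distrib_left add_divide_distrib)
    finally show ?case
      using Suc.IH by (simp add: distrib_left)
  qed
  moreover have "0 \<le> lam / (1 - lam) * lagged lam g T"
    using assms unfolding lagged_def by (intro mult_nonneg_nonneg sum_nonneg divide_nonneg_nonneg) auto
  ultimately show ?thesis by linarith
qed

lemma lagged_nonneg: "0 \<le> lam \<Longrightarrow> (\<And>s. 0 \<le> g s) \<Longrightarrow> 0 \<le> lagged lam g t"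
  unfolding lagged_def by (intro sum_nonneg mult_nonneg_nonneg) auto

lemma harmonic_sum_le: "(\<Sum>s=1..Suc t. 1 / real s) \<le> 1 + ln (real (Suc t))"
proof (induction t)
  case (Suc t)
  let ?r = "real (Suc t) / real (Suc (Suc t))"
  have "ln ?r \<le> ?r - 1"
    by (rule ln_le_minus_one) simp
  moreover have "ln ?r = ln (real (Suc t)) - ln (real (Suc (Suc t)))"
    by (simp add: ln_div)
  moreover have "?r - 1 = - (1 / real (Suc (Suc t)))"
    by (simp add: field_simps)
  ultimately show ?case
    using Suc.IH by simp
qed simp

text \<open>With the stepsize \<open>p / t\<close> the contraction factor is \<open>1 - 2/(t+1)\<close>, which the weights
  \<open>t (t + 1)\<close> turn into a telescoping sum.\<close>

lemma weighted_telescoping: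
  fixes a s e :: "nat \<Rightarrow> real"
  assumes step: "\<And>t. a (Suc t) \<le> (1 - 2 / real (Suc t)) * a t - p / real (Suc t) / n * (s (Suc t) - e t)
      + (p / real (Suc t) / n)\<^sup>2 * Q"
    and nonneg: "\<And>t. 0 \<le> a t" "0 \<le> Q" "0 < p" "0 < n"
  shows "(\<Sum>t<Suc T. real t * s (Suc t)) \<le> (\<Sum>t<Suc T. real t * e t) + p / n * Q * real T"
proof -
  have "real (Suc T) * real T * (n / p) * a (Suc T) + (\<Sum>t<Suc T. real t * s (Suc t))
      \<le> (\<Sum>t<Suc T. real t * e t) + p / n * Q * real T"
  proof (induction T)
    case 0
    then show ?case by simp
  next
    case (Suc T)
    let ?k = "real (Suc (Suc T)) * real (Suc T) * (n / p)"
    let ?u = "real (Suc (Suc T))"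
    have "?k * a (Suc (Suc T)) \<le> ?k * ((1 - 2 / ?u) * a (Suc T) - p / ?u / n * (s (Suc (Suc T)) - e (Suc T))
      + (p / ?u / n)\<^sup>2 * Q)"
      using nonneg by (intro mult_left_mono step) auto
    also have "\<dots> = real (Suc T) * (?u * (1 - 2 / ?u)) * (n / p) * a (Suc T)
        - real (Suc T) * (s (Suc (Suc T)) - e (Suc T)) + real (Suc T) / ?u * (p / n * Q)"
      using nonneg by (simp add: power2_eq_square right_diff_distrib distrib_left del: of_nat_Suc)
    also have "?u * (1 - 2 / ?u) = real T"
      by (simp add: right_diff_distrib del: of_nat_Suc)
    also have "real (Suc T) / ?u * (p / n * Q) \<le> p / n * Q"
      using nonneg by (intro mult_left_le_one_le) auto
    finally show ?case
      using Suc.IH by (simp add: algebra_simps del: of_nat_Suc) (simp add: algebra_simps add_divide_distrib)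
  qed
  moreover have "0 \<le> real (Suc T) * real T * (n / p) * a (Suc T)"
    using nonneg by simp
  ultimately show ?thesis by linarith
qed

lemma sum_pred: "(\<Sum>s=1..k. real s - 1) = real k * (real k - 1) / 2"
  by (induction k) (simp_all add: field_simps)

lemma convex_weighted_average_le:
  fixes u :: "nat \<Rightarrow> 'v::real_vector"
  assumes \<phi>: "convex_on UNIV \<phi>" and \<tau>: "2 \<le> \<tau>"
  shows "\<phi> (weighted_average u \<tau>) \<le> (\<Sum>t<\<tau>. real t * \<phi> (u (Suc t))) / (real \<tau> * (real \<tau> - 1) / 2)"
proof -
  let ?W = "real \<tau> * (real \<tau> - 1) / 2"
  have W: "0 < ?W"
    using \<tau> by simp
  have "weighted_average u \<tau> = (\<Sum>s=1..\<tau>. ((real s - 1) / ?W) *\<^sub>R u s)"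
    unfolding weighted_average_def scaleR_sum_right scaleR_scaleR
    by (simp only: divide_inverse mult.commute)
  also have "\<phi> \<dots> \<le> (\<Sum>s=1..\<tau>. (real s - 1) / ?W * \<phi> (u s))"
  proof (rule convex_on_sum[OF _ _ \<phi>])
    show "(\<Sum>s=1..\<tau>. (real s - 1) / ?W) = 1"
      unfolding sum_divide_distrib[symmetric] sum_pred using less_imp_neq[OF W] by (intro divide_self) simp
  qed (use \<tau> W in auto)
  also have "\<dots> = (\<Sum>s=1..\<tau>. (real s - 1) * \<phi> (u s)) / ?W"
    by (simp only: sum_divide_distrib times_divide_eq_left)
  also have "(\<Sum>s=1..\<tau>. (real s - 1) * \<phi> (u s)) = (\<Sum>t<\<tau>. real t * \<phi> (u (Suc t)))"
    using sum.atLeast1_atMost_eq[of "\<lambda>s. (real s - 1) * \<phi> (u s)" \<tau>] by simp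
  finally show ?thesis .
qed

lemma convex_dist_squared:
  fixes v :: "'v::real_inner"
  shows "convex_on UNIV (\<lambda>a. (norm (a - v))\<^sup>2)"
proof (rule convex_onI)
  fix t :: real and a b :: 'v
  assume t: "0 < t" "t < 1"
  have "(1 - t) *\<^sub>R a + t *\<^sub>R b - v = (1 - t) *\<^sub>R (a - v) + t *\<^sub>R (b - v)"
    by (simp add: algebra_simps)
  also have "norm \<dots> \<le> (1 - t) * norm (a - v) + t * norm (b - v)"
    using t by (intro order_trans[OF norm_triangle_ineq]) simp
  finally have "(norm ((1 - t) *\<^sub>R a + t *\<^sub>R b - v))\<^sup>2 \<le> ((1 - t) * norm (a - v) + t * norm (b - v))\<^sup>2"
    by (intro power_mono) auto
  also have "\<dots> \<le> (1 - t) * (norm (a - v))\<^sup>2 + t * (norm (b - v))\<^sup>2"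
    using convex_onD[OF convex_power2, of t "norm (a - v)" "norm (b - v)"] t by simp
  finally show "(norm ((1 - t) *\<^sub>R a + t *\<^sub>R b - v))\<^sup>2 \<le> (1 - t) * (norm (a - v))\<^sup>2 + t * (norm (b - v))\<^sup>2" .
qed simp

context stochastic_gradient_push
begin

lemma gap_nonneg: "0 \<le> gap u i"
  unfolding gap_def using F_ge \<mu>_pos by (intro add_nonneg_nonneg sum_nonneg) (auto simp: less_imp_le)

lemma gap_weighted_average_le:
  assumes \<tau>: "2 \<le> \<tau>"
  shows "gap (\<lambda>j. weighted_average (\<lambda>s. u s j) \<tau>) i
    \<le> (\<Sum>t<\<tau>. real t * gap (\<lambda>j. u (Suc t) j) i) / (real \<tau> * (real \<tau> - 1) / 2)"
proof -
  let ?W = "real \<tau> * (real \<tau> - 1) / 2"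
  have W: "0 < ?W"
    using \<tau> by simp
  have sumW: "(\<Sum>t<\<tau>. real t) = ?W"
    using sum.atLeast1_atMost_eq[of "\<lambda>s. real s - 1" \<tau>] sum_pred[of \<tau>] by simp
  have "gap (\<lambda>j. weighted_average (\<lambda>s. u s j) \<tau>) i
      \<le> (\<Sum>t<\<tau>. real t * F (u (Suc t) i)) / ?W - F v
        + (\<Sum>j\<in>UNIV. \<mu> j * ((\<Sum>t<\<tau>. real t * (norm (u (Suc t) j - v))\<^sup>2) / ?W))"
    unfolding gap_def
    by (intro add_mono diff_right_mono sum_mono mult_left_mono convex_weighted_average_le[OF _ \<tau>]
        convex_F convex_dist_squared less_imp_le[OF \<mu>_pos])
  also have "\<dots> = ((\<Sum>t<\<tau>. real t * F (u (Suc t) i)) - ?W * F v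
        + (\<Sum>j\<in>UNIV. \<Sum>t<\<tau>. real t * (\<mu> j * (norm (u (Suc t) j - v))\<^sup>2))) / ?W"
    using W \<tau> by (simp add: add_divide_distrib diff_divide_distrib sum_divide_distrib sum_distrib_left ac_simps)
  also have "\<dots> = (\<Sum>t<\<tau>. real t * gap (\<lambda>j. u (Suc t) j) i) / ?W"
    unfolding sumW[symmetric] sum.swap[of _ "{..<\<tau>}" UNIV]
    by (simp add: gap_def distrib_left right_diff_distrib sum.distrib sum_subtractf sum_distrib_left
        sum_distrib_right)
  finally show ?thesis .
qed

lemma mean_gap_sum_le:
  "(\<Sum>t<Suc T. real t * mean_gap i (Suc t)) \<le> (\<Sum>t<Suc T. real t * (5 * L * error t))
    + p / real CARD('n) * (L\<^sup>2 + (\<Sum>j\<in>UNIV. (c j)\<^sup>2)) * real T"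
proof (rule weighted_telescoping[where a = dist2])
  show "dist2 (Suc t) \<le> (1 - 2 / real (Suc t)) * dist2 t
      - p / real (Suc t) / real CARD('n) * (mean_gap i (Suc t) - 5 * L * error t)
      + (p / real (Suc t) / real CARD('n))\<^sup>2 * (L\<^sup>2 + (\<Sum>j\<in>UNIV. (c j)\<^sup>2))" for t
    by (rule one_step)
qed (auto simp: p_pos dist2_def intro!: add_nonneg_nonneg sum_nonneg)

lemma input_nonneg: "0 \<le> input s"
  using p_pos Lip_nonneg c_pos
  by (auto simp: input_def norm1_nonneg less_imp_le intro!: sum_nonneg mult_nonneg_nonneg divide_nonneg_nonneg add_nonneg_nonneg)

lemma error_sum_le:
  "(\<Sum>t\<le>T. error t) \<le> 4 / del * (lam / (1 - lam) * (\<Sum>s\<le>T. input s))"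
  unfolding error_def sum_distrib_left[symmetric]
  using del by (intro mult_left_mono sum_lagged_le lam input_nonneg) auto

lemma input_sum_le:
  "(\<Sum>s\<le>Suc T. input s) \<le> (\<Sum>j\<in>UNIV. norm1 (x0 j))
    + p * (\<Sum>j\<in>UNIV. sqrt (real CARD('d)) * (Lip j + c j)) * (1 + ln (real (Suc T)))"
    (is "_ \<le> ?X + p * ?B * _")
proof -
  have B: "0 \<le> ?B"
    using Lip_nonneg c_pos by (intro sum_nonneg mult_nonneg_nonneg add_nonneg_nonneg) (auto simp: less_imp_le)
  have "(\<Sum>s\<le>Suc T. input s) = input 0 + (\<Sum>s=1..Suc T. input s)"
    using sum.atLeast_Suc_atMost[of 0 "Suc T" input] by (simp add: atLeast0AtMost)
  also have "(\<Sum>s=1..Suc T. input s) = p * ?B * (\<Sum>s=1..Suc T. 1 / real s)"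
    unfolding sum_distrib_left[of "p * ?B"] by (intro sum.cong refl) (simp add: input_def)
  also have "\<dots> \<le> p * ?B * (1 + ln (real (Suc T)))"
    using p_pos B by (intro mult_left_mono harmonic_sum_le) auto
  finally show ?thesis
    by (simp add: input_def)
qed

text \<open>The squared step enters as \<open>(L\<^sup>2 + \<Sum> c\<^sub>j\<^sup>2) / n\<close>: independence between the nodes removes the mixed terms,
  and \<open>n \<ge> 2\<close> compensates the factor \<open>2\<close> from the normalisation of the weights. The term \<open>L\<^sup>2\<close> is
  absorbed by the slack in the logarithmic term.\<close>

lemma expected_gap_le:
  assumes n: "2 \<le> CARD('n)" and \<tau>: "2 \<le> \<tau>"
  defines "Bmax \<equiv> Max (range (\<lambda>j. sqrt (real CARD('d)) * (Lip j + c j)))"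
  shows "expectation (\<lambda>\<omega>. gap (\<lambda>j. weighted_average (\<lambda>s. z s j \<omega>) \<tau>) i)
    \<le> 80 * L / (real \<tau> * del) * (lam / (1 - lam)) * (\<Sum>j\<in>UNIV. norm1 (x0 j))
      + 80 * p * L * real CARD('n) * Bmax / (real \<tau> * del * (1 - lam)) * (1 + ln (real \<tau> - 1))
      + p / real \<tau> * (\<Sum>j\<in>UNIV. (Lip j + c j)\<^sup>2)"
proof -
  let ?n = "real CARD('n)" and ?X = "\<Sum>j\<in>UNIV. norm1 (x0 j)" and ?C = "\<Sum>j\<in>UNIV. (c j)\<^sup>2"
  let ?W = "real \<tau> * (real \<tau> - 1) / 2"
  let ?B = "\<Sum>j\<in>UNIV. sqrt (real CARD('d)) * (Lip j + c j)"
  obtain T where T: "\<tau> = Suc (Suc T)"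
    using \<tau> by (metis Suc_le_D numeral_2_eq_2 Suc_le_mono)
  have W: "?W = real \<tau> * real (Suc T) / 2" "0 < ?W"
    by (auto simp: T)
  define l where "l = 1 + ln (real \<tau> - 1)"
  have l: "1 \<le> l" "l = 1 + ln (real (Suc T))"
    by (auto simp: l_def T)
  have B: "?B \<le> ?n * Bmax" "L \<le> ?B"
  proof -
    have "sqrt (real CARD('d)) * (Lip j + c j) \<le> Bmax" for j
      unfolding Bmax_def by (intro Max_ge) auto
    then have "?B \<le> (\<Sum>j\<in>(UNIV :: 'n set). Bmax)"
      by (intro sum_mono)
    then show "?B \<le> ?n * Bmax" by simp
    have "1 * (Lip j + 0) \<le> sqrt (real CARD('d)) * (Lip j + c j)" for j
      using Lip_nonneg[of j] c_pos[of j] by (intro mult_mono) (auto simp: Suc_le_eq)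
    then show "L \<le> ?B"
      unfolding L_def by (intro sum_mono) simp
  qed
  have AE_gap: "AE \<omega> in M. gap (\<lambda>j. weighted_average (\<lambda>s. z s j \<omega>) \<tau>) i
      \<le> (\<Sum>t<\<tau>. real t * gap (\<lambda>j. z (Suc t) j \<omega>) i) / ?W"
    by (intro AE_I2 gap_weighted_average_le \<tau>)
  have "expectation (\<lambda>\<omega>. gap (\<lambda>j. weighted_average (\<lambda>s. z s j \<omega>) \<tau>) i)
      \<le> expectation (\<lambda>\<omega>. (\<Sum>t<\<tau>. real t * gap (\<lambda>j. z (Suc t) j \<omega>) i) / ?W)"
  proof (rule integral_mono_AE'[OF _ AE_gap])
    show "integrable M (\<lambda>\<omega>. (\<Sum>t<\<tau>. real t * gap (\<lambda>j. z (Suc t) j \<omega>) i) / ?W)"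
      by (intro integrable_divide Bochner_Integration.integrable_sum integrable_mult_right integrable_gap)
    show "AE \<omega> in M. 0 \<le> (\<Sum>t<\<tau>. real t * gap (\<lambda>j. z (Suc t) j \<omega>) i) / ?W"
      using \<tau>
      by (intro AE_I2 divide_nonneg_nonneg sum_nonneg mult_nonneg_nonneg gap_nonneg) auto
  qed
  also have "\<dots> = (\<Sum>t<\<tau>. real t * mean_gap i (Suc t)) / ?W"
    by (simp add: mean_gap_def integrable_gap)
  also have "\<dots> \<le> ((\<Sum>t<\<tau>. real t * (5 * L * error t)) + p / ?n * (L\<^sup>2 + ?C) * real (Suc T)) / ?W"
    unfolding T using mean_gap_sum_le[where T = "Suc T" and i = i] by (intro divide_right_mono) auto
  also have "\<dots> \<le> (real (Suc T) * (5 * L) * (\<Sum>t\<le>Suc T. error t) + p / ?n * (L\<^sup>2 + ?C) * real (Suc T)) / ?W"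
  proof (rule divide_right_mono[OF add_right_mono less_imp_le[OF W(2)]])
    have "real t * (5 * L * error t) \<le> real (Suc T) * (5 * L * error t)" if "t \<le> Suc T" for t
      using that L_nonneg del lagged_nonneg[OF lam(1) input_nonneg, where t = t]
      by (intro mult_right_mono mult_nonneg_nonneg) (auto simp: error_def)
    then have "(\<Sum>t\<le>Suc T. real t * (5 * L * error t)) \<le> (\<Sum>t\<le>Suc T. real (Suc T) * (5 * L * error t))"
      by (intro sum_mono) simp
    then show "(\<Sum>t<\<tau>. real t * (5 * L * error t)) \<le> real (Suc T) * (5 * L) * (\<Sum>t\<le>Suc T. error t)"
      by (simp add: T lessThan_Suc_atMost sum_distrib_left mult.assoc del: sum.atMost_Suc of_nat_Suc)
  qed
  also have "(real (Suc T) * (5 * L) * (\<Sum>t\<le>Suc T. error t) + p / ?n * (L\<^sup>2 + ?C) * real (Suc T)) / ?W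
      = 10 * L / real \<tau> * (\<Sum>t\<le>Suc T. error t) + 2 / real \<tau> * (p / ?n * (L\<^sup>2 + ?C))"
  proof -
    have rescale: "(k * (5 * L) * e + q * k) / (t * k / 2) = 10 * L / t * e + 2 / t * q" if "k \<noteq> 0" "t \<noteq> 0"
      for k t e q :: real
      using that by (simp add: field_simps)
    show ?thesis
      unfolding W(1) by (rule rescale) (use \<tau> in auto)
  qed
  also have "\<dots> \<le> 10 * L / real \<tau> * (4 / del * (lam / (1 - lam) * (?X + p * ?B * l))) + p / real \<tau> * (L * ?B + ?C)"
  proof (intro add_mono mult_left_mono)
    have "(\<Sum>t\<le>Suc T. error t) \<le> 4 / del * (lam / (1 - lam) * (\<Sum>s\<le>Suc T. input s))"
      by (rule error_sum_le)
    also have "\<dots> \<le> 4 / del * (lam / (1 - lam) * (?X + p * ?B * l))"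
      unfolding l(2) using lam del by (intro mult_left_mono input_sum_le) auto
    finally show "(\<Sum>t\<le>Suc T. error t) \<le> 4 / del * (lam / (1 - lam) * (?X + p * ?B * l))" .
    show "0 \<le> 10 * L / real \<tau>"
      using L_nonneg by simp
    have "2 / real \<tau> * (p / ?n * (L\<^sup>2 + ?C)) = p / real \<tau> * (2 / ?n * (L\<^sup>2 + ?C))"
      by simp
    also have "\<dots> \<le> p / real \<tau> * (1 * (L * ?B + ?C))"
    proof (intro mult_left_mono mult_mono add_right_mono)
      show "L\<^sup>2 \<le> L * ?B"
        unfolding power2_eq_square by (intro mult_left_mono B L_nonneg)
    qed (use n p_pos in \<open>auto intro!: add_nonneg_nonneg sum_nonneg\<close>)
    finally show "2 / real \<tau> * (p / ?n * (L\<^sup>2 + ?C)) \<le> p / real \<tau> * (L * ?B + ?C)"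
      by simp
  qed
  \<comment> \<open>The sums yield the constant \<open>40\<close>; what remains of the logarithmic term absorbs \<open>p L\<^sup>2 / \<tau>\<close>.\<close>
  also have "\<dots> \<le> 80 * L / (real \<tau> * del) * (lam / (1 - lam)) * ?X
      + 80 * p * L * ?n * Bmax / (real \<tau> * del * (1 - lam)) * l + p / real \<tau> * (\<Sum>j\<in>UNIV. (Lip j + c j)\<^sup>2)"
  proof -
    let ?q = "1 / (real \<tau> * del * (1 - lam))"
    have q: "0 < ?q"
      using lam del by (simp add: T)
    have "1 / real \<tau> \<le> ?q"
    proof -
      have "real \<tau> * del * (1 - lam) \<le> real \<tau> * 1 * 1"
        using lam del by (intro mult_mono) auto
      then show ?thesis
        using lam del by (intro divide_left_mono) (auto simp: T)
    qed
    have B0: "0 \<le> ?B"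
      using B(2) L_nonneg by linarith
    then have "0 \<le> ?n * Bmax"
      using B(1) by linarith
    then have Bmax0: "0 \<le> Bmax"
      by (simp add: zero_le_mult_iff)
    have 1: "10 * L / real \<tau> * (4 / del * (lam / (1 - lam) * (?X + p * ?B * l)))
        = 40 * (L / (real \<tau> * del) * (lam / (1 - lam)) * ?X) + 40 * lam * (?q * p * (L * ?B) * l)"
    proof -
      have "10 * L / t * (4 / del * (lam / k * (a + p * b * l)))
          = 40 * (L / (t * del) * (lam / k) * a) + 40 * lam * (1 / (t * del * k) * p * (L * b) * l)" for t k a b :: real
        by (simp add: distrib_left add_divide_distrib ac_simps)
      then show ?thesis .
    qed
    have 2: "40 * (L / (real \<tau> * del) * (lam / (1 - lam)) * ?X) \<le> 80 * (L / (real \<tau> * del) * (lam / (1 - lam)) * ?X)"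
      using L_nonneg lam del by (intro mult_right_mono mult_nonneg_nonneg sum_nonneg norm1_nonneg) auto
    have 3: "40 * lam * (?q * p * (L * ?B) * l) \<le> 40 * (?q * p * (L * (?n * Bmax)) * l)"
    proof -
      have "0 \<le> ?q * p * (L * ?B) * l"
        using q p_pos B0 L_nonneg l by (intro mult_nonneg_nonneg) auto
      then have "lam * (?q * p * (L * ?B) * l) \<le> ?q * p * (L * ?B) * l"
        using lam by (intro mult_left_le_one_le) auto
      also have "\<dots> \<le> ?q * p * (L * (?n * Bmax)) * l"
        by (intro mult_right_mono mult_left_mono B L_nonneg) (use q p_pos l in auto)
      finally show ?thesis by simp
    qed
    have 4: "p / real \<tau> * (L * ?B) \<le> ?q * p * (L * (?n * Bmax)) * l"
    proof -
      have "1 / real \<tau> * (p * (L * ?B)) \<le> ?q * (p * (L * (?n * Bmax)) * l)"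
      proof (rule mult_mono)
        have "p * (L * ?B) * 1 \<le> p * (L * (?n * Bmax)) * l"
        proof (rule mult_mono)
          show "p * (L * ?B) \<le> p * (L * (?n * Bmax))"
            by (intro mult_left_mono B L_nonneg less_imp_le[OF p_pos])
        qed (use l p_pos L_nonneg Bmax0 in auto)
        then show "p * (L * ?B) \<le> p * (L * (?n * Bmax)) * l"
          by simp
      qed (use \<open>1 / real \<tau> \<le> ?q\<close> q p_pos L_nonneg B0 in auto)
      then show ?thesis
        by (simp add: ac_simps)
    qed
    have 5: "p / real \<tau> * ?C \<le> p / real \<tau> * (\<Sum>j\<in>UNIV. (Lip j + c j)\<^sup>2)"
      using p_pos Lip_nonneg c_pos by (intro mult_left_mono sum_mono power_mono) (auto simp: less_imp_le)
    have 6: "0 \<le> ?q * p * (L * (?n * Bmax)) * l"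
      using q p_pos L_nonneg Bmax0 l by (intro mult_nonneg_nonneg) auto
    have 7: "80 * p * L * ?n * Bmax / (real \<tau> * del * (1 - lam)) * l = 80 * (?q * p * (L * (?n * Bmax)) * l)"
      by simp
    have 8: "80 * L / (real \<tau> * del) * (lam / (1 - lam)) * ?X = 80 * (L / (real \<tau> * del) * (lam / (1 - lam)) * ?X)"
      by simp
    have combine: "r1 + r2 + (r3 + r4) \<le> s1 + 80 * s2 + s4"
      if "r1 \<le> s1" "r2 \<le> 40 * s2" "r3 \<le> s2" "r4 \<le> s4" "0 \<le> s2" for r1 r2 r3 r4 s1 s2 s4 :: real
      using that by linarith
    show ?thesis
      unfolding 1 7 8 distrib_left[of "p / real \<tau>"] by (rule combine[OF 2 3 4 5 6])
  qed
  finally show ?thesis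
    unfolding l_def .
qed

end

theorem theorem1:
  fixes E :: "nat \<Rightarrow> 'n::finite rel" and B n :: nat
  assumes "n = CARD('n)" and "n \<ge> 2"
    and "B_strongly_connected B E"
  shows "\<exists>lam del :: real.
    (0 < lam \<or>
      lam = 0 \<and> (\<forall>t. regular_digraph (E t)) \<and> Max (range (\<lambda>t. sigma2 (push_matrix (E t)))) = 0) \<and>
    lam < 1 \<and> 0 < del \<and>
    del \<ge> 1 / real n ^ (n * B) \<and>
    lam \<le> (1 - 1 / real n ^ (n * B)) powr (1 / real (n * B)) \<and>
    ((\<forall>t. regular_digraph (E t)) \<longrightarrow>
      del = 1 \<and>
      lam \<le> min ((1 - 1 / (4 * real n ^ 3)) powr (1 / real B))
                 (Max (range (\<lambda>t. sigma2 (push_matrix (E t)))))) \<and>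
    (\<forall>(M :: 'a measure) (f :: 'n \<Rightarrow> real^'d \<Rightarrow> real) (\<mu> :: 'n \<Rightarrow> real) (zstar :: real^'d)
      (h :: 'n \<Rightarrow> real^'d \<Rightarrow> real^'d) (N :: nat \<Rightarrow> 'n \<Rightarrow> real^'d \<Rightarrow> 'a \<Rightarrow> real^'d) (c :: 'n \<Rightarrow> real)
      (p :: real) (x0 :: 'n \<Rightarrow> real^'d)
      (x :: nat \<Rightarrow> 'n \<Rightarrow> 'a \<Rightarrow> real^'d) (w :: nat \<Rightarrow> 'n \<Rightarrow> 'a \<Rightarrow> real^'d)
      (y :: nat \<Rightarrow> 'n \<Rightarrow> real) (z :: nat \<Rightarrow> 'n \<Rightarrow> 'a \<Rightarrow> real^'d) (D :: real).
      prob_space M \<longrightarrow>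
      (\<forall>i. strongly_convex (\<mu> i) (f i)) \<longrightarrow>
      is_arg_min (\<lambda>v. \<Sum>j\<in>UNIV. f j v) (\<lambda>_. True) zstar \<longrightarrow>
      (\<forall>i. h i \<in> borel_measurable borel \<and> (\<forall>u. is_subgradient (f i) u (h i u))) \<longrightarrow>
      independent_noise M N \<longrightarrow>
      (\<forall>i. 0 < c i) \<longrightarrow>
      (\<forall>t\<ge>1. \<forall>i. AE \<omega> in M. \<forall>u. norm (N t i u \<omega>) \<le> c i) \<longrightarrow>
      p * ((\<Sum>i\<in>UNIV. \<mu> i) / real n) \<ge> 4 \<longrightarrow>
      (\<forall>\<omega>\<in>space M. \<forall>i. x 0 i \<omega> = x0 i) \<longrightarrow>
      (\<forall>\<omega>\<in>space M. gradient_push E (\<lambda>t. p / real t) (\<lambda>t i u. h i u + N t i u \<omega>)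
         (\<lambda>t i. x t i \<omega>) (\<lambda>t i. w t i \<omega>) y (\<lambda>t i. z t i \<omega>)) \<longrightarrow>
      (AE \<omega> in M. \<forall>i. \<forall>t\<ge>1. norm (z t i \<omega>) \<le> D) \<longrightarrow>
      (\<forall>i. \<forall>\<tau>::nat\<ge>2.
        (let F = (\<lambda>v. \<Sum>j\<in>UNIV. f j v);
             zhat = (\<lambda>j \<omega>. weighted_average (\<lambda>s. z s j \<omega>) \<tau>);
             Li = (\<lambda>j. subgradient_bound (f j) D);
             L = (\<Sum>j\<in>UNIV. Li j);
             Bi = (\<lambda>j. sqrt (real CARD('d)) * (Li j + c j))
         in (\<integral>\<omega>. F (zhat i \<omega>) - F zstar
                   + (\<Sum>j\<in>UNIV. \<mu> j * (norm (zhat j \<omega> - zstar))\<^sup>2) \<partial>M)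
            \<le> 80 * L / (real \<tau> * del) * (lam / (1 - lam)) * (\<Sum>j\<in>UNIV. norm1 (x0 j))
              + 80 * p * L * real n * Max (range Bi) / (real \<tau> * del * (1 - lam))
                  * (1 + ln (real \<tau> - 1))
              + p / real \<tau> * (\<Sum>j\<in>UNIV. (Li j + c j)\<^sup>2))))"
proof -
  obtain lam del :: real where rate:
    "0 < lam \<or>
      lam = 0 \<and> (\<forall>t. regular_digraph (E t)) \<and> Max (range (\<lambda>t. sigma2 (push_matrix (E t)))) = 0"
    "lam < 1" "0 < del" "del \<le> 1" "del \<ge> 1 / real n ^ (n * B)"
    "lam \<le> (1 - 1 / real n ^ (n * B)) powr (1 / real (n * B))"
    "(\<forall>t. regular_digraph (E t)) \<longrightarrow> del = 1 \<and>
      lam \<le> min ((1 - 1 / (4 * real n ^ 3)) powr (1 / real B))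
                (Max (range (\<lambda>t. sigma2 (push_matrix (E t)))))"
    and mix: "mixes E lam" and weight: "\<And>t i. del \<le> (push_prod E 0 t *v 1) $ i"
    using mixing_rate_exists[OF assms] by blast
  show ?thesis
  proof (rule exI[of _ lam], rule exI[of _ del], rule conjI[OF rate(1)], rule conjI[OF rate(2)],
      rule conjI[OF rate(3)], rule conjI[OF rate(5)], rule conjI[OF rate(6)], rule conjI[OF rate(7)],
      intro allI impI)
    fix M :: "'a measure" and f :: "'n \<Rightarrow> real^'d \<Rightarrow> real" and \<mu> :: "'n \<Rightarrow> real" and zstar :: "real^'d"
      and h :: "'n \<Rightarrow> real^'d \<Rightarrow> real^'d" and N :: "nat \<Rightarrow> 'n \<Rightarrow> real^'d \<Rightarrow> 'a \<Rightarrow> real^'d" and c :: "'n \<Rightarrow> real"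
      and p :: real and x0 :: "'n \<Rightarrow> real^'d"
      and x w :: "nat \<Rightarrow> 'n \<Rightarrow> 'a \<Rightarrow> real^'d" and y :: "nat \<Rightarrow> 'n \<Rightarrow> real"
      and z :: "nat \<Rightarrow> 'n \<Rightarrow> 'a \<Rightarrow> real^'d" and D :: real and i :: 'n and \<tau> :: nat
    assume M: "prob_space M" and sc: "\<forall>i. strongly_convex (\<mu> i) (f i)"
      and min: "is_arg_min (\<lambda>v. \<Sum>j\<in>UNIV. f j v) (\<lambda>_. True) zstar"
      and h: "\<forall>i. h i \<in> borel_measurable borel \<and> (\<forall>u. is_subgradient (f i) u (h i u))"
      and noise: "independent_noise M N" and c: "\<forall>i. 0 < c i"
      and N: "\<forall>t\<ge>1. \<forall>i. AE \<omega> in M. \<forall>u. norm (N t i u \<omega>) \<le> c i"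
      and p: "p * ((\<Sum>i\<in>UNIV. \<mu> i) / real n) \<ge> 4"
      and x0: "\<forall>\<omega>\<in>space M. \<forall>i. x 0 i \<omega> = x0 i"
      and push: "\<forall>\<omega>\<in>space M. gradient_push E (\<lambda>t. p / real t) (\<lambda>t i u. h i u + N t i u \<omega>)
         (\<lambda>t i. x t i \<omega>) (\<lambda>t i. w t i \<omega>) y (\<lambda>t i. z t i \<omega>)"
      and D: "AE \<omega> in M. \<forall>i. \<forall>t\<ge>1. norm (z t i \<omega>) \<le> D" and \<tau>: "2 \<le> \<tau>"
    obtain S where S: "\<And>t i. 1 \<le> t \<Longrightarrow> subalgebra M (S t i)"
      "\<And>t i. 1 \<le> t \<Longrightarrow> (\<lambda>(u, \<omega>). N t i u \<omega>) \<in> borel_measurable (borel \<Otimes>\<^sub>M S t i)"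
      "prob_space.indep_sets M (\<lambda>(t, i). sets (S t i)) ({1..} \<times> UNIV)"
      and mean: "\<And>t i u. 1 \<le> t \<Longrightarrow> (\<integral>\<omega>. N t i u \<omega> \<partial>M) = 0"
      using noise unfolding independent_noise_def by blast
    have sets_S: "(\<lambda>(t, i). sets (S t i)) = (\<lambda>k. sets (case_prod S k))"
      by auto
    interpret prob_space M by (rule M)
    interpret stochastic_gradient_push M f \<mu> h zstar D E lam del N "case_prod S" c p x0 x w z y
    proof unfold_locales
      show "0 \<le> lam"
        using rate(1) by auto
      show "(\<Sum>j\<in>UNIV. f j zstar) \<le> (\<Sum>j\<in>UNIV. f j u)" for u
        using min by (auto simp: is_arg_min_linorder)
      show "indep_sets (\<lambda>k. sets (case_prod S k)) ({1..} \<times> UNIV)"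
        using S(3) unfolding sets_S .
    qed (use sc h S c N p x0 push D rate mix weight mean assms(1) in auto)
    show "let F = (\<lambda>v. \<Sum>j\<in>UNIV. f j v);
             zhat = (\<lambda>j \<omega>. weighted_average (\<lambda>s. z s j \<omega>) \<tau>);
             Li = (\<lambda>j. subgradient_bound (f j) D);
             L = (\<Sum>j\<in>UNIV. Li j);
             Bi = (\<lambda>j. sqrt (real CARD('d)) * (Li j + c j))
         in (\<integral>\<omega>. F (zhat i \<omega>) - F zstar
                   + (\<Sum>j\<in>UNIV. \<mu> j * (norm (zhat j \<omega> - zstar))\<^sup>2) \<partial>M)
            \<le> 80 * L / (real \<tau> * del) * (lam / (1 - lam)) * (\<Sum>j\<in>UNIV. norm1 (x0 j))
              + 80 * p * L * real n * Max (range Bi) / (real \<tau> * del * (1 - lam))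
                  * (1 + ln (real \<tau> - 1))
              + p / real \<tau> * (\<Sum>j\<in>UNIV. (Li j + c j)\<^sup>2)"
      using expected_gap_le[OF _ \<tau>, of i] assms(1,2)
      unfolding gap_def F_def Lip_def[abs_def] L_def Let_def by simp
  qed
qed

end
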